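(* Let $n,d\in\mathbb{N}$, $n,d\ge1$. Assume $a\in\mathcal{M}^\#_{n,d}$ is self-adjoint (i.e. $a(x)=a(x)^*$ for a.e. $x$) and that $aX\in\ker(\operatorname{div}_\#)$ for all $X\in\mathbb{C}^{n\times d}$. Then $$a^{\mathrm{hom}}(\theta)=a^{\mathrm{hom}}(0)\quad\text{for all }\theta\in[-\pi,\pi)^d\setminus\{0\}$$ if, and only if, $a$ is constant.
   Context: $Y:=(0,1)^d$, $\Theta:=[-\pi,\pi)^d$. $\mathcal{M}^\#_{n,d}$ is the set of $a\in L^\infty(\mathbb{R}^d;L(\mathbb{C}^{n\times d}))$ with $a(\cdot+k)=a(\cdot)$ for all $k\in\mathbb{Z}^d$ such that for some $\nu>0$, $\operatorname{Re}a(x)=\frac12(a(x)+a(x)^* )\ge\nu1_{\mathbb{C}^{n\times d}}$ for a.e. $x$. For $\theta\in\Theta$, $H^1_\theta(Y)$ is the closure in $H^1(Y)$ of (restrictions of) smooth functions $\phi$ on $\mathbb{R}^d$ with $\phi(\cdot+k)=e^{\mathrm{i}\theta\cdot k}\phi(\cdot)$, $k\in\mathbb{Z}^d$; $\operatorname{grad}_\theta:[H^1_\theta(Y)]^n\subseteq[L^2(Y)]^n\to[L^2(Y)]^{n\times d}$, $(\phi_i)_i\mapsto(\partial_j\phi_i)_{ij}$; $\operatorname{grad}_\#:=\operatorname{grad}_0$ and $\operatorname{div}_\#:=-\operatorname{grad}_\#^*$. $aX$ denotes the function $y\mapsto a(y)X$ on $Y$. $H^1_\theta(Y)\perp e^{\mathrm{i}\theta\cdot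 y}$ is the set of elements of $H^1_\theta(Y)$ that are $L^2(Y)$-orthogonal to $y\mapsto e^{\mathrm{i}\theta\cdot y}$. The fibre-homogenised tensor $a^{\mathrm{hom}}(\theta)\in L(\mathbb{C}^{n\times d})$ is defined by $$a^{\mathrm{hom}}(\theta)X:=\int_Ye^{-\mathrm{i}\theta\cdot y}a(y)\big(\operatorname{grad}_\theta N_{\theta X}(y)+e^{\mathrm{i}\theta\cdot y}X\big)\,dy\qquad(X\in\mathbb{C}^{n\times d}),$$ where $N_{\theta X}\in[H^1_\theta(Y)\perp e^{\mathrm{i}\theta\cdot y}]^n$ is the unique solution of $\langle a(\operatorname{grad}_\theta N_{\theta X}+e^{\mathrm{i}\theta\cdot y}X),\operatorname{grad}_\theta\phi\rangle_{[L^2(Y)]^{n\times d}}=0$ for all $\phi\in[H^1_\theta(Y)\perp e^{\mathrm{i}\theta\cdot y}]^n$. *)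

theory Defs
  imports "HOL-Analysis.Analysis"
begin

text \<open>
  \<open>real ^ 'd\<close> is the physical space, an \<open>n \<times> d\<close> matrix is a vector
  \<open>complex ^ ('n \<times> 'd)\<close> indexed by pairs (row, column), and the linear operators on the space
  of such matrices are the square matrices \<open>complex ^ ('n \<times> 'd) ^ ('n \<times> 'd)\<close>, acting by \<open>*v\<close>.

  Elements of Lebesgue and Sobolev spaces are represented by functions on all of \<open>real ^ 'd\<close>;
  for spaces over the unit cell only the values on the cell matter, and only almost everywhere.
\<close>

section \<open>Operators on a finite-dimensional complex space\<close>

definition cadjoint :: "complex ^ 'm ^ 'm \<Rightarrow> complex ^ 'm ^ 'm" where
  "cadjoint A = (\<chi> i j. cnj (A $ j $ i))"

definition cinner :: "complex ^ 'm \<Rightarrow> complex ^ 'm \<Rightarrow> complex" where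
  "cinner X Z = (\<Sum>i\<in>UNIV. X $ i * cnj (Z $ i))"

definition pos_semidef :: "complex ^ 'm ^ 'm \<Rightarrow> bool" where
  "pos_semidef P \<longleftrightarrow> (\<forall>X. cinner (P *v X) X \<in> \<real> \<and> 0 \<le> Re (cinner (P *v X) X))"

definition re_part :: "complex ^ 'm ^ 'm \<Rightarrow> complex ^ 'm ^ 'm" where
  "re_part A = (1/2) *\<^sub>R (A + cadjoint A)"


section \<open>Coefficients\<close>

definition unit_cell :: "(real ^ 'd) set" where
  "unit_cell = {y. \<forall>i. 0 < y $ i \<and> y $ i < 1}"

definition theta_cell :: "(real ^ 'd) set" where
  "theta_cell = {\<theta>. \<forall>i. - pi \<le> \<theta> $ i \<and> \<theta> $ i < pi}"

definition lattice_vec :: "int ^ 'd \<Rightarrow> real ^ 'd" where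
  "lattice_vec k = (\<chi> i. of_int (k $ i))"

text \<open>The norm below is the Frobenius norm; in finite dimensions essential boundedness does not
  depend on the choice of norm.\<close>

definition M_per :: "(real ^ 'd \<Rightarrow> complex ^ ('n::finite \<times> 'd::finite) ^ ('n::finite \<times> 'd::finite)) set" where
  "M_per = {a. a \<in> borel_measurable lebesgue \<and>
               (\<exists>C. AE x in lebesgue. norm (a x) \<le> C) \<and>
               (\<forall>k. AE x in lebesgue. a (x + lattice_vec k) = a x) \<and>
               (\<exists>\<nu>>0. AE x in lebesgue. pos_semidef (re_part (a x) - \<nu> *\<^sub>R mat 1))}"


section \<open>Square-integrable functions on the unit cell\<close>

definition L2 :: "(real ^ 'd \<Rightarrow> 'b :: euclidean_space) set" where
  "L2 = {u. u \<in> borel_measurable (lebesgue_on unit_cell) \<and>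
            integrable (lebesgue_on unit_cell) (\<lambda>y. (norm (u y))\<^sup>2)}"

definition l2_inner :: "(real ^ 'd \<Rightarrow> complex) \<Rightarrow> (real ^ 'd \<Rightarrow> complex) \<Rightarrow> complex" where
  "l2_inner u v = (LINT y|lebesgue_on unit_cell. u y * cnj (v y))"

definition l2_inner_vec ::
    "(real ^ 'd \<Rightarrow> complex ^ 'm) \<Rightarrow> (real ^ 'd \<Rightarrow> complex ^ 'm) \<Rightarrow> complex" where
  "l2_inner_vec u v = (\<Sum>i\<in>UNIV. l2_inner (\<lambda>y. u y $ i) (\<lambda>y. v y $ i))"

definition l2_norm :: "(real ^ 'd \<Rightarrow> complex) \<Rightarrow> real" where
  "l2_norm u = sqrt (LINT y|lebesgue_on unit_cell. (norm (u y))\<^sup>2)"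


section \<open>Smooth functions, weak derivatives and Sobolev spaces\<close>

definition pd :: "'d \<Rightarrow> (real ^ 'd \<Rightarrow> complex) \<Rightarrow> real ^ 'd \<Rightarrow> complex" where
  "pd j f x = frechet_derivative f (at x) (axis j 1)"

text \<open>A function is of class \<open>C\<^sup>\<infinity>\<close> if it and all its iterated partial derivatives are (Frechet)
  differentiable everywhere; \<open>smooth\<close> is the largest class of differentiable functions that is
  closed under taking partial derivatives.\<close>

coinductive smooth :: "(real ^ 'd \<Rightarrow> complex) \<Rightarrow> bool" where
  "\<lbrakk>f differentiable_on UNIV; \<And>j. smooth (pd j f)\<rbrakk> \<Longrightarrow> smooth f"

definition test_function :: "(real ^ 'd \<Rightarrow> complex) \<Rightarrow> bool" where
  "test_function \<psi> \<longleftrightarrow>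
     smooth \<psi> \<and> (\<exists>K. compact K \<and> K \<subseteq> unit_cell \<and> (\<forall>x. x \<notin> K \<longrightarrow> \<psi> x = 0))"

definition has_weak_pd :: "'d \<Rightarrow> (real ^ 'd \<Rightarrow> complex) \<Rightarrow> (real ^ 'd \<Rightarrow> complex) \<Rightarrow> bool" where
  "has_weak_pd j u v \<longleftrightarrow>
     (\<forall>\<psi>. test_function \<psi> \<longrightarrow>
        (LINT y|lebesgue_on unit_cell. u y * pd j \<psi> y) =
        - (LINT y|lebesgue_on unit_cell. v y * \<psi> y))"

definition H1 :: "(real ^ 'd \<Rightarrow> complex) set" where
  "H1 = {u \<in> L2. \<forall>j. \<exists>v\<in>L2. has_weak_pd j u v}"

text \<open>For \<open>u\<close> in \<open>H1\<close> the weak derivative is unique up to almost everywhere equality on the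
  cell; \<open>weak_pd\<close> selects a representative.\<close>

definition weak_pd :: "'d \<Rightarrow> (real ^ 'd \<Rightarrow> complex) \<Rightarrow> real ^ 'd \<Rightarrow> complex" where
  "weak_pd j u = (SOME v. v \<in> L2 \<and> has_weak_pd j u v)"

definition h1_norm :: "(real ^ 'd \<Rightarrow> complex) \<Rightarrow> real" where
  "h1_norm u = sqrt ((l2_norm u)\<^sup>2 + (\<Sum>j\<in>UNIV. (l2_norm (weak_pd j u))\<^sup>2))"

definition quasi_periodic :: "real ^ 'd \<Rightarrow> (real ^ 'd \<Rightarrow> complex) \<Rightarrow> bool" where
  "quasi_periodic \<theta> \<phi> \<longleftrightarrow>
     (\<forall>k x. \<phi> (x + lattice_vec k) = exp (\<i> * of_real (\<theta> \<bullet> lattice_vec k)) * \<phi> x)"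

definition H1_theta :: "real ^ 'd \<Rightarrow> (real ^ 'd \<Rightarrow> complex) set" where
  "H1_theta \<theta> =
     {u \<in> H1. \<forall>\<epsilon>>0. \<exists>\<phi>. smooth \<phi> \<and> quasi_periodic \<theta> \<phi> \<and> h1_norm (\<lambda>x. u x - \<phi> x) < \<epsilon>}"

definition plane_wave :: "real ^ 'd \<Rightarrow> real ^ 'd \<Rightarrow> complex" where
  "plane_wave \<theta> y = exp (\<i> * of_real (\<theta> \<bullet> y))"

definition H1_theta_perp :: "real ^ 'd \<Rightarrow> (real ^ 'd \<Rightarrow> complex) set" where
  "H1_theta_perp \<theta> = {u \<in> H1_theta \<theta>. l2_inner u (plane_wave \<theta>) = 0}"

definition power_space ::
    "(real ^ 'd \<Rightarrow> complex) set \<Rightarrow> (real ^ 'd \<Rightarrow> complex ^ 'n) set" where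
  "power_space V = {u. \<forall>i. (\<lambda>y. u y $ i) \<in> V}"


section \<open>Gradient and divergence\<close>

text \<open>The operators \<open>grad\<^sub>\<theta>\<close> share this action and differ only in their domain
  \<open>power_space (H1_theta \<theta>)\<close>, which is imposed wherever \<open>grad\<close> is used.\<close>

definition grad :: "(real ^ 'd \<Rightarrow> complex ^ 'n) \<Rightarrow> real ^ 'd \<Rightarrow> complex ^ ('n::finite \<times> 'd::finite)" where
  "grad u y = (\<chi> p. weak_pd (snd p) (\<lambda>z. u z $ fst p) y)"

text \<open>Graphs of the Hilbert space adjoint of the periodic gradient and of the operator
  \<open>div = - grad\<^sup>*\<close>.\<close>

definition grad_per_adjoint ::
    "(real ^ 'd \<Rightarrow> complex ^ ('n::finite \<times> 'd::finite)) \<Rightarrow> (real ^ 'd \<Rightarrow> complex ^ 'n) \<Rightarrow> bool" where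
  "grad_per_adjoint q w \<longleftrightarrow>
     q \<in> L2 \<and> w \<in> L2 \<and>
     (\<forall>\<phi>\<in>power_space (H1_theta 0). l2_inner_vec (grad \<phi>) q = l2_inner_vec \<phi> w)"

definition div_per ::
    "(real ^ 'd \<Rightarrow> complex ^ ('n::finite \<times> 'd::finite)) \<Rightarrow> (real ^ 'd \<Rightarrow> complex ^ 'n) \<Rightarrow> bool" where
  "div_per q w \<longleftrightarrow> grad_per_adjoint q (\<lambda>y. - w y)"

definition ker_div_per :: "(real ^ 'd \<Rightarrow> complex ^ ('n::finite \<times> 'd::finite)) set" where
  "ker_div_per = {q. div_per q (\<lambda>y. 0)}"


section \<open>The fibre-homogenised tensor\<close>

definition is_corrector ::
    "(real ^ 'd \<Rightarrow> complex ^ ('n::finite \<times> 'd::finite) ^ ('n::finite \<times> 'd::finite)) \<Rightarrow> real ^ 'd \<Rightarrow> complex ^ ('n::finite \<times> 'd::finite) \<Rightarrow>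
     (real ^ 'd \<Rightarrow> complex ^ 'n) \<Rightarrow> bool" where
  "is_corrector a \<theta> X N \<longleftrightarrow>
     N \<in> power_space (H1_theta_perp \<theta>) \<and>
     (\<forall>\<phi>\<in>power_space (H1_theta_perp \<theta>).
        l2_inner_vec (\<lambda>y. a y *v (grad N y + plane_wave \<theta> y *s X)) (grad \<phi>) = 0)"

text \<open>The corrector is unique as an element of \<open>L\<^sup>2\<close>, that is, up to almost everywhere
  equality on the cell, so a representative is selected.\<close>

definition corrector ::
    "(real ^ 'd \<Rightarrow> complex ^ ('n::finite \<times> 'd::finite) ^ ('n::finite \<times> 'd::finite)) \<Rightarrow> real ^ 'd \<Rightarrow> complex ^ ('n::finite \<times> 'd::finite) \<Rightarrow>
     real ^ 'd \<Rightarrow> complex ^ 'n" where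
  "corrector a \<theta> X = (SOME N. is_corrector a \<theta> X N)"

definition a_hom ::
    "(real ^ 'd \<Rightarrow> complex ^ ('n::finite \<times> 'd::finite) ^ ('n::finite \<times> 'd::finite)) \<Rightarrow> real ^ 'd \<Rightarrow>
     complex ^ ('n::finite \<times> 'd::finite) \<Rightarrow> complex ^ ('n::finite \<times> 'd::finite)" where
  "a_hom a \<theta> X =
     (LINT y|lebesgue_on unit_cell.
        plane_wave (- \<theta>) y *s (a y *v (grad (corrector a \<theta> X) y + plane_wave \<theta> y *s X)))"

end

theory Submission
  imports Defs
begin

text \<open>Let \<open>b(p, q)\<close> be the real part of the integral of \<open>\<langle>a p, q\<rangle>\<close> over the cell, a symmetric and
coercive form because \<open>a\<close> is self-adjoint with positive real part. For a matrix \<open>X\<close> let \<open>F\<close> be the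
field \<open>plane_wave \<theta> \<cdot> X\<close> and \<open>P\<close> the gradient of its corrector. The corrector equation tested with the
corrector itself says \<open>b(F + P, P) = 0\<close>, so the real part of \<open>\<langle>a_hom \<theta> X, X\<rangle>\<close>, which is
\<open>b(F + P, F)\<close>, equals \<open>b(F, F) - b(P, P)\<close>. The plane wave has modulus one, hence \<open>b(F, F)\<close> is the real
part of \<open>\<langle>m X, X\<rangle>\<close>, with \<open>m\<close> the mean of \<open>a\<close> over the cell. By coercivity, \<open>a_hom \<theta>\<close> agrees with
\<open>m\<close> only if every \<open>P\<close> vanishes, that is, only if \<open>a F\<close> is orthogonal to the gradients of all
\<open>\<theta>\<close>-quasi-periodic functions perpendicular to the plane wave; and this orthogonality in turn gives
\<open>a_hom \<theta> = m\<close>. The two implications are \<open>orthogonal_if_a_hom_eq_mean\<close> and \<open>a_hom_eq_mean\<close>.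

For \<open>\<theta> = 0\<close> the orthogonality is the hypothesis that the columns of \<open>a\<close> are divergence free, so
\<open>a_hom 0 = m\<close>. If \<open>a\<close> is constant, it holds for every \<open>\<theta>\<close>: an integration by parts moves the derivative
onto the plane wave, which is an eigenfunction of it (\<open>constant_orthogonal\<close>). Conversely, let
\<open>a_hom \<theta> = m\<close> for \<open>\<theta>\<close> the \<open>j\<close>-th unit vector. Testing with the plane wave times a periodic \<open>\<psi>\<close> of mean
zero produces \<open>\<nabla>\<psi> + \<i> \<theta> \<psi>\<close>; the first summand is annihilated by the divergence condition, and the
second leaves the integral of \<open>(a X)\<^sub>i\<^sub>j\<close> against \<open>\<psi>\<close>. So this entry is orthogonal to all periodic
functions of mean zero and is constant (\<open>column_constant\<close>). The unit vectors lie in the admissible set of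
parameters because \<open>1 < pi\<close>.

The analysis behind this is the existence of correctors and the uniqueness of weak derivatives. The
corrector is a choice from a set of solutions, so the argument from \<open>a_hom \<theta> = m\<close> can only start once this
set is known to be nonempty. For a parameter with \<open>exp (\<i> \<theta>\<^sub>j) \<noteq> 1\<close> this follows by minimising \<open>b\<close> over
gradient fields in \<open>L\<^sup>2\<close> (\<open>riesz_on_subspace\<close>): the gradients form a closed subspace, since
\<open>\<phi>(y + e\<^sub>j) - \<phi>(y) = (exp (\<i> \<theta>\<^sub>j) - 1) \<phi>(y)\<close> bounds a quasi-periodic \<open>\<phi>\<close> by its \<open>j\<close>-th derivative alone
(\<open>quasi_periodic_poincare\<close>). Square-integrable functions modulo null sets are made into a type \<open>l2\<close>, a
complete real inner product space, and all limits are taken there. Weak derivatives are unique by the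
fundamental lemma of the calculus of variations, which rests on smooth approximations of indicator
functions of boxes.\<close>

section \<open>Smooth functions and bumps\<close>

lemma pd_eqI: "(f has_derivative D) (at x) \<Longrightarrow> pd j f x = D (axis j 1)"
  by (simp add: pd_def frechet_derivative_at[symmetric])

lemma smooth_differentiable: "smooth f \<Longrightarrow> f differentiable (at x)"
  by (cases rule: smooth.cases) (auto simp: differentiable_on_def)

lemma smooth_pd: "smooth f \<Longrightarrow> smooth (pd j f)"
  by (cases rule: smooth.cases) auto

lemma smooth_has_derivative: "smooth f \<Longrightarrow> (f has_derivative frechet_derivative f (at x)) (at x)"
  using frechet_derivative_works smooth_differentiable by blast

lemma smooth_continuous_on: "smooth f \<Longrightarrow> continuous_on S f"
  by (meson continuous_at_imp_continuous_on differentiable_imp_continuous_within smooth_differentiable)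

lemma pd_add:
  assumes "f differentiable (at x)" "g differentiable (at x)"
  shows "pd j (\<lambda>x. f x + g x) x = pd j f x + pd j g x"
  using has_derivative_add[OF assms[unfolded frechet_derivative_works]]
  by (subst pd_eqI) (auto simp: pd_def)

lemma pd_mult:
  assumes "f differentiable (at x)" "g differentiable (at x)"
  shows "pd j (\<lambda>x. f x * g x) x = f x * pd j g x + pd j f x * g x"
  using has_derivative_mult[OF assms[unfolded frechet_derivative_works]]
  by (subst pd_eqI) (auto simp: pd_def)

lemma pd_const: "pd j (\<lambda>x. c) = (\<lambda>x. 0)"
  by (rule ext, subst pd_eqI, rule has_derivative_const) auto

lemma pd_diff:
  assumes "f differentiable (at x)" "g differentiable (at x)"
  shows "pd j (\<lambda>x. f x - g x) x = pd j f x - pd j g x"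
  using has_derivative_diff[OF assms[unfolded frechet_derivative_works]]
  by (subst pd_eqI) (auto simp: pd_def)

lemma pd_cmult: "smooth f \<Longrightarrow> pd j (\<lambda>x. c * f x) x = c * pd j f x"
  using pd_mult[of "\<lambda>_. c" x f j] by (simp add: smooth_differentiable pd_const)

text \<open>The predicate \<open>smooth\<close> is coinductive, so differentiable functions are smooth as soon as they form a class closed under
partial derivatives. The classes that arise naturally are not closed: the derivative of a product or of a
composite is a polynomial expression in members of the class. The algebra generated by a class together
with all smooth functions absorbs such expressions, which gives a coinduction principle up to algebra.\<close>

inductive smooth_alg :: "((real ^ 'd \<Rightarrow> complex) \<Rightarrow> bool) \<Rightarrow> (real ^ 'd \<Rightarrow> complex) \<Rightarrow> bool"
  for P where
    gen: "P f \<Longrightarrow> smooth_alg P f"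
  | smooth: "smooth f \<Longrightarrow> smooth_alg P f"
  | add: "smooth_alg P f \<Longrightarrow> smooth_alg P g \<Longrightarrow> smooth_alg P (\<lambda>x. f x + g x)"
  | mult: "smooth_alg P f \<Longrightarrow> smooth_alg P g \<Longrightarrow> smooth_alg P (\<lambda>x. f x * g x)"

lemma smooth_alg_imp_smooth:
  assumes step: "\<And>f. P f \<Longrightarrow> f differentiable_on UNIV \<and> (\<forall>j. smooth_alg P (pd j f))"
    and "smooth_alg P f"
  shows "smooth f"
proof -
  have key: "f differentiable_on UNIV \<and> (\<forall>j. smooth_alg P (pd j f))" if "smooth_alg P f" for f
    using that
  proof induction
    case (gen f)
    then show ?case by (rule step)
  next
    case (smooth f)
    then show ?case
      by (auto simp: differentiable_on_def smooth_differentiable smooth_pd intro: smooth_alg.smooth)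
  next
    case (add f g)
    then have "pd j (\<lambda>x. f x + g x) = (\<lambda>x. pd j f x + pd j g x)" for j
      by (auto simp: differentiable_on_def intro!: pd_add)
    with add show ?case by (auto intro!: differentiable_on_add smooth_alg.add)
  next
    case (mult f g)
    then have "pd j (\<lambda>x. f x * g x) = (\<lambda>x. f x * pd j g x + pd j f x * g x)" for j
      by (auto simp: differentiable_on_def intro!: pd_mult)
    with mult show ?case
      by (auto intro!: differentiable_on_mult smooth_alg.add smooth_alg.mult)
  qed
  show ?thesis
    using \<open>smooth_alg P f\<close> by (coinduction arbitrary: f) (use key in auto)
qed

lemma smooth_add: "smooth f \<Longrightarrow> smooth g \<Longrightarrow> smooth (\<lambda>x. f x + g x)"
  by (rule smooth_alg_imp_smooth[of "\<lambda>_. False"]) (auto intro: smooth_alg.intros)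

lemma smooth_mult: "smooth f \<Longrightarrow> smooth g \<Longrightarrow> smooth (\<lambda>x. f x * g x)"
  by (rule smooth_alg_imp_smooth[of "\<lambda>_. False"]) (auto intro: smooth_alg.intros)

lemma smooth_const: "smooth (\<lambda>x. c)"
proof (rule smooth_alg_imp_smooth[of "\<lambda>f. \<exists>c. f = (\<lambda>x. c)"])
  show "smooth_alg (\<lambda>f. \<exists>c. f = (\<lambda>x. c)) (\<lambda>x. c)"
    by (rule smooth_alg.gen) auto
qed (auto simp: pd_const intro!: smooth_alg.gen)

lemma smooth_diff: "smooth f \<Longrightarrow> smooth g \<Longrightarrow> smooth (\<lambda>x. f x - g x)"
  using smooth_add[OF _ smooth_mult[OF smooth_const[of "-1"]], of f g] by simp

lemma smooth_prod: "(\<And>i. i \<in> I \<Longrightarrow> smooth (f i)) \<Longrightarrow> smooth (\<lambda>x. \<Prod>i\<in>I. f i x)"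
  by (induction I rule: infinite_finite_induct) (auto intro: smooth_mult smooth_const)

lemma smooth_inner:
  fixes v :: "real ^ 'd"
  shows "smooth (\<lambda>x. complex_of_real (v \<bullet> x))"
proof (rule smooth_alg_imp_smooth[of "\<lambda>f. f = (\<lambda>x. complex_of_real (v \<bullet> x))"])
  have *: "((\<lambda>x. complex_of_real (v \<bullet> x)) has_derivative (\<lambda>h. complex_of_real (v \<bullet> h))) (at x)" for x
    by (auto intro!: derivative_eq_intros)
  have "pd j (\<lambda>x. complex_of_real (v \<bullet> x)) = (\<lambda>x. complex_of_real (v $ j))" for j
    by (rule ext, subst pd_eqI[OF *]) (simp add: inner_axis)
  then show "f differentiable_on UNIV \<and> (\<forall>j. smooth_alg (\<lambda>f. f = (\<lambda>x. complex_of_real (v \<bullet> x))) (pd j f))"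
    if "f = (\<lambda>x. complex_of_real (v \<bullet> x))" for f
    using that * by (auto simp: smooth_const differentiable_on_def differentiable_def intro!: smooth_alg.smooth)
qed (auto intro: smooth_alg.gen)

lemma smooth_coord: "smooth (\<lambda>x. complex_of_real (x $ i))"
  using smooth_inner[of "axis i 1"] by (simp add: inner_axis')

text \<open>A composite \<open>G\<^sub>0 \<circ> h\<close> with a function of one variable is smooth if \<open>G\<^sub>0\<close> comes with a sequence \<open>G\<close> of
successive derivatives: by the chain rule the partial derivatives of \<open>G\<^sub>n \<circ> h\<close> are products of
\<open>G\<^sub>n\<^sub>+\<^sub>1 \<circ> h\<close> with smooth functions.\<close>

lemma smooth_compose:
  assumes G: "\<And>n t. (G n has_vector_derivative G (Suc n) t) (at t)"
    and h: "smooth (\<lambda>x. complex_of_real (h x))"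
  shows "smooth (\<lambda>x. G n (h x))"
proof (rule smooth_alg_imp_smooth[of "\<lambda>f. \<exists>n. f = (\<lambda>x. G n (h x))"])
  define D where "D x = (\<lambda>v. Re (frechet_derivative (\<lambda>x. complex_of_real (h x)) (at x) v))" for x
  have D: "(h has_derivative D x) (at x)" for x
    using has_derivative_Re[OF smooth_has_derivative[OF h]] by (simp add: D_def)
  have pdh: "pd j (\<lambda>x. complex_of_real (h x)) x = complex_of_real (D x (axis j 1))" for j x
    by (intro pd_eqI has_derivative_of_real D)
  have der: "((\<lambda>x. G n (h x)) has_derivative (\<lambda>v. D x v *\<^sub>R G (Suc n) (h x))) (at x)" for n x
    using has_derivative_compose[OF D G[unfolded has_vector_derivative_def]] by simp
  have pdG: "pd j (\<lambda>x. G n (h x)) = (\<lambda>x. G (Suc n) (h x) * pd j (\<lambda>x. complex_of_real (h x)) x)" for n j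
    by (rule ext) (simp add: pd_eqI[OF der] pdh scaleR_conv_of_real)
  fix f assume "\<exists>n. f = (\<lambda>x. G n (h x))"
  then obtain n where f: "f = (\<lambda>x. G n (h x))" by auto
  have "f differentiable_on UNIV"
    using der unfolding f differentiable_on_def differentiable_def by (metis UNIV_I)
  moreover have "smooth_alg (\<lambda>f. \<exists>n. f = (\<lambda>x. G n (h x))) (pd j f)" for j
    unfolding f pdG using smooth_pd[OF h]
    by (intro smooth_alg.mult smooth_alg.gen smooth_alg.smooth) auto
  ultimately show "f differentiable_on UNIV \<and> (\<forall>j. smooth_alg (\<lambda>f. \<exists>n. f = (\<lambda>x. G n (h x))) (pd j f))"
    by blast
qed (auto intro: smooth_alg.gen)

lemma smooth_cos:
  assumes "smooth (\<lambda>x. complex_of_real (h x))"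
  shows "smooth (\<lambda>x. complex_of_real (cos (h x)))"
proof -
  define G where "G n t = complex_of_real (cos (t + of_nat n * (pi/2)))" for n t
  have "(G n has_vector_derivative G (Suc n) t) (at t)" for n t
  proof -
    have *: "cos (t + of_nat (Suc n) * (pi/2)) = - sin (t + of_nat n * (pi/2))"
      using minus_sin_cos_eq[of "t + of_nat n * (pi/2)"] by (simp add: algebra_simps add_divide_distrib)
    show ?thesis
      unfolding G_def * by (auto intro!: derivative_eq_intros has_vector_derivative_of_real simp: has_real_derivative_iff_has_vector_derivative[symmetric])
  qed
  from smooth_compose[of G, OF this assms, of 0] show ?thesis by (simp add: G_def)
qed

lemma plane_wave_derivative:
  "(plane_wave \<theta> has_derivative (\<lambda>h. \<i> * of_real (\<theta> \<bullet> h) * plane_wave \<theta> x)) (at x)"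
proof -
  have "((\<lambda>y. \<i> * of_real (\<theta> \<bullet> y)) has_derivative (\<lambda>h. \<i> * of_real (\<theta> \<bullet> h))) (at x)"
    by (auto intro!: derivative_eq_intros)
  from has_derivative_compose[OF this DERIV_exp[unfolded has_field_derivative_def]]
  show ?thesis by (simp add: plane_wave_def[abs_def] mult_ac)
qed

lemma pd_plane_wave: "pd j (plane_wave \<theta>) x = \<i> * of_real (\<theta> $ j) * plane_wave \<theta> x"
  by (subst pd_eqI[OF plane_wave_derivative]) (simp add: inner_axis)

lemma smooth_plane_wave: "smooth (plane_wave \<theta>)"
proof (rule smooth_alg_imp_smooth[of "\<lambda>f. f = plane_wave \<theta>"])
  fix f assume f: "f = plane_wave \<theta>"
  have "smooth_alg (\<lambda>f. f = plane_wave \<theta>) (\<lambda>x. \<i> * of_real (\<theta> $ j) * plane_wave \<theta> x)" for j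
    by (intro smooth_alg.mult smooth_alg.gen smooth_alg.smooth smooth_const) auto
  moreover have "pd j (plane_wave \<theta>) = (\<lambda>x. \<i> * of_real (\<theta> $ j) * plane_wave \<theta> x)" for j
    by (rule ext) (rule pd_plane_wave)
  ultimately show "f differentiable_on UNIV \<and> (\<forall>j. smooth_alg (\<lambda>f. f = plane_wave \<theta>) (pd j f))"
    using plane_wave_derivative unfolding f differentiable_on_def differentiable_def by (metis UNIV_I)
qed (auto intro: smooth_alg.gen)

definition exp_bump :: "real \<Rightarrow> real" where
  "exp_bump t = (if t > 0 then exp (- 1 / t) else 0)"

lemma poly_exp_decay: "((\<lambda>s. poly p s * exp (- s)) \<longlongrightarrow> (0::real)) at_top"
proof -
  have "((\<lambda>s. \<Sum>i\<le>degree p. coeff p i * (s ^ i / exp s)) \<longlongrightarrow> (\<Sum>i\<le>degree p. coeff p i * 0)) at_top"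
    by (intro tendsto_sum tendsto_mult tendsto_const tendsto_power_div_exp_0)
  then show ?thesis
    by (simp add: poly_altdef sum_distrib_left exp_minus divide_inverse mult_ac)
qed

text \<open>The functions equal to \<open>p(1/t) exp(-1/t)\<close> for \<open>t > 0\<close> and to zero for \<open>t \<le> 0\<close>, with \<open>p\<close> a polynomial,
are closed under differentiation. At the origin this holds because \<open>s p(s) exp(-s)\<close> tends to zero as
\<open>s = 1/t\<close> grows.\<close>

lemma exp_bump_chain:
  fixes p :: "real poly"
  defines "F \<equiv> \<lambda>p t. if t > 0 then poly p (1/t) * exp (- 1/t) else (0::real)"
  shows "(F p has_real_derivative F (monom 1 2 * (p - pderiv p)) t) (at t)"
proof -
  consider "t > 0" | "t < 0" | "t = 0" by linarith
  then show ?thesis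
  proof cases
    case 1
    have "((\<lambda>t. poly p (1/t) * exp (- 1/t)) has_real_derivative F (monom 1 2 * (p - pderiv p)) t) (at t)"
      using 1 unfolding F_def
      by (auto intro!: derivative_eq_intros DERIV_chain2[OF poly_DERIV] simp: poly_monom field_simps power2_eq_square)
    moreover have "\<forall>\<^sub>F s in nhds t. F p s = poly p (1/s) * exp (- 1/s)"
      using eventually_nhds_in_open[of "{0<..}" t] 1 by (auto simp: F_def elim!: eventually_mono)
    ultimately show ?thesis by (simp add: DERIV_cong_ev)
  next
    case 2
    have "\<forall>\<^sub>F s in nhds t. F p s = 0"
      using eventually_nhds_in_open[of "{..<0}" t] 2 by (auto simp: F_def elim!: eventually_mono)
    then show ?thesis using 2
      by (subst DERIV_cong_ev[OF refl _ refl]) (auto simp: F_def)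
  next
    case 3
    have "((\<lambda>h. (F p (0 + h) - F p 0) / h) \<longlongrightarrow> 0) (at 0)"
    proof (rule filterlim_split_at)
      show "((\<lambda>h. (F p (0 + h) - F p 0) / h) \<longlongrightarrow> 0) (at_left 0)"
        by (rule tendsto_eventually) (auto simp: eventually_at_left_field F_def intro!: exI[of _ "-1"])
      have "((\<lambda>h. poly (monom 1 1 * p) (inverse h) * exp (- inverse h)) \<longlongrightarrow> 0) (at_right (0::real))"
        by (rule filterlim_compose[OF poly_exp_decay filterlim_inverse_at_top_right])
      then show "((\<lambda>h. (F p (0 + h) - F p 0) / h) \<longlongrightarrow> 0) (at_right 0)"
        by (rule Lim_transform_eventually)
          (auto simp: eventually_at_right_field F_def poly_monom field_simps intro!: exI[of _ 1])
    qed
    then show ?thesis using 3 unfolding DERIV_def by (simp add: F_def)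
  qed
qed

lemma smooth_exp_bump:
  assumes "smooth (\<lambda>x. complex_of_real (h x))"
  shows "smooth (\<lambda>x. complex_of_real (exp_bump (h x)))"
proof -
  \<comment> \<open>The polynomial factor of the \<open>n\<close>-th derivative of \<open>exp (- 1 / t)\<close>.\<close>
  define p where "p = rec_nat 1 (\<lambda>_ q. monom 1 2 * (q - pderiv q :: real poly))"
  define G where "G n t = complex_of_real (if t > 0 then poly (p n) (1/t) * exp (- 1/t) else 0)" for n and t :: real
  have "(G n has_vector_derivative G (Suc n) t) (at t)" for n t
    using has_vector_derivative_of_real[OF exp_bump_chain[of "p n" t]]
    by (simp add: G_def[abs_def] p_def if_distrib cong: if_cong)
  from smooth_compose[of G, OF this assms, of 0] show ?thesis
    by (simp add: G_def p_def exp_bump_def if_distrib cong: if_cong)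
qed

text \<open>A smooth function with values between 0 and 1 that vanishes wherever some \<open>h i\<close> is at most \<open>1 / k\<close> and
that tends, for \<open>k \<rightarrow> \<infinity>\<close>, to the indicator function of the set on which all \<open>h i\<close> are positive.
The subtraction of 1 keeps the support away from the boundary of this set, so that it becomes compact when
the set is a box.\<close>

definition bump :: "('d \<Rightarrow> real ^ 'd \<Rightarrow> real) \<Rightarrow> nat \<Rightarrow> real ^ 'd \<Rightarrow> real" where
  "bump h k x = (\<Prod>i\<in>UNIV. exp_bump (of_nat k * h i x - 1))"

lemma smooth_bump:
  assumes "\<And>i. smooth (\<lambda>x. complex_of_real (h i x))"
  shows "smooth (\<lambda>x. complex_of_real (bump h k x))"
proof -
  have "smooth (\<lambda>x. complex_of_real (of_nat k * h i x - 1))" for i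
    using smooth_diff[OF smooth_mult[OF smooth_const[of "of_nat k"] assms[of i]] smooth_const[of 1]] by simp
  then show ?thesis
    unfolding bump_def of_real_prod by (intro smooth_prod smooth_exp_bump)
qed

lemma exp_bump_bounds: "0 \<le> exp_bump t" "exp_bump t \<le> 1"
  by (auto simp: exp_bump_def)

lemma bump_bounds: "0 \<le> bump h k x" "bump h k x \<le> 1"
  unfolding bump_def by (auto intro!: prod_nonneg prod_le_1 exp_bump_bounds)

lemma bump_eq_0: "of_nat k * h i x \<le> 1 \<Longrightarrow> bump h k x = 0"
  by (auto simp: bump_def exp_bump_def not_less)

lemma bump_tendsto:
  "(\<lambda>k. bump h k x) \<longlonglongrightarrow> indicator {x. \<forall>i. 0 < h i x} x"
proof -
  have 1: "(\<lambda>k. exp_bump (of_nat k * h i x - 1)) \<longlonglongrightarrow> (if 0 < h i x then 1 else 0)" for i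
  proof (cases "0 < h i x")
    case True
    have "filterlim (\<lambda>k. real k * h i x - 1) at_top sequentially"
      using filterlim_tendsto_add_at_top[OF tendsto_const[of "-1"] filterlim_tendsto_pos_mult_at_top[OF tendsto_const True filterlim_real_sequentially]]
      by (simp add: mult.commute)
    then have "((\<lambda>k. exp (- inverse (real k * h i x - 1))) \<longlongrightarrow> exp (- 0)) sequentially"
      by (intro tendsto_exp tendsto_minus filterlim_compose[OF tendsto_inverse_0_at_top]) (auto intro: filterlim_ident)
    moreover have "\<forall>\<^sub>F k in sequentially. exp (- inverse (real k * h i x - 1)) = exp_bump (real k * h i x - 1)"
      using eventually_compose_filterlim[OF eventually_gt_at_top[of 0] \<open>filterlim _ at_top sequentially\<close>]
      by eventually_elim (auto simp: exp_bump_def field_simps)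
    ultimately show ?thesis using True by (auto intro: Lim_transform_eventually)
  next
    case False
    then have "real k * h i x - 1 \<le> 0" for k
      by (smt (verit) mult_nonneg_nonpos of_nat_0_le_iff)
    then show ?thesis using False by (auto simp: exp_bump_def leD)
  qed
  have "(\<lambda>k. bump h k x) \<longlonglongrightarrow> (\<Prod>i\<in>UNIV. if 0 < h i x then 1 else 0)"
    unfolding bump_def by (intro tendsto_prod 1)
  also have "(\<Prod>i\<in>UNIV. if 0 < h i x then 1 else 0) = (indicator {x. \<forall>i. 0 < h i x} x :: real)"
    by (auto simp: indicator_def)
  finally show ?thesis .
qed

section \<open>The unit cell and the fundamental lemma\<close>

abbreviation cell :: "(real ^ 'd) measure" where
  "cell \<equiv> lebesgue_on unit_cell"

lemma unit_cell_box: "unit_cell = box 0 (\<chi> i. (1::real))"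
  by (auto simp: unit_cell_def mem_box_cart)

lemma unit_cell_borel [measurable, simp]: "unit_cell \<in> sets borel"
  unfolding unit_cell_box by simp

lemma unit_cell_lebesgue [measurable, simp]: "unit_cell \<in> sets lebesgue"
  by (simp add: sets_completionI_sets)

lemma measure_unit_cell: "emeasure lebesgue (unit_cell :: (real ^ 'd) set) = 1"
proof -
  have "emeasure lborel (box 0 (\<chi> i. (1::real)) :: (real ^ 'd) set) = (\<Prod>b\<in>Basis. ((\<chi> i. 1) - 0 :: real ^ 'd) \<bullet> b)"
    by (rule emeasure_lborel_box) (auto simp: Basis_vec_def inner_axis)
  also have "\<dots> = 1"
    by (subst prod.neutral) (auto simp: Basis_vec_def inner_axis)
  finally show ?thesis by (simp add: unit_cell_box)
qed

lemma prob_cell: "emeasure cell unit_cell = 1"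
  using measure_unit_cell by (simp add: emeasure_restrict_space)

lemma finite_measure_cell: "finite_measure (cell :: (real ^ 'd) measure)"
  by (rule finite_measureI) (simp add: prob_cell)

lemma integral_cell_const [simp]:
  "(LINT y|(cell :: (real ^ 'd) measure). (c :: 'b :: {banach, second_countable_topology})) = c"
  by (simp add: measure_def prob_cell)

lemma continuous_measurable_cell:
  fixes f :: "real ^ 'd \<Rightarrow> 'b :: real_normed_vector"
  assumes "continuous_on UNIV f" shows "f \<in> borel_measurable cell"
proof -
  have "f \<in> borel_measurable lebesgue"
    using borel_measurable_continuous_onI[OF assms] by (auto intro: measurable_completion)
  then show ?thesis by (rule measurable_restrict_space1)
qed

lemma continuous_bounded_on_cell:
  fixes f :: "real ^ 'd \<Rightarrow> 'b :: real_normed_vector"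
  assumes "continuous_on UNIV f" shows "\<exists>C\<ge>0. \<forall>y\<in>unit_cell. norm (f y) \<le> C"
proof -
  have "bounded (f ` cbox 0 (\<chi> i. 1))"
    by (intro compact_imp_bounded compact_continuous_image continuous_on_subset[OF assms]) auto
  then obtain C where C: "\<And>y. y \<in> cbox 0 (\<chi> i. 1) \<Longrightarrow> norm (f y) \<le> C"
    by (auto simp: bounded_iff)
  have "norm (f y) \<le> max C 0" if "y \<in> unit_cell" for y
    using C[of y] that box_subset_cbox by (fastforce simp: unit_cell_box)
  then show ?thesis by (intro exI[of _ "max C 0"]) auto
qed

lemma integrable_cell_bounded:
  fixes f :: "real ^ 'd \<Rightarrow> 'b :: {banach, second_countable_topology}"
  assumes "f \<in> borel_measurable cell" "AE y in cell. norm (f y) \<le> C"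
  shows "integrable cell f"
  using finite_measure.integrable_const_bound[OF finite_measure_cell assms(2,1)] .

lemma AE_cellI: "(\<And>y. y \<in> unit_cell \<Longrightarrow> P y) \<Longrightarrow> AE y in cell. P y"
  by (rule AE_I2) auto

lemma integrable_cell_continuous:
  fixes f :: "real ^ 'd \<Rightarrow> 'b :: {banach, second_countable_topology}"
  assumes "continuous_on UNIV f" shows "integrable cell f"
proof -
  obtain C where "\<forall>y\<in>unit_cell. norm (f y) \<le> C" using continuous_bounded_on_cell[OF assms] by auto
  then show ?thesis
    by (intro integrable_cell_bounded[of _ C] continuous_measurable_cell assms AE_cellI) auto
qed

text \<open>The boxes generate the Borel sets and are stable under intersection, so the integral vanishes over every
Borel set and, by completion, over every measurable set.\<close>

lemma zero_if_box_integrals_zero: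
  fixes v :: "real ^ 'd \<Rightarrow> complex"
  assumes v: "integrable cell v"
    and box: "\<And>a b. (\<And>i. 0 \<le> a $ i \<and> a $ i < b $ i \<and> b $ i \<le> 1) \<Longrightarrow>
                (LINT y|cell. indicator (box a b) y *\<^sub>R v y) = 0"
  shows "AE y in cell. v y = 0"
proof -
  define w where "w = (\<lambda>x. indicat_real unit_cell x *\<^sub>R v x)"
  have w: "integrable lebesgue w"
    using v by (simp add: integrable_restrict_space w_def)
  have wA: "(LINT x:A|lebesgue. w x) = (LINT y|cell. indicat_real A y *\<^sub>R v y)" for A
    by (subst integral_restrict_space) (auto simp: set_lebesgue_integral_def w_def mult_ac)
  have wi: "set_integrable lebesgue A w" if "A \<in> sets lebesgue" for A
    using that w by (simp add: set_integrable_def integrable_mult_indicator)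
  have gen: "(LINT x:A|lebesgue. w x) = 0" if range: "A \<in> range (\<lambda>(a, b). box a b)" for A
  proof -
    obtain a b where A: "A = box a b" using range by auto
    \<comment> \<open>Outside the cell \<open>w\<close> vanishes, so a box may be replaced by its intersection with the cell.\<close>
    define a' :: "real ^ 'd" where "a' = (\<chi> i. max (a $ i) 0)"
    define b' :: "real ^ 'd" where "b' = (\<chi> i. min (b $ i) 1)"
    have eq: "indicat_real A x *\<^sub>R w x = indicat_real (box a' b') x *\<^sub>R w x" for x
      by (auto simp: A w_def indicator_def a'_def b'_def mem_box_cart unit_cell_def)
    show ?thesis
    proof (cases "\<forall>i. a' $ i < b' $ i")
      case True
      have "(LINT x:A|lebesgue. w x) = (LINT x:box a' b'|lebesgue. w x)"
        by (simp only: set_lebesgue_integral_def eq)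
      also have "\<dots> = 0" unfolding wA using True by (intro box) (auto simp: a'_def b'_def)
      finally show ?thesis .
    next
      case False
      then have "box a' b' = {}" by (auto simp: mem_box_cart) (meson less_trans)
      then show ?thesis by (simp add: set_lebesgue_integral_def eq)
    qed
  qed
  have all: "(LINT x:UNIV|lebesgue. w x) = 0"
  proof -
    have "(LINT x:UNIV|lebesgue. w x) = (LINT x:box 0 (\<chi> i. 1)|lebesgue. w x)"
      by (auto simp: set_lebesgue_integral_def w_def unit_cell_box indicator_def intro!: Bochner_Integration.integral_cong)
    then show ?thesis using gen by auto
  qed
  have leb: "A \<in> sets lebesgue" if "A \<in> sigma_sets UNIV (range (\<lambda>(a, b). box a b))" for A :: "(real ^ 'd) set"
  proof -
    have "A \<in> sets borel" using that unfolding borel_eq_box by simp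
    then show ?thesis by (simp add: sets_completionI_sets)
  qed
  have borel: "(LINT x:A|lebesgue. w x) = 0" if "A \<in> sets borel" for A
  proof -
    have "Int_stable (range (\<lambda>(a, b). box a b :: (real ^ 'd) set))"
      by (auto simp: Int_stable_def box_Int_box)
    moreover have "range (\<lambda>(a, b). box a b :: (real ^ 'd) set) \<subseteq> Pow UNIV" by simp
    moreover have "A \<in> sigma_sets UNIV (range (\<lambda>(a, b). box a b))"
      using that unfolding borel_eq_box by simp
    ultimately show ?thesis
    proof (induction rule: sigma_sets_induct_disjoint)
      case (basic A) then show ?case by (rule gen)
    next
      case empty then show ?case by (simp add: set_lebesgue_integral_def)
    next
      case (compl A)
      then have A: "A \<in> sets lebesgue" "UNIV - A \<in> sets lebesgue"
        using leb[of A] sets.compl_sets[of A lebesgue] by auto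
      have "(LINT x:A \<union> (UNIV - A)|lebesgue. w x) = (LINT x:A|lebesgue. w x) + (LINT x:UNIV - A|lebesgue. w x)"
        using A by (intro set_integral_Un wi) auto
      then show ?case using all compl.IH by simp
    next
      case (union F)
      then have F: "F i \<in> sets lebesgue" for i
        by (intro leb) auto
      have "(LINT x:(\<Union>i. F i)|lebesgue. w x) = (\<Sum>i. (LINT x:F i|lebesgue. w x))"
        using F union(1) by (intro lebesgue_integral_countable_add wi) (auto simp: disjoint_family_on_def)
      then show ?case using union.IH by simp
    qed
  qed
  have "(LINT x:A|lebesgue. w x) = 0" if A: "A \<in> sets lebesgue" for A
  proof -
    obtain S N N' where SN: "A = S \<union> N" "N \<subseteq> N'" "N' \<in> null_sets lborel" "S \<in> sets lborel"
      using sets_completionE[OF A] by metis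
    have N': "AE x in lebesgue. x \<notin> N'"
      using SN(3) by (intro AE_not_in null_sets_completionI)
    have "(LINT x:A|lebesgue. w x) = (LINT x:S|lebesgue. w x)"
      unfolding set_lebesgue_integral_def
    proof (rule integral_cong_AE)
      show "AE x in lebesgue. indicat_real A x *\<^sub>R w x = indicat_real S x *\<^sub>R w x"
        using N' by eventually_elim (use SN in \<open>auto simp: indicator_def\<close>)
      have "S \<in> sets lebesgue" using SN(4) by (rule sets_completionI_sets)
      then show "(\<lambda>x. indicat_real A x *\<^sub>R w x) \<in> borel_measurable lebesgue"
        "(\<lambda>x. indicat_real S x *\<^sub>R w x) \<in> borel_measurable lebesgue"
        using A w by auto
    qed
    then show ?thesis using borel[of S] SN by simp
  qed
  then have zero: "(LINT y:A|cell. v y) = 0" if "A \<in> sets cell" for A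
    using that wA[of A] by (auto simp: set_lebesgue_integral_def sets_restrict_space sets.Int)
  interpret finite_measure "cell :: (real ^ 'd) measure" by (rule finite_measure_cell)
  show ?thesis by (rule density_zero[OF v zero])
qed

text \<open>Dominated convergence along the bumps turns the hypothesis into vanishing integrals over boxes. Leaving
\<open>h\<close> free serves two purposes: quadratic \<open>h\<close> gives compactly supported bumps, trigonometric \<open>h\<close> gives
periodic ones.\<close>

lemma zero_if_bump_integrals_zero:
  fixes v :: "real ^ 'd \<Rightarrow> complex"
  assumes v: "integrable cell v"
    and bumps: "\<And>a b. (\<And>i. 0 \<le> a $ i \<and> a $ i < b $ i \<and> b $ i \<le> 1) \<Longrightarrow>
       \<exists>h. (\<forall>i. smooth (\<lambda>x. complex_of_real (h i x))) \<and>
           (\<forall>x\<in>unit_cell. (\<forall>i. 0 < h i x) \<longleftrightarrow> x \<in> box a b) \<and>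
           (\<forall>k. (LINT y|cell. v y * complex_of_real (bump h k y)) = 0)"
  shows "AE y in cell. v y = 0"
proof (rule zero_if_box_integrals_zero[OF v])
  fix a b :: "real ^ 'd" assume ab: "\<And>i. 0 \<le> a $ i \<and> a $ i < b $ i \<and> b $ i \<le> 1"
  obtain h where h: "\<And>i. smooth (\<lambda>x. complex_of_real (h i x))"
    "\<And>x. x \<in> unit_cell \<Longrightarrow> (\<forall>i. 0 < h i x) \<longleftrightarrow> x \<in> box a b"
    "\<And>k. (LINT y|cell. v y * complex_of_real (bump h k y)) = 0"
    using bumps[OF ab] by auto
  have [measurable]: "(\<lambda>y. complex_of_real (bump h k y)) \<in> borel_measurable cell" for k
    by (intro continuous_measurable_cell smooth_continuous_on smooth_bump h)
  have [measurable]: "v \<in> borel_measurable cell" using v by auto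
  have [measurable]: "box a b \<inter> unit_cell \<in> sets cell"
    unfolding sets_restrict_space by (subst Int_commute) (intro imageI sets_completionI_sets, simp)
  have eq: "indicat_real (box a b) y *\<^sub>R v y = indicat_real (box a b \<inter> unit_cell) y *\<^sub>R v y" if "y \<in> unit_cell" for y
    using that by (auto simp: indicator_def)
  have "(\<lambda>k. LINT y|cell. v y * complex_of_real (bump h k y)) \<longlonglongrightarrow>
        (LINT y|cell. indicator (box a b \<inter> unit_cell) y *\<^sub>R v y)"
  proof (rule integral_dominated_convergence[where w="\<lambda>y. norm (v y)"])
    show "AE y in cell. (\<lambda>k. v y * complex_of_real (bump h k y)) \<longlonglongrightarrow> indicat_real (box a b \<inter> unit_cell) y *\<^sub>R v y"
    proof (rule AE_cellI)
      fix y :: "real ^ 'd" assume y: "y \<in> unit_cell"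
      have "(\<lambda>k. complex_of_real (bump h k y)) \<longlonglongrightarrow> complex_of_real (indicator {x. \<forall>i. 0 < h i x} y)"
        by (intro tendsto_of_real bump_tendsto)
      then have "(\<lambda>k. v y * complex_of_real (bump h k y)) \<longlonglongrightarrow> v y * complex_of_real (indicator {x. \<forall>i. 0 < h i x} y)"
        by (intro tendsto_mult tendsto_const)
      also have "v y * complex_of_real (indicator {x. \<forall>i. 0 < h i x} y) = indicat_real (box a b \<inter> unit_cell) y *\<^sub>R v y"
        using h(2)[OF y] y by (auto simp: indicator_def)
      finally show "(\<lambda>k. v y * complex_of_real (bump h k y)) \<longlonglongrightarrow> indicat_real (box a b \<inter> unit_cell) y *\<^sub>R v y" .
    qed
    show "AE y in cell. norm (v y * complex_of_real (bump h k y)) \<le> norm (v y)" for k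
      by (intro AE_I2) (simp add: norm_mult mult_right_le_one_le bump_bounds)
  qed (use v in auto)
  then have "(LINT y|cell. indicator (box a b \<inter> unit_cell) y *\<^sub>R v y) = 0"
    by (simp add: h(3) LIMSEQ_const_iff)
  also have "(LINT y|cell. indicator (box a b \<inter> unit_cell) y *\<^sub>R v y) = (LINT y|cell. indicator (box a b) y *\<^sub>R v y)"
    by (intro Bochner_Integration.integral_cong) (auto simp: eq)
  finally show "(LINT y|cell. indicator (box a b) y *\<^sub>R v y) = 0" .
qed

theorem fundamental_lemma_test_functions:
  assumes v: "integrable cell v"
    and test: "\<And>\<psi>. test_function \<psi> \<Longrightarrow> (LINT y|cell. v y * \<psi> y) = 0"
  shows "AE y in cell. v y = 0"
proof (rule zero_if_bump_integrals_zero[OF v])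
  fix a b :: "real ^ 'a" assume ab: "\<And>i. 0 \<le> a $ i \<and> a $ i < b $ i \<and> b $ i \<le> 1"
  define h :: "'a \<Rightarrow> real ^ 'a \<Rightarrow> real" where "h i x = (x $ i - a $ i) * (b $ i - x $ i)" for i x
  have h: "smooth (\<lambda>x. complex_of_real (h i x))" for i
    unfolding h_def of_real_mult of_real_diff
    by (intro smooth_mult smooth_diff smooth_coord smooth_const)
  have pos: "0 < h i x \<longleftrightarrow> a $ i < x $ i \<and> x $ i < b $ i" for i x
    using ab[of i] by (auto simp: h_def zero_less_mult_iff)
  have "test_function (\<lambda>y. complex_of_real (bump h k y))" for k
  proof (cases "k = 0")
    case True
    have "bump h 0 y = 0" for y by (rule bump_eq_0[where i=undefined]) simp
    then show ?thesis using True by (auto simp: test_function_def smooth_const intro!: exI[of _ "{}"])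
  next
    case False
    define K where "K = {x. \<forall>i. 1 / real k \<le> h i x}"
    have sub: "K \<subseteq> box a b"
    proof
      fix x assume "x \<in> K"
      then have "1 / real k \<le> h i x" for i by (auto simp: K_def)
      moreover have "0 < 1 / real k" using False by simp
      ultimately have "0 < h i x" for i by (rule less_le_trans[rotated])
      then show "x \<in> box a b" by (simp add: mem_box_cart pos)
    qed
    have "closed K"
      unfolding K_def h_def by (intro closed_Collect_all closed_Collect_le continuous_intros)
    then have "compact K"
      using sub bounded_subset[OF bounded_box] by (auto simp: compact_eq_bounded_closed)
    moreover have "box a b \<subseteq> unit_cell"
      unfolding unit_cell_def by (auto simp: mem_box_cart) (meson ab le_less_trans less_le_trans)+
    moreover have "bump h k x = 0" if "x \<notin> K" for x
      using that False by (auto simp: K_def not_le field_simps intro: bump_eq_0[OF less_imp_le])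
    ultimately show ?thesis
      using sub by (auto simp: test_function_def smooth_bump h intro!: exI[of _ K])
  qed
  then show "\<exists>h. (\<forall>i. smooth (\<lambda>x. complex_of_real (h i x))) \<and>
      (\<forall>x\<in>unit_cell. (\<forall>i. 0 < h i x) \<longleftrightarrow> x \<in> box a b) \<and>
      (\<forall>k. (LINT y|cell. v y * complex_of_real (bump h k y)) = 0)"
    using h pos by (intro exI[of _ h]) (auto simp: mem_box_cart test)
qed

text \<open>An interval \<open>(a, b)\<close> in \<open>(0, 1)\<close> with midpoint \<open>m\<close> and half-length \<open>r\<close> is the set on which
\<open>cos (2 pi (t - m)) > cos (2 pi r)\<close>, because \<open>r \<le> 1/2\<close>. The resulting bumps are periodic.\<close>

theorem fundamental_lemma_periodic:
  assumes v: "integrable cell v"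
    and per: "\<And>\<psi>. smooth (\<lambda>y. complex_of_real (\<psi> y)) \<Longrightarrow> quasi_periodic 0 (\<lambda>y. complex_of_real (\<psi> y)) \<Longrightarrow>
                (LINT y|cell. v y * complex_of_real (\<psi> y)) = 0"
  shows "AE y in cell. v y = 0"
proof (rule zero_if_bump_integrals_zero[OF v])
  fix a b :: "real ^ 'a" assume ab: "\<And>i. 0 \<le> a $ i \<and> a $ i < b $ i \<and> b $ i \<le> 1"
  define m where "m i = (a $ i + b $ i) / 2" for i
  define r where "r i = (b $ i - a $ i) / 2" for i
  define h :: "'a \<Rightarrow> real ^ 'a \<Rightarrow> real"
    where "h i x = cos (2 * pi * (x $ i - m i)) - cos (2 * pi * r i)" for i x
  have "smooth (\<lambda>x. complex_of_real (2 * pi * (x $ i - m i)))" for i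
    unfolding of_real_mult of_real_diff by (intro smooth_mult smooth_diff smooth_coord smooth_const)
  then have h: "smooth (\<lambda>x. complex_of_real (h i x))" for i
    unfolding h_def of_real_diff by (intro smooth_diff smooth_cos smooth_const)
  have hper: "h i (x + lattice_vec k) = h i x" for i x k
  proof -
    have "cos (2 * pi * ((x + lattice_vec k) $ i - m i)) = cos (2 * pi * (x $ i - m i) + 2 * pi * of_int (k $ i))"
      by (simp add: lattice_vec_def algebra_simps)
    also have "\<dots> = cos (2 * pi * (x $ i - m i))"
      unfolding cos_add cos_int_2pin sin_int_2pin by simp
    finally show ?thesis unfolding h_def by (rule arg_cong)
  qed
  have pos: "0 < h i x \<longleftrightarrow> a $ i < x $ i \<and> x $ i < b $ i" if "x \<in> unit_cell" for i x
  proof -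
    have x: "0 < x $ i" "x $ i < 1" using that by (auto simp: unit_cell_def)
    define s where "s = \<bar>x $ i - m i\<bar>"
    have s: "0 \<le> s" "s < 1 - r i" and r: "0 < r i" "r i \<le> 1/2"
      using x ab[of i] by (auto simp: s_def m_def r_def field_simps abs_if)
    have c: "cos (2 * pi * (x $ i - m i)) = cos (2 * pi * s)"
    proof -
      have "2 * pi * s = \<bar>2 * pi * (x $ i - m i)\<bar>" by (simp add: s_def abs_mult)
      then show ?thesis by (simp only: cos_abs_real)
    qed
    have iff: "a $ i < x $ i \<and> x $ i < b $ i \<longleftrightarrow> s < r i"
      by (auto simp: s_def m_def r_def abs_if field_simps)
    \<comment> \<open>The cosine decreases up to \<open>s = 1/2\<close> and is symmetric about it; beyond, \<open>s < 1 - r\<close> excludes large values.\<close>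
    have "cos (2 * pi * r i) < cos (2 * pi * s) \<longleftrightarrow> s < r i"
    proof (cases "s \<le> 1/2")
      case True
      then show ?thesis using s r by (subst cos_mono_less_eq) (auto simp: field_simps)
    next
      case False
      have "cos (2 * pi * s) = cos (2 * pi * (1 - s))"
        using cos_2pi_minus[of "2 * pi * s"] by (simp add: algebra_simps)
      moreover have "pi * (s + r i) < pi * 1"
        using s by (intro mult_strict_left_mono) auto
      then have "cos (2 * pi * r i) < cos (2 * pi * (1 - s)) \<longleftrightarrow> 1 - s < r i"
        using s r False \<open>pi * (s + r i) < pi * 1\<close> by (subst cos_mono_less_eq) (auto simp: field_simps)
      moreover have "\<not> 1 - s < r i" "\<not> s < r i" using s r False by auto
      ultimately show ?thesis by simp
    qed
    then show ?thesis using iff c by (simp add: h_def)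
  qed
  have "quasi_periodic 0 (\<lambda>y. complex_of_real (bump h k y))" for k
    by (simp add: quasi_periodic_def bump_def hper)
  then have "(LINT y|cell. v y * complex_of_real (bump h k y)) = 0" for k
    by (intro per smooth_bump h)
  then show "\<exists>h. (\<forall>i. smooth (\<lambda>x. complex_of_real (h i x))) \<and>
      (\<forall>x\<in>unit_cell. (\<forall>i. 0 < h i x) \<longleftrightarrow> x \<in> box a b) \<and>
      (\<forall>k. (LINT y|cell. v y * complex_of_real (bump h k y)) = 0)"
    using h pos by (intro exI[of _ h]) (auto simp: mem_box_cart)
qed

section \<open>Integration by parts on the unit cell\<close>

lemma integral_cell_lborel:
  fixes g :: "real ^ 'd \<Rightarrow> 'b :: {banach, second_countable_topology}"
  assumes "continuous_on UNIV g"
  shows "(LINT y|cell. g y) = (LINT y|lborel. indicator unit_cell y *\<^sub>R g y)"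
proof -
  have "g \<in> borel_measurable borel" by (rule borel_measurable_continuous_onI[OF assms])
  then show ?thesis
    by (subst integral_restrict_space) (auto intro!: integral_completion)
qed

lemma lborel_integral_translate:
  fixes f :: "'a :: euclidean_space \<Rightarrow> 'b :: {banach, second_countable_topology}"
  assumes [measurable]: "f \<in> borel_measurable borel"
  shows "(LINT x|lborel. f (x + c)) = (LINT x|lborel. f x)"
proof -
  have "(LINT x|lborel. f x) = (LINT x|distr lborel borel ((+) c). f x)"
    by (simp add: lborel_distr_plus)
  also have "\<dots> = (LINT x|lborel. f (c + x))"
    by (rule integral_distr) auto
  finally show ?thesis by (simp add: add.commute)
qed

lemma AE_lborel_coord_neq: "AE x in (lborel :: (real ^ 'd) measure). x $ j \<noteq> (c :: real)"
proof -
  have "{x :: real ^ 'd. x $ j = c} \<in> null_sets lborel"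
  proof -
    have eq: "{x :: real ^ 'd. x $ j = c} = {x. axis j 1 \<bullet> x = c}" by (simp add: inner_axis')
    have "negligible {x :: real ^ 'd. axis j 1 \<bullet> x = c}" by (rule negligible_hyperplane) auto
    moreover have "{x :: real ^ 'd. axis j 1 \<bullet> x = c} \<in> sets lborel"
      using closed_hyperplane[of "axis j 1 :: real ^ 'd" c] by simp
    ultimately show ?thesis unfolding eq negligible_iff_null_sets by (auto simp: null_sets_def)
  qed
  then show ?thesis by (auto dest: AE_not_in)
qed

text \<open>Shifting the cell by \<open>t\<close> in direction \<open>j\<close> cuts off a slab and attaches the translate of this slab by a
period on the other side.\<close>

lemma integral_cell_shift:
  fixes g :: "real ^ 'd \<Rightarrow> 'b :: {banach, second_countable_topology}"
  assumes g: "continuous_on UNIV g" and per: "\<And>x. g (x + axis j 1) = g x"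
    and t: "0 \<le> t" "t \<le> 1"
  shows "(LINT y|cell. g (y + t *\<^sub>R axis j 1)) = (LINT y|cell. g y)"
proof -
  define e :: "real ^ 'd" where "e = axis j 1"
  have e: "e $ i = (if i = j then 1 else 0)" for i by (simp add: e_def axis_def)
  have [measurable]: "g \<in> borel_measurable borel" by (rule borel_measurable_continuous_onI[OF g])
  have gs: "continuous_on UNIV (\<lambda>y. g (y + t *\<^sub>R e))"
    by (intro continuous_on_compose2[OF g] continuous_intros) auto
  define A where "A = {x :: real ^ 'd. x \<in> unit_cell \<and> t < x $ j}"
  define B where "B = {x :: real ^ 'd. x \<in> unit_cell \<and> x $ j < t}"
  have [measurable]: "A \<in> sets borel" "B \<in> sets borel"
  proof -
    have "A = unit_cell \<inter> {x. x $ j > t}" "B = unit_cell \<inter> {x. x $ j < t}"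
      by (auto simp: A_def B_def)
    then show "A \<in> sets borel" "B \<in> sets borel"
      by (auto intro!: borel_open open_halfspace_component_gt_cart open_halfspace_component_lt_cart)
  qed
  have sub: "integrable lborel (\<lambda>x. indicat_real T x *\<^sub>R g x)" if "T \<subseteq> cbox a b" "T \<in> sets borel" for T a b
  proof -
    have "set_integrable lborel (cbox a b) g"
      unfolding set_integrable_def by (intro borel_integrable_compact continuous_on_subset[OF g]) auto
    then show ?thesis
      using that set_integrable_subset[of lborel "cbox a b" g T] by (auto simp: set_integrable_def)
  qed
  have iA: "integrable lborel (\<lambda>x. indicat_real A x *\<^sub>R g x)"
    and iB: "integrable lborel (\<lambda>x. indicat_real B x *\<^sub>R g x)"
    by (auto intro!: sub[of _ 0 "\<chi> i. 1"] simp: A_def B_def unit_cell_def mem_box_cart less_imp_le)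
  have Be: "indicat_real B (x - e) = indicat_real ((\<lambda>x. x - e) -` B) x" for x
    by (auto simp: indicator_def)
  have iB': "integrable lborel (\<lambda>x. indicat_real B (x - e) *\<^sub>R g x)"
  proof -
    have "(\<lambda>x. x - e) -` B \<in> sets borel"
      using measurable_sets[of "\<lambda>x. x - e" borel borel B] by simp
    moreover have "(\<lambda>x. x - e) -` B \<subseteq> cbox e (e + (\<chi> i. 1))"
      by (auto simp: B_def unit_cell_def mem_box_cart less_imp_le) (smt (verit))+
    ultimately show ?thesis unfolding Be by (intro sub)
  qed
  have "(LINT y|cell. g (y + t *\<^sub>R e)) = (LINT x|lborel. indicat_real unit_cell x *\<^sub>R g (x + t *\<^sub>R e))"
    by (rule integral_cell_lborel[OF gs])
  also have "\<dots> = (LINT x|lborel. indicat_real unit_cell (x - t *\<^sub>R e) *\<^sub>R g x)"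
    using lborel_integral_translate[of "\<lambda>x. indicat_real unit_cell (x - t *\<^sub>R e) *\<^sub>R g x" "t *\<^sub>R e"] by simp
  also have "\<dots> = (LINT x|lborel. indicat_real A x *\<^sub>R g x + indicat_real B (x - e) *\<^sub>R g x)"
  proof (rule integral_cong_AE)
    show "AE x in lborel. indicat_real unit_cell (x - t *\<^sub>R e) *\<^sub>R g x =
      indicat_real A x *\<^sub>R g x + indicat_real B (x - e) *\<^sub>R g x"
      using AE_lborel_coord_neq[of j 1]
    proof eventually_elim
      case (elim x)
      have "indicat_real unit_cell (x - t *\<^sub>R e) = indicat_real A x + indicat_real B (x - e)"
      proof (cases "\<forall>i. i \<noteq> j \<longrightarrow> 0 < x $ i \<and> x $ i < 1")
        case True
        have U: "z \<in> unit_cell \<longleftrightarrow> 0 < z $ j \<and> z $ j < 1" if "\<forall>i. i \<noteq> j \<longrightarrow> z $ i = x $ i" for z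
          using True that unfolding unit_cell_def mem_Collect_eq by metis
        have "x - t *\<^sub>R e \<in> unit_cell \<longleftrightarrow> t < x $ j \<and> x $ j < 1 + t"
          "x \<in> A \<longleftrightarrow> t < x $ j \<and> x $ j < 1"  "x - e \<in> B \<longleftrightarrow> 1 < x $ j \<and> x $ j < 1 + t"
          using t by (auto simp: U A_def B_def e)
        then show ?thesis using elim t by (auto simp: indicator_def)
      next
        case False
        then obtain i where "i \<noteq> j" "\<not> (0 < x $ i \<and> x $ i < 1)" by auto
        then have "x - t *\<^sub>R e \<notin> unit_cell" "x \<notin> A" "x - e \<notin> B"
          by (auto simp: unit_cell_def A_def B_def e intro!: exI[of _ i])
        then show ?thesis by simp
      qed
      then show ?case by (simp add: scaleR_left_distrib)
    qed
  qed auto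
  also have "\<dots> = (LINT x|lborel. indicat_real A x *\<^sub>R g x) + (LINT x|lborel. indicat_real B (x - e) *\<^sub>R g x)"
    by (rule Bochner_Integration.integral_add[OF iA iB'])
  also have "(LINT x|lborel. indicat_real B (x - e) *\<^sub>R g x) = (LINT x|lborel. indicat_real B x *\<^sub>R g x)"
    using lborel_integral_translate[of "\<lambda>x. indicat_real B (x - e) *\<^sub>R g x" e] per by (simp add: e_def)
  also have "(LINT x|lborel. indicat_real A x *\<^sub>R g x) + (LINT x|lborel. indicat_real B x *\<^sub>R g x) =
     (LINT x|lborel. indicat_real A x *\<^sub>R g x + indicat_real B x *\<^sub>R g x)"
    by (rule Bochner_Integration.integral_add[OF iA iB, symmetric])
  also have "\<dots> = (LINT x|lborel. indicat_real unit_cell x *\<^sub>R g x)"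
  proof (rule integral_cong_AE)
    show "AE x in lborel. indicat_real A x *\<^sub>R g x + indicat_real B x *\<^sub>R g x = indicat_real unit_cell x *\<^sub>R g x"
      using AE_lborel_coord_neq[of j t]
      by eventually_elim (auto simp: A_def B_def indicator_def)
  qed auto
  also have "\<dots> = (LINT y|cell. g y)" by (rule integral_cell_lborel[OF g, symmetric])
  finally show ?thesis by (simp add: e_def)
qed

definition diff_quot :: "'d \<Rightarrow> (real ^ 'd \<Rightarrow> complex) \<Rightarrow> nat \<Rightarrow> real ^ 'd \<Rightarrow> complex" where
  "diff_quot j g m y = of_nat (Suc m) * (g (y + (1 / real (Suc m)) *\<^sub>R axis j 1) - g y)"

lemma smooth_line_derivative:
  assumes "smooth g"
  shows "((\<lambda>s. g (y + s *\<^sub>R axis j 1)) has_vector_derivative pd j g (y + s *\<^sub>R axis j 1)) (at s within S)"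
proof -
  define D where "D = frechet_derivative g (at (y + s *\<^sub>R axis j 1))"
  have D: "(g has_derivative D) (at (y + s *\<^sub>R axis j 1))"
    unfolding D_def by (rule smooth_has_derivative[OF assms])
  have "((\<lambda>s. y + s *\<^sub>R axis j 1) has_derivative (\<lambda>h. h *\<^sub>R axis j 1)) (at s within S)"
    by (auto intro!: derivative_eq_intros)
  from has_derivative_compose[OF this D]
  show ?thesis
    by (simp add: has_vector_derivative_def pd_eqI[OF D] linear_scale[OF has_derivative_linear[OF D]])
qed

lemma diff_quot_tendsto:
  assumes "smooth g"
  shows "(\<lambda>m. diff_quot j g m y) \<longlonglongrightarrow> pd j g y"
proof -
  have "((\<lambda>s. (g (y + s *\<^sub>R axis j 1) - g y) /\<^sub>R s) \<longlongrightarrow> pd j g y) (at 0)"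
  proof -
    have "((\<lambda>s. norm (g (y + s *\<^sub>R axis j 1) - g y - s *\<^sub>R pd j g y) / norm s) \<longlongrightarrow> 0) (at 0)"
      using smooth_line_derivative[OF assms, of y j 0 UNIV] by (simp add: has_vector_derivative_def has_derivative_at)
    moreover have "\<forall>\<^sub>F s in at (0::real). norm (g (y + s *\<^sub>R axis j 1) - g y - s *\<^sub>R pd j g y) / norm s =
        norm ((g (y + s *\<^sub>R axis j 1) - g y) /\<^sub>R s - pd j g y)"
      unfolding eventually_at_filter
    proof (intro always_eventually allI impI)
      fix s :: real assume "s \<noteq> 0"
      then have "(g (y + s *\<^sub>R axis j 1) - g y) /\<^sub>R s - pd j g y = (g (y + s *\<^sub>R axis j 1) - g y - s *\<^sub>R pd j g y) /\<^sub>R s"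
        by (simp add: scaleR_diff_right)
      then show "norm (g (y + s *\<^sub>R axis j 1) - g y - s *\<^sub>R pd j g y) / norm s =
        norm ((g (y + s *\<^sub>R axis j 1) - g y) /\<^sub>R s - pd j g y)"
        by (simp add: divide_inverse)
    qed
    ultimately have "((\<lambda>s. norm ((g (y + s *\<^sub>R axis j 1) - g y) /\<^sub>R s - pd j g y)) \<longlongrightarrow> 0) (at 0)"
      by (rule Lim_transform_eventually)
    then show ?thesis by (simp add: tendsto_norm_zero_iff LIM_zero_iff)
  qed
  moreover have "filterlim (\<lambda>m. 1 / real (Suc m)) (at 0) sequentially"
    by (intro filterlim_atI lim_1_over_n LIMSEQ_Suc) auto
  ultimately have "(\<lambda>m. (g (y + (1 / real (Suc m)) *\<^sub>R axis j 1) - g y) /\<^sub>R (1 / real (Suc m))) \<longlonglongrightarrow> pd j g y"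
    by (rule filterlim_compose)
  then show ?thesis by (simp add: diff_quot_def scaleR_conv_of_real divide_inverse)
qed

lemma diff_quot_bounded:
  assumes g: "smooth g" and S: "bounded S"
  shows "\<exists>C. \<forall>y\<in>S. \<forall>m. norm (diff_quot j g m y) \<le> C"
proof -
  obtain R where R: "\<And>y. y \<in> S \<Longrightarrow> norm y \<le> R" using S by (auto simp: bounded_iff)
  have "bounded (pd j g ` cball 0 (R + 1))"
    by (intro compact_imp_bounded compact_continuous_image smooth_continuous_on smooth_pd g) auto
  then obtain C where "\<forall>x\<in>cball 0 (R + 1). norm (pd j g x) \<le> C"
    by (auto simp: bounded_iff)
  then have C: "norm (pd j g x) \<le> C" if "norm x \<le> R + 1" for x using that by simp
  have "norm (diff_quot j g m y) \<le> C" if "y \<in> S" for y m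
  proof -
    let ?t = "1 / real (Suc m)"
    have "norm (g (y + ?t *\<^sub>R axis j 1) - g (y + 0 *\<^sub>R axis j 1)) \<le> C * norm (?t - 0)"
    proof (rule differentiable_bound[where f="\<lambda>s. g (y + s *\<^sub>R axis j 1)" and S="{0..1}"])
      fix s :: real assume s: "s \<in> {0..1}"
      show "((\<lambda>s. g (y + s *\<^sub>R axis j 1)) has_derivative (\<lambda>h. h *\<^sub>R pd j g (y + s *\<^sub>R axis j 1))) (at s within {0..1})"
        using smooth_line_derivative[OF g] by (simp add: has_vector_derivative_def)
      have "norm (y + s *\<^sub>R axis j 1) \<le> norm y + norm (s *\<^sub>R axis j (1::real))" by (rule norm_triangle_ineq)
      also have "\<dots> \<le> R + 1" using s R[OF that] by (auto simp: norm_axis_1)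
      finally have "norm (pd j g (y + s *\<^sub>R axis j 1)) \<le> C" by (rule C)
      then show "onorm (\<lambda>h. h *\<^sub>R pd j g (y + s *\<^sub>R axis j 1)) \<le> C"
        by (intro onorm_le) (simp add: mult.commute[of C] mult_left_mono)
    qed auto
    then have "real (Suc m) * norm (g (y + ?t *\<^sub>R axis j 1) - g y) \<le> C"
      by (simp add: field_simps)
    then show ?thesis by (simp only: diff_quot_def norm_mult norm_of_nat)
  qed
  then show ?thesis by blast
qed

lemma diff_quot_continuous: "smooth g \<Longrightarrow> continuous_on UNIV (diff_quot j g m)"
  unfolding diff_quot_def
  by (intro continuous_intros continuous_on_compose2[OF smooth_continuous_on]) auto

text \<open>The integral of a difference quotient of \<open>g\<close> vanishes by translation invariance; difference quotients
are uniformly bounded on bounded sets and converge to the derivative. This replaces Fubini's theorem and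
the fundamental theorem of calculus, and covers periodic functions on the cell as well as compactly
supported ones.\<close>

lemma integral_pd_zero:
  assumes g: "smooth g" and S: "bounded S" "S \<in> sets borel"
    and inv: "\<And>t. 0 \<le> t \<Longrightarrow> t \<le> 1 \<Longrightarrow>
      (LINT y|lborel. indicator S y *\<^sub>R g (y + t *\<^sub>R axis j 1)) = (LINT y|lborel. indicator S y *\<^sub>R g y)"
  shows "(LINT y|lborel. indicator S y *\<^sub>R pd j g y) = 0"
proof -
  have int: "integrable lborel (\<lambda>y. indicat_real S y *\<^sub>R f y)" if "continuous_on UNIV f" for f :: "real ^ 'a \<Rightarrow> complex"
  proof -
    obtain a where a: "S \<subseteq> cbox (-a) a" using bounded_subset_cbox_symmetric[OF S(1)] by auto
    have "set_integrable lborel (cbox (-a) a) f"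
      unfolding set_integrable_def by (intro borel_integrable_compact continuous_on_subset[OF that]) auto
    then have "set_integrable lborel S f" by (rule set_integrable_subset) (use a S(2) in auto)
    then show ?thesis by (simp add: set_integrable_def)
  qed
  obtain C where C: "\<And>y m. y \<in> S \<Longrightarrow> norm (diff_quot j g m y) \<le> C"
    using diff_quot_bounded[OF g S(1)] by metis
  have gc: "continuous_on UNIV g" by (rule smooth_continuous_on[OF g])
  have gs: "continuous_on UNIV (\<lambda>y. g (y + t *\<^sub>R axis j 1))" for t
    by (intro continuous_on_compose2[OF gc] continuous_intros) auto
  have [measurable]: "pd j g \<in> borel_measurable borel" "diff_quot j g m \<in> borel_measurable borel" "S \<in> sets borel" for m
    using borel_measurable_continuous_onI[OF smooth_continuous_on[OF smooth_pd[OF g]]]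
     borel_measurable_continuous_onI[OF diff_quot_continuous[OF g]] S(2) by auto
  have "(\<lambda>m. LINT y|lborel. indicat_real S y *\<^sub>R diff_quot j g m y) \<longlonglongrightarrow> (LINT y|lborel. indicat_real S y *\<^sub>R pd j g y)"
  proof (rule integral_dominated_convergence[where w="\<lambda>y. indicat_real S y *\<^sub>R C"])
    show "integrable lborel (\<lambda>y. indicat_real S y *\<^sub>R C)"
      using S bounded_set_imp_lmeasurable[of S] emeasure_bounded_finite[OF S(1)] by (auto intro!: integrable_real_indicator)
    show "AE y in lborel. (\<lambda>m. indicat_real S y *\<^sub>R diff_quot j g m y) \<longlonglongrightarrow> indicat_real S y *\<^sub>R pd j g y"
      by (intro AE_I2 tendsto_intros diff_quot_tendsto g)
    show "AE y in lborel. norm (indicat_real S y *\<^sub>R diff_quot j g m y) \<le> indicat_real S y *\<^sub>R C" for m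
      by (intro AE_I2) (auto simp: indicator_def C)
  qed auto
  moreover have "(LINT y|lborel. indicat_real S y *\<^sub>R diff_quot j g m y) = 0" for m
  proof -
    have "(LINT y|lborel. indicat_real S y *\<^sub>R diff_quot j g m y) =
      (LINT y|lborel. of_nat (Suc m) * (indicat_real S y *\<^sub>R g (y + (1 / real (Suc m)) *\<^sub>R axis j 1) - indicat_real S y *\<^sub>R g y))"
      by (simp add: diff_quot_def scaleR_conv_of_real algebra_simps)
    also have "\<dots> = of_nat (Suc m) * ((LINT y|lborel. indicat_real S y *\<^sub>R g (y + (1 / real (Suc m)) *\<^sub>R axis j 1)) - (LINT y|lborel. indicat_real S y *\<^sub>R g y))"
      by (subst integral_mult_right_zero, subst Bochner_Integration.integral_diff) (auto intro!: int gs gc)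
    also have "\<dots> = 0" by (subst inv) (auto simp: field_simps)
    finally show ?thesis .
  qed
  ultimately show ?thesis by (simp add: LIMSEQ_const_iff)
qed

lemma lattice_axis: "axis j 1 = lattice_vec (axis j 1)"
  by (simp add: lattice_vec_def vec_eq_iff axis_def)

lemma integral_pd_periodic:
  assumes g: "smooth g" and per: "\<And>x. g (x + axis j 1) = g x"
  shows "(LINT y|cell. pd j g y) = 0"
proof -
  have gc: "continuous_on UNIV g" by (rule smooth_continuous_on[OF g])
  have gs: "continuous_on UNIV (\<lambda>y. g (y + t *\<^sub>R axis j 1))" for t
    by (intro continuous_on_compose2[OF gc] continuous_intros) auto
  have "(LINT y|lborel. indicator unit_cell y *\<^sub>R pd j g y) = 0"
  proof (rule integral_pd_zero[OF g])
    show "bounded (unit_cell :: (real ^ 'a) set)" by (simp add: unit_cell_box)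
    fix t :: real assume "0 \<le> t" "t \<le> 1"
    from integral_cell_shift[OF gc per this]
    show "(LINT y|lborel. indicator unit_cell y *\<^sub>R g (y + t *\<^sub>R axis j 1)) = (LINT y|lborel. indicator unit_cell y *\<^sub>R g y)"
      by (simp add: integral_cell_lborel gc gs)
  qed auto
  then show ?thesis by (simp add: integral_cell_lborel smooth_continuous_on[OF smooth_pd[OF g]])
qed

lemma pd_eq_0_off:
  assumes K: "compact K" "\<And>x. x \<notin> K \<Longrightarrow> g x = 0" and x: "x \<notin> K"
  shows "pd j g x = 0"
proof -
  have "((\<lambda>_. 0) has_derivative (\<lambda>_. 0)) (at x)" by simp
  then have "(g has_derivative (\<lambda>_. 0)) (at x)"
    by (rule has_derivative_transform_within_open[of _ _ _ _ "-K"])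
      (use K x compact_imp_closed[of K] in auto)
  then show ?thesis by (simp add: pd_eqI)
qed

lemma integral_pd_compact_support:
  assumes g: "smooth g" and K: "compact K" "K \<subseteq> unit_cell" "\<And>x. x \<notin> K \<Longrightarrow> g x = 0"
  shows "(LINT y|cell. pd j g y) = 0"
proof -
  \<comment> \<open>A region that contains every set \<open>K - t e\<^sub>j\<close> with \<open>0 \<le> t \<le> 1\<close>.\<close>
  define S :: "(real ^ 'a) set" where "S = box (\<chi> i. -1) (\<chi> i. 2)"
  have KS: "indicat_real S y *\<^sub>R g (y + t *\<^sub>R axis j 1) = g (y + t *\<^sub>R axis j 1)" if "0 \<le> t" "t \<le> 1" for y t
  proof (cases "y + t *\<^sub>R axis j 1 \<in> K")
    case True
    then have "0 < y $ i + t * axis j 1 $ i \<and> y $ i + t * axis j 1 $ i < 1" for i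
      using K(2) by (auto simp: unit_cell_def subset_iff dest!: spec)
    moreover have "0 \<le> t * axis j 1 $ i \<and> t * axis j 1 $ i \<le> 1" for i
      using that by (auto simp: axis_def)
    ultimately have "-1 < y $ i \<and> y $ i < 2" for i by (smt (verit))
    then show ?thesis by (simp add: S_def mem_box_cart)
  qed (simp add: K)
  have [measurable]: "g \<in> borel_measurable borel"
    by (rule borel_measurable_continuous_onI[OF smooth_continuous_on[OF g]])
  have "(LINT y|lborel. indicator S y *\<^sub>R pd j g y) = 0"
  proof (rule integral_pd_zero[OF g])
    fix t :: real assume "0 \<le> t" "t \<le> 1"
    then show "(LINT y|lborel. indicator S y *\<^sub>R g (y + t *\<^sub>R axis j 1)) = (LINT y|lborel. indicator S y *\<^sub>R g y)"
      using KS[where t=0] by (simp add: KS lborel_integral_translate)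
  qed (auto simp: S_def)
  also have "(\<lambda>y. indicat_real S y *\<^sub>R pd j g y) = (\<lambda>y. indicat_real unit_cell y *\<^sub>R pd j g y)"
  proof
    fix y
    have "unit_cell \<subseteq> S"
    proof
      fix x :: "real ^ 'a" assume "x \<in> unit_cell"
      then have "0 < x $ i \<and> x $ i < 1" for i by (simp add: unit_cell_def)
      then have "- 1 < x $ i \<and> x $ i < 2" for i by (smt (verit))
      then show "x \<in> S" by (simp add: S_def mem_box_cart)
    qed
    then have "y \<in> K \<Longrightarrow> y \<in> S" using K(2) by auto
    then show "indicat_real S y *\<^sub>R pd j g y = indicat_real unit_cell y *\<^sub>R pd j g y"
      using pd_eq_0_off[OF K(1,3), where x=y and j=j] K(2) by (cases "y \<in> K") auto
  qed
  finally show ?thesis by (simp add: integral_cell_lborel smooth_continuous_on[OF smooth_pd[OF g]])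
qed

text \<open>Integration by parts: the product with a test function is smooth with compact support in the cell.\<close>

lemma smooth_has_weak_pd:
  assumes "smooth \<phi>" shows "has_weak_pd j \<phi> (pd j \<phi>)"
  unfolding has_weak_pd_def
proof (intro allI impI)
  fix \<psi> :: "real ^ 'a \<Rightarrow> complex" assume "test_function \<psi>"
  then obtain K where \<psi>: "smooth \<psi>" and K: "compact K" "K \<subseteq> unit_cell" "\<And>x. x \<notin> K \<Longrightarrow> \<psi> x = 0"
    by (auto simp: test_function_def)
  have "0 = (LINT y|cell. pd j (\<lambda>x. \<phi> x * \<psi> x) y)"
    by (rule integral_pd_compact_support[symmetric, OF smooth_mult[OF assms \<psi>] K(1,2)]) (simp add: K(3))
  also have "\<dots> = (LINT y|cell. \<phi> y * pd j \<psi> y + pd j \<phi> y * \<psi> y)"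
    by (simp add: pd_mult smooth_differentiable assms \<psi>)
  also have "\<dots> = (LINT y|cell. \<phi> y * pd j \<psi> y) + (LINT y|cell. pd j \<phi> y * \<psi> y)"
    by (intro Bochner_Integration.integral_add integrable_cell_continuous smooth_continuous_on smooth_mult smooth_pd assms \<psi>)
  finally show "(LINT y|cell. \<phi> y * pd j \<psi> y) = - (LINT y|cell. pd j \<phi> y * \<psi> y)"
    by (simp add: eq_neg_iff_add_eq_0)
qed

section \<open>The Hilbert space of square-integrable classes\<close>

lemma L2_measurable [measurable_dest]: "u \<in> L2 \<Longrightarrow> u \<in> borel_measurable cell"
  and L2_integrable: "u \<in> L2 \<Longrightarrow> integrable cell (\<lambda>y. (norm (u y))\<^sup>2)"
  by (auto simp: L2_def)

lemma L2_bound: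
  fixes v :: "real ^ 'd \<Rightarrow> 'b :: euclidean_space"
  assumes [measurable]: "v \<in> borel_measurable cell" and u: "integrable cell u"
    and "AE y in cell. (norm (v y))\<^sup>2 \<le> u y"
  shows "v \<in> L2"
proof -
  have "integrable cell (\<lambda>y. (norm (v y))\<^sup>2)"
    by (rule Bochner_Integration.integrable_bound[OF u]) (use assms in \<open>auto elim!: eventually_mono\<close>)
  then show ?thesis by (simp add: L2_def assms)
qed

lemma L2_add:
  fixes u v :: "real ^ 'd \<Rightarrow> 'b :: euclidean_space"
  assumes u: "u \<in> L2" and v: "v \<in> L2" shows "(\<lambda>y. u y + v y) \<in> L2"
proof (rule L2_bound)
  show "integrable cell (\<lambda>y. 2 * (norm (u y))\<^sup>2 + 2 * (norm (v y))\<^sup>2)"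
    using u v by (simp add: L2_integrable)
  have "(norm (u y + v y))\<^sup>2 \<le> 2 * (norm (u y))\<^sup>2 + 2 * (norm (v y))\<^sup>2" for y
  proof -
    have "(norm (u y + v y))\<^sup>2 \<le> (norm (u y) + norm (v y))\<^sup>2"
      by (intro power_mono norm_triangle_ineq norm_ge_zero)
    also have "\<dots> \<le> 2 * (norm (u y))\<^sup>2 + 2 * (norm (v y))\<^sup>2"
      using zero_le_power2[of "norm (u y) - norm (v y)"] by (simp add: power2_sum power2_diff)
    finally show ?thesis .
  qed
  then show "AE y in cell. (norm (u y + v y))\<^sup>2 \<le> 2 * (norm (u y))\<^sup>2 + 2 * (norm (v y))\<^sup>2" by simp
qed (use u v in measurable)

lemma L2_scaleR: "u \<in> L2 \<Longrightarrow> (\<lambda>y. c *\<^sub>R u y) \<in> L2"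
  by (rule L2_bound[where u="\<lambda>y. c\<^sup>2 * (norm (u y))\<^sup>2"]) (auto simp: L2_integrable power_mult_distrib dest: L2_measurable)

lemma L2_zero: "(\<lambda>y. 0) \<in> L2"
  by (simp add: L2_def)

lemma L2_uminus: "u \<in> L2 \<Longrightarrow> (\<lambda>y. - u y) \<in> L2"
  using L2_scaleR[of u "-1"] by simp

lemma L2_diff: "u \<in> L2 \<Longrightarrow> v \<in> L2 \<Longrightarrow> (\<lambda>y. u y - v y) \<in> L2"
  using L2_add[OF _ L2_uminus, of u v] by simp

lemma L2_inner_integrable:
  fixes u v :: "real ^ 'd \<Rightarrow> 'b :: euclidean_space"
  assumes u: "u \<in> L2" and v: "v \<in> L2" shows "integrable cell (\<lambda>y. u y \<bullet> v y)"
proof (rule Bochner_Integration.integrable_bound)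
  show "integrable cell (\<lambda>y. (norm (u y))\<^sup>2 + (norm (v y))\<^sup>2)"
    using u v by (simp add: L2_integrable)
  have "\<bar>u y \<bullet> v y\<bar> \<le> (norm (u y))\<^sup>2 + (norm (v y))\<^sup>2" for y
  proof -
    have "\<bar>u y \<bullet> v y\<bar> \<le> norm (u y) * norm (v y)" by (rule Cauchy_Schwarz_ineq2)
    also have "\<dots> \<le> (norm (u y))\<^sup>2 + (norm (v y))\<^sup>2"
      using sum_squares_bound[of "norm (u y)" "norm (v y)"] mult_nonneg_nonneg[OF norm_ge_zero[of "u y"] norm_ge_zero[of "v y"]]
      by linarith
    finally show ?thesis .
  qed
  then show "AE y in cell. norm (u y \<bullet> v y) \<le> norm ((norm (u y))\<^sup>2 + (norm (v y))\<^sup>2)" by simp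
qed (use u v in measurable)

text \<open>Elements of \<open>L2\<close> are functions; identifying those that agree almost everywhere on the cell yields a
genuine inner product space. The real inner product is used also for complex values: complex
orthogonality is recovered by replacing one argument by its multiple by \<open>\<i>\<close>.\<close>

quotient_type (overloaded) ('d, 'b) l2 = "real ^ ('d :: finite) \<Rightarrow> ('b :: euclidean_space)" / partial:
    "\<lambda>u v. u \<in> L2 \<and> v \<in> L2 \<and> (AE y in cell. u y = v y)"
proof (rule part_equivpI)
  show "\<exists>u :: real ^ 'd \<Rightarrow> 'b. u \<in> L2 \<and> u \<in> L2 \<and> (AE y in cell. u y = u y)"
    using L2_zero by blast
next
  show "symp (\<lambda>u v :: real ^ 'd \<Rightarrow> 'b. u \<in> L2 \<and> v \<in> L2 \<and> (AE y in cell. u y = v y))"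
    by (auto simp: symp_def elim!: eventually_mono)
  show "transp (\<lambda>u v :: real ^ 'd \<Rightarrow> 'b. u \<in> L2 \<and> v \<in> L2 \<and> (AE y in cell. u y = v y))"
    by (auto simp: transp_def elim: eventually_elim2)
qed

instantiation l2 :: (finite, euclidean_space) real_vector
begin

lift_definition zero_l2 :: "('a, 'b) l2" is "\<lambda>y. 0" by (simp add: L2_zero)

lift_definition plus_l2 :: "('a, 'b) l2 \<Rightarrow> ('a, 'b) l2 \<Rightarrow> ('a, 'b) l2" is "\<lambda>u v y. u y + v y"
  by (auto intro: L2_add)

lift_definition uminus_l2 :: "('a, 'b) l2 \<Rightarrow> ('a, 'b) l2" is "\<lambda>u y. - u y"
  by (auto intro: L2_uminus)

lift_definition minus_l2 :: "('a, 'b) l2 \<Rightarrow> ('a, 'b) l2 \<Rightarrow> ('a, 'b) l2" is "\<lambda>u v y. u y - v y"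
  by (auto intro: L2_diff)

lift_definition scaleR_l2 :: "real \<Rightarrow> ('a, 'b) l2 \<Rightarrow> ('a, 'b) l2" is "\<lambda>c u y. c *\<^sub>R u y"
  by (auto intro: L2_scaleR)

instance
proof
  fix x y z :: "('a, 'b) l2" and c d :: real
  show "x + y + z = x + (y + z)" by transfer (auto simp: L2_add add.assoc)
  show "x + y = y + x" by transfer (auto simp: L2_add add.commute)
  show "0 + x = x" by transfer auto
  show "- x + x = 0" by transfer (auto simp: L2_zero)
  show "x - y = x + - y" by transfer (auto simp: L2_diff)
  show "c *\<^sub>R (x + y) = c *\<^sub>R x + c *\<^sub>R y" by transfer (auto simp: L2_add L2_scaleR scaleR_add_right)
  show "(c + d) *\<^sub>R x = c *\<^sub>R x + d *\<^sub>R x" by transfer (auto simp: L2_add L2_scaleR scaleR_add_left)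
  show "c *\<^sub>R d *\<^sub>R x = (c * d) *\<^sub>R x" by transfer (auto simp: L2_scaleR)
  show "1 *\<^sub>R x = x" by transfer auto
qed

end

instantiation l2 :: (finite, euclidean_space) real_inner
begin

lift_definition inner_l2 :: "('a, 'b) l2 \<Rightarrow> ('a, 'b) l2 \<Rightarrow> real" is "\<lambda>u v. LINT y|cell. u y \<bullet> v y"
  by (auto intro!: integral_cong_AE dest!: L2_measurable)

definition norm_l2 :: "('a, 'b) l2 \<Rightarrow> real" where "norm_l2 x = sqrt (x \<bullet> x)"
definition sgn_l2 :: "('a, 'b) l2 \<Rightarrow> ('a, 'b) l2" where "sgn_l2 x = x /\<^sub>R norm x"
definition dist_l2 :: "('a, 'b) l2 \<Rightarrow> ('a, 'b) l2 \<Rightarrow> real" where "dist_l2 x y = norm (x - y)"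
definition uniformity_l2 :: "(('a, 'b) l2 \<times> ('a, 'b) l2) filter"
  where "uniformity_l2 = (INF e\<in>{0<..}. principal {(x, y). dist x y < e})"
definition open_l2 :: "('a, 'b) l2 set \<Rightarrow> bool"
  where "open_l2 U = (\<forall>x\<in>U. \<forall>\<^sub>F (x', y) in uniformity. x' = x \<longrightarrow> y \<in> U)"

instance
proof
  fix x y z :: "('a, 'b) l2" and c :: real
  show "x \<bullet> y = y \<bullet> x" by transfer (simp add: inner_commute)
  show "(x + y) \<bullet> z = x \<bullet> z + y \<bullet> z"
    by transfer (simp add: inner_add_left L2_inner_integrable)
  show "(c *\<^sub>R x) \<bullet> y = c * (x \<bullet> y)" by transfer simp
  show "0 \<le> x \<bullet> x" by transfer simp
  show "x \<bullet> x = 0 \<longleftrightarrow> x = 0"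
  proof transfer
    fix u :: "real ^ 'a \<Rightarrow> 'b" assume "u \<in> L2 \<and> u \<in> L2 \<and> (AE y in cell. u y = u y)"
    then have u: "u \<in> L2" by simp
    have "(LINT y|cell. u y \<bullet> u y) = 0 \<longleftrightarrow> (AE y in cell. u y \<bullet> u y = 0)"
      by (rule integral_nonneg_eq_0_iff_AE) (auto simp: L2_inner_integrable u)
    then show "(LINT y|cell. u y \<bullet> u y) = 0 \<longleftrightarrow> u \<in> L2 \<and> (\<lambda>y. 0) \<in> L2 \<and> (AE y in cell. u y = 0)"
      using u by (simp add: L2_zero)
  qed
qed (rule norm_l2_def sgn_l2_def dist_l2_def uniformity_l2_def open_l2_def)+

end

definition cls :: "(real ^ 'd \<Rightarrow> 'b) \<Rightarrow> ('d :: finite, 'b :: euclidean_space) l2" where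
  "cls u = abs_l2 u"

lemma cls_eq_iff: "u \<in> L2 \<Longrightarrow> v \<in> L2 \<Longrightarrow> cls u = cls v \<longleftrightarrow> (AE y in cell. u y = v y)"
  using Quotient_rel[OF Quotient_l2, of u v] by (simp add: cls_def)

lemma cls_surj: "\<exists>u\<in>L2. x = cls u"
  using Quotient_rep_reflp[OF Quotient_l2, of x] Quotient_abs_rep[OF Quotient_l2, of x]
  unfolding cls_def by metis

lemma cls_add: "u \<in> L2 \<Longrightarrow> v \<in> L2 \<Longrightarrow> cls (\<lambda>y. u y + v y) = cls u + cls v"
  by (simp add: cls_def plus_l2.abs_eq eq_onp_same_args)

lemma cls_diff: "u \<in> L2 \<Longrightarrow> v \<in> L2 \<Longrightarrow> cls (\<lambda>y. u y - v y) = cls u - cls v"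
  by (simp add: cls_def minus_l2.abs_eq eq_onp_same_args)

lemma cls_scaleR: "u \<in> L2 \<Longrightarrow> cls (\<lambda>y. c *\<^sub>R u y) = c *\<^sub>R cls u"
  by (simp add: cls_def scaleR_l2.abs_eq)

lemma cls_zero: "cls (\<lambda>y. 0) = 0"
  by (simp add: cls_def zero_l2_def)

lemma inner_cls: "u \<in> L2 \<Longrightarrow> v \<in> L2 \<Longrightarrow> cls u \<bullet> cls v = (LINT y|cell. u y \<bullet> v y)"
  by (simp add: cls_def inner_l2.abs_eq)

lemma norm_cls: "u \<in> L2 \<Longrightarrow> (norm (cls u))\<^sup>2 = (LINT y|cell. (norm (u y))\<^sup>2)"
  by (simp add: power2_norm_eq_inner inner_cls)

lemma nn_integral_L2:
  assumes "u \<in> L2" shows "(\<integral>\<^sup>+y. ennreal ((norm (u y))\<^sup>2) \<partial>cell) = ennreal ((norm (cls u))\<^sup>2)"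
  using L2_integrable[OF assms] by (subst nn_integral_eq_integral) (auto simp: norm_cls assms)

lemma L2_if_nn_integral_finite:
  fixes u :: "real ^ 'd \<Rightarrow> 'b :: euclidean_space"
  assumes [measurable]: "u \<in> borel_measurable cell"
    and "(\<integral>\<^sup>+y. ennreal ((norm (u y))\<^sup>2) \<partial>cell) \<le> ennreal c" "0 \<le> c"
  shows "u \<in> L2" "(norm (cls u))\<^sup>2 \<le> c"
proof -
  have "integrable cell (\<lambda>y. (norm (u y))\<^sup>2)"
    using assms(2) by (intro integrableI_nonneg) (auto intro: le_less_trans)
  then show u: "u \<in> L2" by (simp add: L2_def)
  show "(norm (cls u))\<^sup>2 \<le> c" using assms(2,3) by (simp add: nn_integral_L2 u)
qed

lemma integral_norm_le_norm_cls:
  assumes u: "u \<in> L2"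
  shows "integrable cell (\<lambda>y. norm (u y))" "(LINT y|cell. norm (u y)) \<le> norm (cls u)"
proof -
  have n: "(\<lambda>y. norm (u y)) \<in> L2" and one: "(\<lambda>y. 1 :: real) \<in> L2"
    using u by (auto simp: L2_def intro!: integrable_cell_bounded[of _ 1])
  have nn: "norm (cls (\<lambda>y. norm (u y))) = norm (cls u)"
    by (rule power2_eq_imp_eq) (simp_all add: norm_cls n u)
  have n1: "norm (cls (\<lambda>y::real^'a. 1 :: real)) = 1"
    by (rule power2_eq_imp_eq) (simp_all add: norm_cls one measure_def prob_cell)
  show "integrable cell (\<lambda>y. norm (u y))" using L2_inner_integrable[OF n one] by simp
  have "(LINT y|cell. norm (u y)) = cls (\<lambda>y. norm (u y)) \<bullet> cls (\<lambda>y. 1)"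
    by (simp add: inner_cls n one)
  also have "\<dots> \<le> norm (cls (\<lambda>y. norm (u y))) * norm (cls (\<lambda>y::real^'a. 1 :: real))" by (rule norm_cauchy_schwarz)
  finally show "(LINT y|cell. norm (u y)) \<le> norm (cls u)" by (simp add: nn n1)
qed

text \<open>Riesz--Fischer: a rapidly converging subsequence has absolutely summable increments in \<open>L\<^sup>1\<close>, hence it
converges almost everywhere, and Fatou's lemma bounds the distance of its terms to the pointwise limit.\<close>

instance l2 :: (finite, euclidean_space) complete_space
proof
  fix X :: "nat \<Rightarrow> ('a, 'b) l2" assume "Cauchy X"
  then have "\<exists>N. \<forall>m\<ge>N. \<forall>n\<ge>N. dist (X m) (X n) < (1/2) ^ k" for k
    unfolding Cauchy_def by (meson zero_less_divide_1_iff zero_less_numeral zero_less_power)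
  then obtain N where N: "\<And>k m n. m \<ge> N k \<Longrightarrow> n \<ge> N k \<Longrightarrow> dist (X m) (X n) < (1/2) ^ k"
    by metis
  \<comment> \<open>Partial sums dominate all earlier thresholds, which makes the choice of indices monotone.\<close>
  define r where "r k = (\<Sum>i\<le>k. N i)" for k
  have rN: "N k \<le> r m" if "k \<le> m" for k m
    unfolding r_def using that by (intro member_le_sum) auto
  have "\<exists>u\<in>L2. X (r k) = cls u" for k by (rule cls_surj)
  then obtain f where f: "\<And>k. f k \<in> L2" "\<And>k. X (r k) = cls (f k)" by metis
  have fd: "(\<lambda>y. f m y - f k y) \<in> L2" for m k by (intro L2_diff f)
  have fk: "norm (cls (\<lambda>y. f m y - f k y)) \<le> (1/2) ^ k" if "k \<le> m" for k m
    using N[OF rN[OF that] rN[OF order_refl]] by (simp add: f cls_diff dist_norm)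
  have [measurable]: "f k \<in> borel_measurable cell" for k using f(1) by (rule L2_measurable)
  have "(\<integral>\<^sup>+y. (\<Sum>k. ennreal (norm (f (Suc k) y - f k y))) \<partial>cell) = (\<Sum>k. \<integral>\<^sup>+y. ennreal (norm (f (Suc k) y - f k y)) \<partial>cell)"
    by (rule nn_integral_suminf) measurable
  also have "\<dots> \<le> (\<Sum>k. ennreal ((1/2) ^ k))"
  proof (intro suminf_le)
    fix k
    have "(\<integral>\<^sup>+y. ennreal (norm (f (Suc k) y - f k y)) \<partial>cell) = ennreal (LINT y|cell. norm (f (Suc k) y - f k y))"
      by (rule nn_integral_eq_integral) (auto intro: integral_norm_le_norm_cls fd)
    also have "\<dots> \<le> ennreal ((1/2) ^ k)"
      using integral_norm_le_norm_cls(2)[OF fd[of "Suc k" k]] fk[of k "Suc k"] by (intro ennreal_leI) linarith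
    finally show "(\<integral>\<^sup>+y. ennreal (norm (f (Suc k) y - f k y)) \<partial>cell) \<le> ennreal ((1/2) ^ k)" .
  qed auto
  also have "\<dots> < \<infinity>"
    by (subst suminf_ennreal2) (auto intro: summable_geometric)
  finally have "AE y in cell. (\<Sum>k. ennreal (norm (f (Suc k) y - f k y))) \<noteq> \<infinity>"
    by (intro nn_integral_PInf_AE) auto
  then have lim: "AE y in cell. (\<lambda>k. f k y) \<longlonglongrightarrow> lim (\<lambda>k. f k y)"
  proof eventually_elim
    case (elim y)
    then have "summable (\<lambda>k. norm (f (Suc k) y - f k y))"
      by (intro summable_suminf_not_top) (auto simp: infinity_ennreal_def)
    then have "summable (\<lambda>k. f (Suc k) y - f k y)" by (rule summable_norm_cancel)
    then obtain s where "(\<lambda>n. \<Sum>k<n. f (Suc k) y - f k y) \<longlonglongrightarrow> s"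
      by (auto simp: summable_def sums_def)
    then have "(\<lambda>n. f n y - f 0 y) \<longlonglongrightarrow> s"
      by (simp add: sum_lessThan_telescope[of "\<lambda>k. f k y"])
    then have "(\<lambda>n. f n y - f 0 y + f 0 y) \<longlonglongrightarrow> s + f 0 y"
      by (intro tendsto_add tendsto_const)
    then show ?case by (simp add: limI)
  qed
  define F where "F y = lim (\<lambda>k. f k y)" for y
  have [measurable]: "F \<in> borel_measurable cell" unfolding F_def by measurable
  have key: "(\<integral>\<^sup>+y. ennreal ((norm (F y - f k y))\<^sup>2) \<partial>cell) \<le> ennreal (((1/2) ^ k)\<^sup>2)" for k
  proof -
    have "(\<integral>\<^sup>+y. ennreal ((norm (F y - f k y))\<^sup>2) \<partial>cell) = (\<integral>\<^sup>+y. liminf (\<lambda>m. ennreal ((norm (f m y - f k y))\<^sup>2)) \<partial>cell)"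
    proof (rule nn_integral_cong_AE)
      show "AE y in cell. ennreal ((norm (F y - f k y))\<^sup>2) = liminf (\<lambda>m. ennreal ((norm (f m y - f k y))\<^sup>2))"
        using lim
      proof eventually_elim
        case (elim y)
        have "(\<lambda>m. ennreal ((norm (f m y - f k y))\<^sup>2)) \<longlonglongrightarrow> ennreal ((norm (F y - f k y))\<^sup>2)"
          unfolding F_def by (intro tendsto_ennrealI tendsto_intros elim)
        then show ?case by (rule lim_imp_Liminf[OF sequentially_bot, symmetric])
      qed
    qed
    also have "\<dots> \<le> liminf (\<lambda>m. \<integral>\<^sup>+y. ennreal ((norm (f m y - f k y))\<^sup>2) \<partial>cell)"
      by (rule nn_integral_liminf) measurable
    also have "\<dots> \<le> ennreal (((1/2) ^ k)\<^sup>2)"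
    proof (rule Liminf_le)
      show "\<forall>\<^sub>F m in sequentially. (\<integral>\<^sup>+y. ennreal ((norm (f m y - f k y))\<^sup>2) \<partial>cell) \<le> ennreal (((1/2) ^ k)\<^sup>2)"
        using eventually_ge_at_top[of k]
        by eventually_elim (auto simp: nn_integral_L2[OF fd] intro!: ennreal_leI power_mono fk)
    qed simp
    finally show ?thesis .
  qed
  have Fd: "(\<lambda>y. F y - f k y) \<in> L2" "norm (cls (\<lambda>y. F y - f k y)) \<le> (1/2) ^ k" for k
    using L2_if_nn_integral_finite[OF _ key] by (auto intro: power2_le_imp_le)
  have "F \<in> L2" using L2_add[OF Fd(1) f(1), of 0 0] by simp
  then have Fk: "dist (X (r k)) (cls F) \<le> (1/2) ^ k" for k
    using Fd(2)[of k] f by (simp add: cls_diff dist_norm norm_minus_commute)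
  have "X \<longlonglongrightarrow> cls F"
  proof (rule metric_LIMSEQ_I)
    fix e :: real assume "0 < e"
    then obtain k where k: "(1/2) ^ k < e / 2" using real_arch_pow_inv[of "e/2" "1/2"] by auto
    have "dist (X n) (cls F) < e" if "n \<ge> N k" for n
      using dist_triangle[of "X n" "cls F" "X (r k)"] N[OF that rN[OF order_refl]] Fk[of k] k by linarith
    then show "\<exists>no. \<forall>n\<ge>no. dist (X n) (cls F) < e" by blast
  qed
  then show "convergent X" by (auto simp: convergent_def)
qed

section \<open>A minimisation principle in Hilbert space\<close>

text \<open>The functional \<open>w \<mapsto> B(f + w, f + w)\<close> is bounded below on \<open>W\<close>. By the parallelogram law a minimising
sequence is Cauchy, and minimality of the limit \<open>f + p\<close> forces \<open>B(f + p, q)\<close> to vanish, as otherwise a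
small multiple of \<open>q\<close> would decrease the value.\<close>

lemma riesz_on_subspace:
  fixes B :: "'h :: {real_inner, complete_space} \<Rightarrow> 'h \<Rightarrow> real"
  assumes B: "bounded_bilinear B" and sym: "\<And>x y. B x y = B y x"
    and c: "0 < c" "\<And>x. c * (norm x)\<^sup>2 \<le> B x x"
    and W: "subspace W"
  shows "\<exists>p\<in>closure W. \<forall>q\<in>W. B (f + p) q = 0"
proof -
  interpret bounded_bilinear B by (rule B)
  define Q where "Q x = B x x" for x
  have Q0: "0 \<le> Q x" for x using c(2)[of x] c(1) unfolding Q_def by (smt (verit) zero_le_mult_iff zero_le_power2)
  have Q_diff: "Q (x - y) = 2 * Q x + 2 * Q y - Q (x + y)" for x y
    by (simp add: Q_def add_left add_right diff_left diff_right)
  have Q_scale: "Q (t *\<^sub>R x) = t\<^sup>2 * Q x" for t x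
    by (simp add: Q_def scaleR_left scaleR_right power2_eq_square)
  have Q_add: "Q (x + y) = Q x + 2 * B x y + Q y" for x y
    by (simp add: Q_def add_left add_right sym[of y x])
  define I where "I = Inf ((\<lambda>w. Q (f + w)) ` W)"
  have ne: "(\<lambda>w. Q (f + w)) ` W \<noteq> {}" using subspace_0[OF W] by auto
  have bdd: "bdd_below ((\<lambda>w. Q (f + w)) ` W)" by (rule bdd_belowI[of _ 0]) (auto simp: Q0)
  have I: "I \<le> Q (f + w)" if "w \<in> W" for w unfolding I_def using bdd that by (intro cInf_lower) auto
  have "\<exists>w\<in>W. Q (f + w) < I + 1 / real (Suc k)" for k
    using cInf_lessD[OF ne, of "I + 1 / real (Suc k)"] by (auto simp: I_def)
  then obtain w where w: "\<And>k. w k \<in> W" "\<And>k. Q (f + w k) < I + 1 / real (Suc k)" by metis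
  \<comment> \<open>Indices beyond \<open>n\<close> have values within \<open>1 / (n + 1)\<close> of the infimum; the midpoint costs four times the infimum.\<close>
  have near: "c * (norm (w m - w k))\<^sup>2 \<le> 4 / real (Suc n)" if "n \<le> m" "n \<le> k" for m k n
  proof -
    have inv: "1 / real (Suc i) \<le> 1 / real (Suc n)" if "n \<le> i" for i using that by (simp add: field_simps)
    have "(1/2) *\<^sub>R (w m + w k) \<in> W" using W w by (simp add: subspace_def)
    then have "I \<le> Q (f + (1/2) *\<^sub>R (w m + w k))" by (rule I)
    moreover have "Q (w m - w k) = 2 * Q (f + w m) + 2 * Q (f + w k) - 4 * Q (f + (1/2) *\<^sub>R (w m + w k))"
    proof -
      have "f + (1/2) *\<^sub>R (w m + w k) = (1/2) *\<^sub>R ((f + w m) + (f + w k))"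
        by (simp add: algebra_simps flip: scaleR_add_left)
      then show ?thesis
        using Q_diff[of "f + w m" "f + w k"] Q_scale[of "1/2" "(f + w m) + (f + w k)"] by (simp add: power2_eq_square)
    qed
    moreover have "c * (norm (w m - w k))\<^sup>2 \<le> Q (w m - w k)" unfolding Q_def by (rule c(2))
    ultimately show ?thesis using w(2)[of m] w(2)[of k] inv[OF that(1)] inv[OF that(2)] by simp
  qed
  have "Cauchy w"
  proof (rule CauchyI)
    fix e :: real assume e: "0 < e"
    obtain n where n: "1 / real (Suc n) < c * e\<^sup>2 / 4"
      using reals_Archimedean[of "c * e\<^sup>2 / 4"] e c(1) by (auto simp: inverse_eq_divide)
    have "norm (w m - w k) < e" if "n \<le> m" "n \<le> k" for m k
    proof -
      have "c * (norm (w m - w k))\<^sup>2 < c * e\<^sup>2" using near[OF that] n by simp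
      then show ?thesis using c(1) e power2_less_imp_less[of "norm (w m - w k)" e] by simp
    qed
    then show "\<exists>M. \<forall>m\<ge>M. \<forall>n\<ge>M. norm (w m - w n) < e" by blast
  qed
  then obtain p where p: "w \<longlonglongrightarrow> p" using Cauchy_convergent convergent_def by blast
  have Qlim: "(\<lambda>k. Q (f + w k + x)) \<longlonglongrightarrow> Q (f + p + x)" for x
    unfolding Q_def by (intro tendsto tendsto_add tendsto_const p)
  have "(\<lambda>k. I + 1 / real (Suc k)) \<longlonglongrightarrow> I + 0"
    by (intro tendsto_add tendsto_const LIMSEQ_Suc lim_1_over_n)
  then have "Q (f + p) \<le> I"
    using LIMSEQ_le[of "\<lambda>k. Q (f + w k)" "Q (f + p)" "\<lambda>k. I + 1 / real (Suc k)" "I + 0"] Qlim[of 0] w(2)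
    by (auto intro: less_imp_le)
  have "B (f + p) q = 0" if q: "q \<in> W" for q
  proof -
    define \<beta> where "\<beta> = B (f + p) q"
    define \<gamma> where "\<gamma> = Q q"
    have quad: "0 \<le> 2 * t * \<beta> + t\<^sup>2 * \<gamma>" for t
    proof -
      have "I \<le> Q (f + w k + t *\<^sub>R q)" for k
        using I[of "w k + t *\<^sub>R q"] w(1) q W by (auto simp: subspace_def add.assoc)
      then have "I \<le> Q (f + p + t *\<^sub>R q)" by (intro LIMSEQ_le_const[OF Qlim]) auto
      also have "\<dots> = Q (f + p) + 2 * t * \<beta> + t\<^sup>2 * \<gamma>"
        by (simp only: Q_add Q_scale \<beta>_def \<gamma>_def scaleR_right) simp
      finally show ?thesis using \<open>Q (f + p) \<le> I\<close> by linarith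
    qed
    have "0 \<le> \<gamma>" unfolding \<gamma>_def by (rule Q0)
    have "\<beta> = 0"
    proof (rule ccontr)
      assume "\<beta> \<noteq> 0"
      \<comment> \<open>The minimiser of the quadratic, with \<open>1 + \<gamma>\<close> in place of \<open>\<gamma>\<close>, which may be zero.\<close>
      define t where "t = - \<beta> / (1 + \<gamma>)"
      have "2 * t * \<beta> + t\<^sup>2 * \<gamma> = (\<beta> / (1 + \<gamma>))\<^sup>2 * (- 2 * (1 + \<gamma>) + \<gamma>)"
        using \<open>0 \<le> \<gamma>\<close> by (simp add: t_def power2_eq_square divide_simps) (simp add: algebra_simps)
      also have "\<dots> < 0"
        using \<open>0 \<le> \<gamma>\<close> \<open>\<beta> \<noteq> 0\<close> by (intro mult_pos_neg) auto
      finally show False using quad[of t] by simp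
    qed
    then show ?thesis by (simp add: \<beta>_def)
  qed
  moreover have "p \<in> closure W" using p w(1) by (auto simp: closure_sequential)
  ultimately show ?thesis by blast
qed

section \<open>Scalar inner products in terms of classes\<close>

lemma L2_integrable_self:
  fixes u :: "real ^ 'd \<Rightarrow> 'b :: euclidean_space"
  assumes "u \<in> L2" shows "integrable cell u"
  using integral_norm_le_norm_cls(1)[OF assms] L2_measurable[OF assms] by (simp add: integrable_norm_iff)

lemma L2_bounded:
  fixes f :: "real ^ 'd \<Rightarrow> 'b :: euclidean_space"
  assumes "f \<in> borel_measurable cell" "AE y in cell. norm (f y) \<le> C" shows "f \<in> L2"
proof (rule L2_bound)
  show "AE y in cell. (norm (f y))\<^sup>2 \<le> C\<^sup>2"
    using assms(2) by eventually_elim (auto intro: power_mono)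
  show "integrable cell (\<lambda>y::real^'d. C\<^sup>2)" by (intro integrable_cell_bounded[where C="C\<^sup>2"]) auto
qed (use assms in auto)

lemma L2_continuous:
  fixes f :: "real ^ 'd \<Rightarrow> 'b :: euclidean_space"
  assumes "continuous_on UNIV f" shows "f \<in> L2"
proof -
  obtain C where "\<forall>y\<in>unit_cell. norm (f y) \<le> C" using continuous_bounded_on_cell[OF assms] by auto
  then show ?thesis by (intro L2_bounded[where C=C] continuous_measurable_cell assms AE_cellI) auto
qed

lemma L2_smooth: "smooth f \<Longrightarrow> f \<in> L2"
  by (intro L2_continuous smooth_continuous_on)

lemma L2_complex_mult:
  fixes u :: "real ^ 'd \<Rightarrow> complex"
  assumes "u \<in> L2" shows "(\<lambda>y. c * u y) \<in> L2"
  by (rule L2_bound[where u="\<lambda>y. (norm c)\<^sup>2 * (norm (u y))\<^sup>2"])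
    (use assms in \<open>auto simp: L2_integrable norm_mult power_mult_distrib dest: L2_measurable\<close>)

lemma L2_cnj:
  fixes u :: "real ^ 'd \<Rightarrow> complex"
  assumes "u \<in> L2" shows "(\<lambda>y. cnj (u y)) \<in> L2"
proof (rule L2_bound[OF _ L2_integrable[OF assms]])
  have "u \<in> borel_measurable cell" by (rule L2_measurable[OF assms])
  then show "(\<lambda>y. cnj (u y)) \<in> borel_measurable cell"
    by (rule measurable_compose) (intro borel_measurable_continuous_onI continuous_intros)
qed auto

lemma L2_product_integrable:
  fixes u v :: "real ^ 'd \<Rightarrow> complex"
  assumes u: "u \<in> L2" and v: "v \<in> L2" shows "integrable cell (\<lambda>y. u y * v y)"
proof (rule Bochner_Integration.integrable_bound)
  show "integrable cell (\<lambda>y. (norm (u y))\<^sup>2 + (norm (v y))\<^sup>2)"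
    using u v by (simp add: L2_integrable)
  have "norm (u y) * norm (v y) \<le> (norm (u y))\<^sup>2 + (norm (v y))\<^sup>2" for y
    using sum_squares_bound[of "norm (u y)" "norm (v y)"] mult_nonneg_nonneg[OF norm_ge_zero[of "u y"] norm_ge_zero[of "v y"]]
    by linarith
  then show "AE y in cell. norm (u y * v y) \<le> norm ((norm (u y))\<^sup>2 + (norm (v y))\<^sup>2)"
    by (simp add: norm_mult)
qed (use u v in measurable)

text \<open>The imaginary part of \<open>u \<cdot> cnj v\<close> is the real inner product of \<open>u\<close> with \<open>\<i> v\<close>, so the complex inner
product of functions depends continuously on classes.\<close>

lemma l2_inner_cls:
  assumes u: "u \<in> L2" and v: "v \<in> L2"
  shows "l2_inner u v = of_real (cls u \<bullet> cls v) + \<i> * of_real (cls u \<bullet> cls (\<lambda>y. \<i> * v y))"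
proof -
  have int: "integrable cell (\<lambda>y. u y * cnj (v y))" by (intro L2_product_integrable L2_cnj u v)
  have "Re (l2_inner u v) = (LINT y|cell. Re (u y * cnj (v y)))"
    using integral_Re[OF int] by (simp add: l2_inner_def)
  moreover have "Im (l2_inner u v) = (LINT y|cell. Im (u y * cnj (v y)))"
    using integral_Im[OF int] by (simp add: l2_inner_def)
  ultimately show ?thesis
    by (simp add: complex_eq_iff inner_cls u v L2_complex_mult inner_complex_def algebra_simps)
qed

lemma l2_inner_tendsto:
  assumes "\<And>k. u k \<in> L2" "u' \<in> L2" "(\<lambda>k. cls (u k)) \<longlonglongrightarrow> cls u'" "v \<in> L2"
  shows "(\<lambda>k. l2_inner (u k) v) \<longlonglongrightarrow> l2_inner u' v"
  using assms(1,2,4) by (simp add: l2_inner_cls) (intro tendsto_intros assms)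

lemma integral_mult_l2_inner: "(LINT y|cell. u y * v y) = l2_inner u (\<lambda>y. cnj (v y))"
  by (simp add: l2_inner_def)

lemma norm_cls_cmult:
  fixes u :: "real ^ 'd \<Rightarrow> complex"
  assumes "u \<in> L2" shows "norm (cls (\<lambda>y. c * u y)) = norm c * norm (cls u)"
proof (rule power2_eq_imp_eq)
  show "(norm (cls (\<lambda>y. c * u y)))\<^sup>2 = (norm c * norm (cls u))\<^sup>2"
    by (simp add: norm_cls L2_complex_mult assms norm_mult power_mult_distrib)
qed auto

lemma l2_inner_diff: 
  "u \<in> L2 \<Longrightarrow> v \<in> L2 \<Longrightarrow> w \<in> L2 \<Longrightarrow> l2_inner (\<lambda>y. u y - v y) w = l2_inner u w - l2_inner v w"
  unfolding l2_inner_def left_diff_distrib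
  by (rule Bochner_Integration.integral_diff) (auto intro!: L2_product_integrable L2_cnj)

lemma l2_inner_cmult: "l2_inner (\<lambda>y. c * u y) w = c * l2_inner u w"
  by (simp add: l2_inner_def mult.assoc)

lemma l2_inner_commute: "cnj (l2_inner u v) = l2_inner v u"
  unfolding l2_inner_def by (simp only: Bochner_Integration.integral_cnj[symmetric] complex_cnj_mult complex_cnj_cnj mult.commute)

lemma l2_inner_add_right:
  "u \<in> L2 \<Longrightarrow> v \<in> L2 \<Longrightarrow> w \<in> L2 \<Longrightarrow> l2_inner u (\<lambda>y. v y + w y) = l2_inner u v + l2_inner u w"
  unfolding l2_inner_def complex_cnj_add distrib_left
  by (rule Bochner_Integration.integral_add) (auto intro!: L2_product_integrable L2_cnj)

section \<open>Weak derivatives and quasi-periodic Sobolev functions\<close>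

text \<open>Two weak derivatives have the same integral against every test function.\<close>

lemma has_weak_pd_unique:
  assumes v: "v \<in> L2" "has_weak_pd j u v" and w: "w \<in> L2" "has_weak_pd j u w"
  shows "cls v = cls w"
proof -
  have "AE y in cell. v y - w y = 0"
  proof (rule fundamental_lemma_test_functions)
    show "integrable cell (\<lambda>y. v y - w y)" using v w by (intro L2_integrable_self L2_diff)
    fix \<psi> :: "real ^ 'a \<Rightarrow> complex" assume \<psi>: "test_function \<psi>"
    then have "\<psi> \<in> L2" by (intro L2_smooth) (simp add: test_function_def)
    then have "(LINT y|cell. (v y - w y) * \<psi> y) = (LINT y|cell. v y * \<psi> y) - (LINT y|cell. w y * \<psi> y)"
      using v w by (simp add: left_diff_distrib L2_product_integrable)
    also have "\<dots> = 0" using v(2) w(2) \<psi> by (simp add: has_weak_pd_def)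
    finally show "(LINT y|cell. (v y - w y) * \<psi> y) = 0" .
  qed
  then show ?thesis using v w by (subst cls_eq_iff) auto
qed

lemma weak_pd_props:
  assumes "v \<in> L2" "has_weak_pd j u v"
  shows "weak_pd j u \<in> L2" "has_weak_pd j u (weak_pd j u)" "cls (weak_pd j u) = cls v"
proof -
  have *: "weak_pd j u \<in> L2 \<and> has_weak_pd j u (weak_pd j u)"
    unfolding weak_pd_def by (rule someI[of _ v]) (use assms in auto)
  then show "weak_pd j u \<in> L2" "has_weak_pd j u (weak_pd j u)" by auto
  then show "cls (weak_pd j u) = cls v" using assms by (intro has_weak_pd_unique)
qed

lemma H1_L2: "u \<in> H1 \<Longrightarrow> u \<in> L2"
  and H1_weak_pd: "u \<in> H1 \<Longrightarrow> weak_pd j u \<in> L2" "u \<in> H1 \<Longrightarrow> has_weak_pd j u (weak_pd j u)"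
  using weak_pd_props by (auto simp: H1_def) blast+

lemma has_weak_pd_diff:
  assumes "u \<in> L2" "v \<in> L2" "u' \<in> L2" "v' \<in> L2" "has_weak_pd j u v" "has_weak_pd j u' v'"
  shows "has_weak_pd j (\<lambda>y. u y - u' y) (\<lambda>y. v y - v' y)"
  unfolding has_weak_pd_def
proof (intro allI impI)
  fix \<psi> :: "real ^ 'a \<Rightarrow> complex" assume \<psi>: "test_function \<psi>"
  then have s: "\<psi> \<in> L2" "pd j \<psi> \<in> L2" by (auto simp: test_function_def intro!: L2_smooth smooth_pd)
  show "(LINT y|cell. (u y - u' y) * pd j \<psi> y) = - (LINT y|cell. (v y - v' y) * \<psi> y)"
    using assms \<psi> s by (simp add: left_diff_distrib L2_product_integrable has_weak_pd_def)
qed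

lemma smooth_H1:
  assumes "smooth \<phi>"
  shows "\<phi> \<in> H1" "cls (weak_pd j \<phi>) = cls (pd j \<phi>)"
  using L2_smooth[OF assms] L2_smooth[OF smooth_pd[OF assms]] smooth_has_weak_pd[OF assms]
  by (auto simp: H1_def intro!: weak_pd_props)

lemma l2_norm_cls: "u \<in> L2 \<Longrightarrow> l2_norm u = norm (cls u)"
  by (simp add: l2_norm_def norm_cls[symmetric])

lemma h1_norm_diff:
  assumes u: "u \<in> H1" and \<phi>: "smooth \<phi>"
  shows "(h1_norm (\<lambda>x. u x - \<phi> x))\<^sup>2 =
    (norm (cls u - cls \<phi>))\<^sup>2 + (\<Sum>j\<in>UNIV. (norm (cls (weak_pd j u) - cls (pd j \<phi>)))\<^sup>2)"
proof -
  have L: "u \<in> L2" "\<phi> \<in> L2" "weak_pd j u \<in> L2" "pd j \<phi> \<in> L2" for j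
    using u \<phi> by (auto intro: H1_L2 H1_weak_pd L2_smooth smooth_pd)
  have w: "has_weak_pd j (\<lambda>x. u x - \<phi> x) (\<lambda>x. weak_pd j u x - pd j \<phi> x)" for j
    by (intro has_weak_pd_diff L H1_weak_pd u smooth_has_weak_pd \<phi>)
  have "weak_pd j (\<lambda>x. u x - \<phi> x) \<in> L2" "cls (weak_pd j (\<lambda>x. u x - \<phi> x)) = cls (weak_pd j u) - cls (pd j \<phi>)" for j
    using weak_pd_props[OF L2_diff[OF L(3,4)] w, of j] by (auto simp: cls_diff L)
  then show ?thesis
    using L by (simp add: h1_norm_def l2_norm_cls L2_diff cls_diff sum_nonneg)
qed

lemma H1_theta_approx:
  assumes "u \<in> H1_theta \<theta>"
  obtains \<phi> where "\<And>k. smooth (\<phi> k)" "\<And>k. quasi_periodic \<theta> (\<phi> k)"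
    "(\<lambda>k. cls (\<phi> k)) \<longlonglongrightarrow> cls u" "\<And>j. (\<lambda>k. cls (pd j (\<phi> k))) \<longlonglongrightarrow> cls (weak_pd j u)"
proof -
  have u: "u \<in> H1" using assms by (simp add: H1_theta_def)
  have "\<exists>\<phi>. smooth \<phi> \<and> quasi_periodic \<theta> \<phi> \<and> h1_norm (\<lambda>x. u x - \<phi> x) < 1 / real (Suc k)" for k
    using assms by (simp add: H1_theta_def)
  then obtain \<phi> where \<phi>: "\<And>k. smooth (\<phi> k)" "\<And>k. quasi_periodic \<theta> (\<phi> k)"
    "\<And>k. h1_norm (\<lambda>x. u x - \<phi> k x) < 1 / real (Suc k)" by metis
  have h: "0 \<le> h1_norm v" for v by (simp add: h1_norm_def sum_nonneg)
  have lim: "x \<longlonglongrightarrow> y" if "\<And>k. (norm (y - x k))\<^sup>2 \<le> (h1_norm (\<lambda>x. u x - \<phi> k x))\<^sup>2"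
    for x and y :: "('a, complex) l2"
  proof -
    have "norm (y - x k) \<le> 1 / real (Suc k)" for k
      using power2_le_imp_le[OF that h, of k] \<phi>(3)[of k] by linarith
    then have "(\<lambda>k. y - x k) \<longlonglongrightarrow> 0"
      by (intro Lim_null_comparison[OF _ LIMSEQ_Suc[OF lim_1_over_n]]) auto
    then have "(\<lambda>k. y - (y - x k)) \<longlonglongrightarrow> y - 0" by (intro tendsto_diff tendsto_const)
    then show ?thesis by simp
  qed
  show ?thesis
  proof (rule that[OF \<phi>(1,2)])
    show "(\<lambda>k. cls (\<phi> k)) \<longlonglongrightarrow> cls u"
      by (rule lim) (simp add: h1_norm_diff u \<phi> sum_nonneg)
    show "(\<lambda>k. cls (pd j (\<phi> k))) \<longlonglongrightarrow> cls (weak_pd j u)" for j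
    proof (rule lim)
      fix k
      have "(norm (cls (weak_pd j u) - cls (pd j (\<phi> k))))\<^sup>2 \<le> (\<Sum>j\<in>UNIV. (norm (cls (weak_pd j u) - cls (pd j (\<phi> k))))\<^sup>2)"
        by (rule member_le_sum[where f="\<lambda>j. (norm (cls (weak_pd j u) - cls (pd j (\<phi> k))))\<^sup>2"]) auto
      then show "(norm (cls (weak_pd j u) - cls (pd j (\<phi> k))))\<^sup>2 \<le> (h1_norm (\<lambda>x. u x - \<phi> k x))\<^sup>2"
        by (simp add: h1_norm_diff u \<phi> add_increasing)
    qed
  qed
qed

text \<open>The defining identity of a weak derivative is an equality of continuous functionals on \<open>L\<^sup>2\<close>, so it
passes from smooth functions to limits. Together with \<open>H1_theta_approx\<close> this describes \<open>H1_theta\<close> and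
its weak derivatives by convergence in \<open>l2\<close>.\<close>

lemma H1_theta_limit:
  assumes u: "u \<in> L2" and \<phi>: "\<And>k. smooth (\<phi> k)" "\<And>k. quasi_periodic \<theta> (\<phi> k)"
    and lim: "(\<lambda>k. cls (\<phi> k)) \<longlonglongrightarrow> cls u" "\<And>j. (\<lambda>k. cls (pd j (\<phi> k))) \<longlonglongrightarrow> P j"
  shows "u \<in> H1_theta \<theta>" "cls (weak_pd j u) = P j"
proof -
  have "\<exists>v\<in>L2. P j = cls v" for j by (rule cls_surj)
  then obtain v where v: "\<And>j. v j \<in> L2" "\<And>j. P j = cls (v j)" by metis
  have wp: "has_weak_pd j u (v j)" for j
    unfolding has_weak_pd_def
  proof (intro allI impI)
    fix \<psi> :: "real ^ 'a \<Rightarrow> complex" assume \<psi>: "test_function \<psi>"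
    then have s: "(\<lambda>y. cnj (\<psi> y)) \<in> L2" "(\<lambda>y. cnj (pd j \<psi> y)) \<in> L2"
      using L2_cnj[OF L2_smooth] L2_cnj[OF L2_smooth[OF smooth_pd]] by (auto simp: test_function_def)
    have "(\<lambda>k. l2_inner (\<phi> k) (\<lambda>y. cnj (pd j \<psi> y))) \<longlonglongrightarrow> l2_inner u (\<lambda>y. cnj (pd j \<psi> y))"
      by (intro l2_inner_tendsto lim(1) u s L2_smooth \<phi>)
    moreover have "l2_inner (\<phi> k) (\<lambda>y. cnj (pd j \<psi> y)) = - l2_inner (pd j (\<phi> k)) (\<lambda>y. cnj (\<psi> y))" for k
      using smooth_has_weak_pd[OF \<phi>(1), of j k] \<psi> by (simp add: has_weak_pd_def integral_mult_l2_inner)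
    moreover have "(\<lambda>k. - l2_inner (pd j (\<phi> k)) (\<lambda>y. cnj (\<psi> y))) \<longlonglongrightarrow> - l2_inner (v j) (\<lambda>y. cnj (\<psi> y))"
      using lim(2)[of j] by (intro tendsto_minus l2_inner_tendsto s v L2_smooth smooth_pd \<phi>) (simp add: v)
    ultimately have "l2_inner u (\<lambda>y. cnj (pd j \<psi> y)) = - l2_inner (v j) (\<lambda>y. cnj (\<psi> y))"
      using LIMSEQ_unique by auto
    then show "(LINT y|cell. u y * pd j \<psi> y) = - (LINT y|cell. v j y * \<psi> y)"
      by (simp add: integral_mult_l2_inner)
  qed
  then have H: "u \<in> H1" using u v by (auto simp: H1_def)
  show *: "cls (weak_pd j u) = P j" for j using weak_pd_props(3)[OF v(1) wp] v(2) by simp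
  have "(\<lambda>k. (norm (cls u - cls (\<phi> k)))\<^sup>2 + (\<Sum>j\<in>UNIV. (norm (P j - cls (pd j (\<phi> k))))\<^sup>2))
     \<longlonglongrightarrow> (norm (cls u - cls u))\<^sup>2 + (\<Sum>j\<in>UNIV. (norm (P j - P j))\<^sup>2)"
    by (intro tendsto_intros lim)
  then have h0: "(\<lambda>k. (h1_norm (\<lambda>x. u x - \<phi> k x))\<^sup>2) \<longlonglongrightarrow> 0"
    by (simp add: h1_norm_diff H \<phi> *)
  have "\<exists>k. h1_norm (\<lambda>x. u x - \<phi> k x) < \<epsilon>" if "0 < \<epsilon>" for \<epsilon>
  proof -
    obtain k where "(h1_norm (\<lambda>x. u x - \<phi> k x))\<^sup>2 < \<epsilon>\<^sup>2"
      using order_tendstoD(2)[OF h0, of "\<epsilon>\<^sup>2"] \<open>0 < \<epsilon>\<close> by (auto simp: eventually_sequentially)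
    then show ?thesis using power2_less_imp_less[of _ \<epsilon>] \<open>0 < \<epsilon>\<close> by auto
  qed
  then show "u \<in> H1_theta \<theta>" using H \<phi>(1,2) unfolding H1_theta_def mem_Collect_eq by meson
qed

lemma smooth_H1_theta: "smooth \<phi> \<Longrightarrow> quasi_periodic \<theta> \<phi> \<Longrightarrow> \<phi> \<in> H1_theta \<theta>"
  by (rule H1_theta_limit(1)[of \<phi> "\<lambda>_. \<phi>" \<theta> "\<lambda>j. cls (pd j \<phi>)"]) (auto intro: L2_smooth)

section \<open>Plane waves and the Poincare inequality\<close>

lemma norm_plane_wave [simp]: "norm (plane_wave \<theta> y) = 1"
  by (simp add: plane_wave_def)

lemma plane_wave_mult_cnj: "plane_wave \<theta> y * cnj (plane_wave \<theta> y) = 1"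
  by (simp add: complex_norm_square[symmetric])

lemma cnj_plane_wave: "cnj (plane_wave \<theta> y) = plane_wave (- \<theta>) y"
  by (simp add: plane_wave_def exp_cnj)

lemma plane_wave_cancel: "plane_wave (- \<theta>) y * plane_wave \<theta> y = 1"
  using plane_wave_mult_cnj[of \<theta> y] by (simp add: cnj_plane_wave mult.commute)

lemma quasi_periodic_plane_wave: "quasi_periodic \<theta> (plane_wave \<theta>)"
  by (simp add: quasi_periodic_def plane_wave_def inner_add_right distrib_left exp_add)

lemma quasi_periodic_mult:
  "quasi_periodic \<theta> \<phi> \<Longrightarrow> quasi_periodic \<theta>' \<psi> \<Longrightarrow> quasi_periodic (\<theta> + \<theta>') (\<lambda>x. \<phi> x * \<psi> x)"
  by (simp add: quasi_periodic_def inner_add_left distrib_left exp_add)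

lemma quasi_periodic_cmult: "quasi_periodic \<theta> \<phi> \<Longrightarrow> quasi_periodic \<theta> (\<lambda>x. c * \<phi> x)"
  by (simp add: quasi_periodic_def)

lemma quasi_periodic_add:
  "quasi_periodic \<theta> \<phi> \<Longrightarrow> quasi_periodic \<theta> \<psi> \<Longrightarrow> quasi_periodic \<theta> (\<lambda>x. \<phi> x + \<psi> x)"
  by (simp add: quasi_periodic_def algebra_simps)

lemma quasi_periodic_diff:
  "quasi_periodic \<theta> \<phi> \<Longrightarrow> quasi_periodic \<theta> \<psi> \<Longrightarrow> quasi_periodic \<theta> (\<lambda>x. \<phi> x - \<psi> x)"
  by (simp add: quasi_periodic_def algebra_simps)

lemma quasi_periodic_shift:
  assumes "quasi_periodic \<theta> \<phi>"
  shows "\<phi> (x + axis j 1) = exp (\<i> * of_real (\<theta> $ j)) * \<phi> x"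
proof -
  have "\<phi> (x + lattice_vec (axis j 1)) = exp (\<i> * of_real (\<theta> \<bullet> lattice_vec (axis j 1))) * \<phi> x"
    using assms unfolding quasi_periodic_def by blast
  then show ?thesis by (simp add: lattice_axis[symmetric] inner_axis)
qed

text \<open>Quasi-periodicity gives \<open>\<phi>(y + e\<^sub>j) - \<phi>(y) = (exp (\<i> \<theta>\<^sub>j) - 1) \<phi>(y)\<close>. The left-hand side is a sum of
\<open>M\<close> increments over steps of length \<open>1 / M\<close>. Up to a phase these are translates of a single
increment, so by the Cauchy--Schwarz inequality and the invariance of cell integrals under shifts its
square integral is at most that of the difference quotient with step \<open>1 / M\<close>, which tends to the square
integral of the derivative.\<close>

theorem quasi_periodic_poincare:
  assumes \<phi>: "smooth \<phi>" and qp: "quasi_periodic \<theta> \<phi>"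
  shows "norm (exp (\<i> * of_real (\<theta> $ j)) - 1) * norm (cls \<phi>) \<le> norm (cls (pd j \<phi>))"
proof -
  define c where "c = exp (\<i> * of_real (\<theta> $ j)) - 1"
  define u where "u = exp (\<i> * of_real (\<theta> $ j))"
  have shift: "\<phi> (x + axis j 1) = u * \<phi> x" for x
    unfolding u_def by (rule quasi_periodic_shift[OF qp])
  have nu: "norm u = 1" by (simp add: u_def)
  have c: "continuous_on UNIV \<phi>" by (rule smooth_continuous_on[OF \<phi>])
  have step: "(norm c)\<^sup>2 * (norm (cls \<phi>))\<^sup>2 \<le> (LINT y|cell. (norm (diff_quot j \<phi> m y))\<^sup>2)" for m
  proof -
    define M where "M = Suc m"
    define h where "h = 1 / real M"
    define D where "D y = (norm (\<phi> (y + h *\<^sub>R axis j 1) - \<phi> y))\<^sup>2" for y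
    have Dc: "continuous_on UNIV D"
      unfolding D_def by (intro continuous_intros continuous_on_compose2[OF c]) auto
    have Dk: "continuous_on UNIV (\<lambda>y. D (y + t *\<^sub>R axis j 1))" for t
      by (intro continuous_on_compose2[OF Dc] continuous_intros) auto
    have Dper: "D (y + axis j 1) = D y" for y
    proof -
      have "\<phi> (y + axis j 1 + h *\<^sub>R axis j 1) = u * \<phi> (y + h *\<^sub>R axis j 1)"
        using shift[of "y + h *\<^sub>R axis j 1"] by (simp add: add_ac)
      then have "\<phi> (y + axis j 1 + h *\<^sub>R axis j 1) - \<phi> (y + axis j 1) = u * (\<phi> (y + h *\<^sub>R axis j 1) - \<phi> y)"
        by (simp add: shift right_diff_distrib)
      then show ?thesis by (simp add: D_def norm_mult nu)
    qed
    have "(norm (c * \<phi> y))\<^sup>2 \<le> real M * (\<Sum>k<M. D (y + (real k * h) *\<^sub>R axis j 1))" for y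
    proof -
      have "(\<Sum>k<M. \<phi> (y + (real (Suc k) * h) *\<^sub>R axis j 1) - \<phi> (y + (real k * h) *\<^sub>R axis j 1)) = c * \<phi> y"
        using shift[of y] by (subst sum_lessThan_telescope[of "\<lambda>k. \<phi> (y + (real k * h) *\<^sub>R axis j 1)"])
          (simp add: h_def M_def c_def u_def algebra_simps)
      then have "norm (c * \<phi> y) \<le> (\<Sum>k<M. norm (\<phi> (y + (real (Suc k) * h) *\<^sub>R axis j 1) - \<phi> (y + (real k * h) *\<^sub>R axis j 1)))"
        using norm_sum[of "\<lambda>k. \<phi> (y + (real (Suc k) * h) *\<^sub>R axis j 1) - \<phi> (y + (real k * h) *\<^sub>R axis j 1)" "{..<M}"] by simp
      then have "(norm (c * \<phi> y))\<^sup>2 \<le> (\<Sum>k<M. norm (\<phi> (y + (real (Suc k) * h) *\<^sub>R axis j 1) - \<phi> (y + (real k * h) *\<^sub>R axis j 1)))\<^sup>2"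
        by (intro power_mono) auto
      also have "\<dots> \<le> (\<Sum>k<M. (norm (\<phi> (y + (real (Suc k) * h) *\<^sub>R axis j 1) - \<phi> (y + (real k * h) *\<^sub>R axis j 1)))\<^sup>2) * real M"
        using sum_squared_le_sum_of_squares[of "\<lambda>k. norm (\<phi> (y + (real (Suc k) * h) *\<^sub>R axis j 1) - \<phi> (y + (real k * h) *\<^sub>R axis j 1))" "{..<M}"] by simp
      also have "\<dots> = real M * (\<Sum>k<M. D (y + (real k * h) *\<^sub>R axis j 1))"
        by (simp add: D_def algebra_simps)
      finally show ?thesis .
    qed
    then have "(LINT y|cell. (norm (c * \<phi> y))\<^sup>2) \<le> (LINT y|cell. real M * (\<Sum>k<M. D (y + (real k * h) *\<^sub>R axis j 1)))"
      by (intro integral_mono integrable_cell_continuous continuous_intros c Dk)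
    also have "\<dots> = real M * (\<Sum>k<M. (LINT y|cell. D (y + (real k * h) *\<^sub>R axis j 1)))"
      by (simp add: Bochner_Integration.integral_sum integrable_cell_continuous Dk)
    also have "\<dots> = real M * (\<Sum>k<M. (LINT y|cell. D y))"
      by (intro arg_cong2[where f="(*)"] sum.cong refl integral_cell_shift Dc Dper) (auto simp: h_def field_simps)
    also have "\<dots> = (LINT y|cell. (real M)\<^sup>2 * D y)"
      by (simp add: power2_eq_square)
    also have "\<dots> = (LINT y|cell. (norm (diff_quot j \<phi> m y))\<^sup>2)"
      by (simp add: diff_quot_def D_def norm_mult power_mult_distrib h_def M_def del: of_nat_Suc)
    finally show ?thesis
      by (simp add: norm_cls L2_smooth \<phi> norm_mult power_mult_distrib)
  qed
  obtain K where K: "\<And>y m. y \<in> unit_cell \<Longrightarrow> norm (diff_quot j \<phi> m y) \<le> K"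
    using diff_quot_bounded[OF \<phi>, of unit_cell j] by (auto simp: unit_cell_box)
  have "(\<lambda>m. LINT y|cell. (norm (diff_quot j \<phi> m y))\<^sup>2) \<longlonglongrightarrow> (LINT y|cell. (norm (pd j \<phi> y))\<^sup>2)"
  proof (rule integral_dominated_convergence[where w="\<lambda>_. K\<^sup>2"])
    show "(\<lambda>y. (norm (pd j \<phi> y))\<^sup>2) \<in> borel_measurable cell"
      by (intro continuous_measurable_cell continuous_intros smooth_continuous_on smooth_pd \<phi>)
    show "(\<lambda>y. (norm (diff_quot j \<phi> m y))\<^sup>2) \<in> borel_measurable cell" for m
      by (intro continuous_measurable_cell continuous_intros diff_quot_continuous \<phi>)
    show "integrable cell (\<lambda>_ :: real ^ 'a. K\<^sup>2)" by (intro integrable_cell_continuous continuous_intros)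
    show "AE y in cell. (\<lambda>m. (norm (diff_quot j \<phi> m y))\<^sup>2) \<longlonglongrightarrow> (norm (pd j \<phi> y))\<^sup>2"
      by (intro AE_I2 tendsto_intros diff_quot_tendsto \<phi>)
    show "AE y in cell. norm ((norm (diff_quot j \<phi> m y))\<^sup>2) \<le> K\<^sup>2" for m
      by (intro AE_cellI) (auto intro!: power_mono K)
  qed
  then have "(norm c)\<^sup>2 * (norm (cls \<phi>))\<^sup>2 \<le> (LINT y|cell. (norm (pd j \<phi> y))\<^sup>2)"
    by (rule LIMSEQ_le_const) (use step in auto)
  also have "\<dots> = (norm (cls (pd j \<phi>)))\<^sup>2"
    by (simp add: norm_cls L2_smooth smooth_pd \<phi>)
  finally have "(norm c * norm (cls \<phi>))\<^sup>2 \<le> (norm (cls (pd j \<phi>)))\<^sup>2" by (simp add: power_mult_distrib)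
  then show ?thesis unfolding c_def by (rule power2_le_imp_le) simp
qed

text \<open>The product of \<open>\<phi>\<close> with the conjugate plane wave is periodic, so its derivative has integral zero.\<close>

lemma l2_inner_pd_plane_wave:
  assumes \<phi>: "smooth \<phi>" and qp: "quasi_periodic \<theta> \<phi>"
  shows "l2_inner (pd j \<phi>) (plane_wave \<theta>) = \<i> * of_real (\<theta> $ j) * l2_inner \<phi> (plane_wave \<theta>)"
proof -
  let ?w = "plane_wave (- \<theta>)"
  have "quasi_periodic (\<theta> + (- \<theta>)) (\<lambda>x. \<phi> x * ?w x)"
    by (rule quasi_periodic_mult[OF qp quasi_periodic_plane_wave])
  then have "0 = (LINT y|cell. pd j (\<lambda>x. \<phi> x * ?w x) y)"
    using quasi_periodic_shift[of 0 "\<lambda>x. \<phi> x * ?w x"]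
    by (subst integral_pd_periodic) (auto intro!: smooth_mult \<phi> smooth_plane_wave)
  also have "\<dots> = (LINT y|cell. pd j \<phi> y * ?w y - \<i> * of_real (\<theta> $ j) * (\<phi> y * ?w y))"
    by (simp add: pd_mult smooth_differentiable \<phi> smooth_plane_wave pd_plane_wave algebra_simps)
  also have "\<dots> = (LINT y|cell. pd j \<phi> y * ?w y) - \<i> * of_real (\<theta> $ j) * (LINT y|cell. \<phi> y * ?w y)"
    by (subst Bochner_Integration.integral_diff)
      (auto intro!: integrable_cell_continuous smooth_continuous_on smooth_mult smooth_pd smooth_const \<phi> smooth_plane_wave)
  finally show ?thesis by (simp add: l2_inner_def cnj_plane_wave)
qed

lemma l2_inner_weak_pd_plane_wave:
  assumes "u \<in> H1_theta \<theta>"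
  shows "l2_inner (weak_pd j u) (plane_wave \<theta>) = \<i> * of_real (\<theta> $ j) * l2_inner u (plane_wave \<theta>)"
proof -
  obtain \<phi> where \<phi>: "\<And>k. smooth (\<phi> k)" "\<And>k. quasi_periodic \<theta> (\<phi> k)"
    "(\<lambda>k. cls (\<phi> k)) \<longlonglongrightarrow> cls u" "\<And>j. (\<lambda>k. cls (pd j (\<phi> k))) \<longlonglongrightarrow> cls (weak_pd j u)"
    by (rule H1_theta_approx[OF assms]) blast
  have u: "u \<in> H1" using assms by (simp add: H1_theta_def)
  have "(\<lambda>k. l2_inner (pd j (\<phi> k)) (plane_wave \<theta>)) \<longlonglongrightarrow> l2_inner (weak_pd j u) (plane_wave \<theta>)"
    by (intro l2_inner_tendsto \<phi> L2_smooth smooth_pd H1_weak_pd u smooth_plane_wave)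
  moreover have "(\<lambda>k. \<i> * of_real (\<theta> $ j) * l2_inner (\<phi> k) (plane_wave \<theta>)) \<longlonglongrightarrow>
      \<i> * of_real (\<theta> $ j) * l2_inner u (plane_wave \<theta>)"
    by (intro tendsto_mult tendsto_const l2_inner_tendsto \<phi> L2_smooth H1_L2 u smooth_plane_wave)
  ultimately show ?thesis
    using LIMSEQ_unique by (simp add: l2_inner_pd_plane_wave \<phi>)
qed

lemma l2_inner_plane_wave_self: "l2_inner (plane_wave \<theta>) (plane_wave \<theta>) = 1"
  by (simp add: l2_inner_def plane_wave_mult_cnj measure_def prob_cell)

text \<open>Orthogonality to the plane wave is restored in an approximating sequence by subtracting the projection
onto it; the coefficients of these projections tend to zero.\<close>

lemma H1_theta_perp_approx:
  assumes "u \<in> H1_theta_perp \<theta>"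
  obtains \<phi> where "\<And>k. smooth (\<phi> k)" "\<And>k. quasi_periodic \<theta> (\<phi> k)"
    "\<And>k. l2_inner (\<phi> k) (plane_wave \<theta>) = 0"
    "\<And>j. (\<lambda>k. cls (pd j (\<phi> k))) \<longlonglongrightarrow> cls (weak_pd j u)"
proof -
  have u: "u \<in> H1_theta \<theta>" "l2_inner u (plane_wave \<theta>) = 0" and uH: "u \<in> H1"
    using assms by (auto simp: H1_theta_perp_def H1_theta_def)
  obtain \<phi> where \<phi>: "\<And>k. smooth (\<phi> k)" "\<And>k. quasi_periodic \<theta> (\<phi> k)"
    "(\<lambda>k. cls (\<phi> k)) \<longlonglongrightarrow> cls u" "\<And>j. (\<lambda>k. cls (pd j (\<phi> k))) \<longlonglongrightarrow> cls (weak_pd j u)"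
    by (rule H1_theta_approx[OF u(1)]) blast
  define c where "c k = l2_inner (\<phi> k) (plane_wave \<theta>)" for k
  have "c \<longlonglongrightarrow> l2_inner u (plane_wave \<theta>)"
    unfolding c_def by (intro l2_inner_tendsto \<phi> L2_smooth H1_L2 uH smooth_plane_wave)
  then have c0: "c \<longlonglongrightarrow> 0" using u(2) by simp
  define \<phi>' where "\<phi>' k = (\<lambda>y. \<phi> k y - c k * plane_wave \<theta> y)" for k
  have cw: "smooth (\<lambda>y. c k * plane_wave \<theta> y)" for k by (intro smooth_mult smooth_const smooth_plane_wave)
  have pdw: "pd j (\<phi>' k) = (\<lambda>y. pd j (\<phi> k) y - (c k * \<i> * of_real (\<theta> $ j)) * plane_wave \<theta> y)" for j k
    unfolding \<phi>'_def by (rule ext) (simp add: pd_diff pd_cmult smooth_differentiable cw \<phi> smooth_plane_wave pd_plane_wave)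
  show ?thesis
  proof (rule that[of \<phi>'])
    show "smooth (\<phi>' k)" for k unfolding \<phi>'_def by (intro smooth_diff cw \<phi>)
    show "quasi_periodic \<theta> (\<phi>' k)" for k
      unfolding \<phi>'_def by (intro quasi_periodic_diff quasi_periodic_cmult quasi_periodic_plane_wave \<phi>)
    show "l2_inner (\<phi>' k) (plane_wave \<theta>) = 0" for k
      unfolding \<phi>'_def
      by (subst l2_inner_diff[OF L2_smooth[OF \<phi>(1)] L2_smooth[OF cw] L2_smooth[OF smooth_plane_wave]])
        (simp add: l2_inner_cmult l2_inner_plane_wave_self c_def[symmetric])
    show "(\<lambda>k. cls (pd j (\<phi>' k))) \<longlonglongrightarrow> cls (weak_pd j u)" for j
    proof -
      let ?r = "\<lambda>k. cls (\<lambda>y. (c k * \<i> * of_real (\<theta> $ j)) * plane_wave \<theta> y)"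
      have "(\<lambda>k. norm (c k * \<i> * of_real (\<theta> $ j)) * norm (cls (plane_wave \<theta>))) \<longlonglongrightarrow> norm (0 * \<i> * of_real (\<theta> $ j)) * norm (cls (plane_wave \<theta>))"
        by (intro tendsto_intros c0)
      then have "(\<lambda>k. norm (?r k)) \<longlonglongrightarrow> 0"
        by (subst norm_cls_cmult) (auto intro: L2_smooth smooth_plane_wave)
      then have "?r \<longlonglongrightarrow> 0" by (rule tendsto_norm_zero_cancel)
      then have "(\<lambda>k. cls (pd j (\<phi> k)) - ?r k) \<longlonglongrightarrow> cls (weak_pd j u) - 0"
        by (intro tendsto_diff \<phi>)
      then show ?thesis
        unfolding pdw by (subst cls_diff) (auto intro!: L2_smooth smooth_pd \<phi> L2_complex_mult smooth_plane_wave)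
    qed
  qed
qed

section \<open>Vector-valued square-integrable functions\<close>

lemma borel_measurable_vecI:
  fixes u :: "'x \<Rightarrow> complex ^ 'm"
  assumes "\<And>i. (\<lambda>y. u y $ i) \<in> borel_measurable M"
  shows "u \<in> borel_measurable M"
proof -
  have ax: "(\<lambda>z :: complex. axis i z :: complex ^ 'm) \<in> borel_measurable borel" for i
  proof -
    have "continuous_on UNIV (\<lambda>z :: complex. if k = i then z else 0)" for k :: 'm
      by (cases "k = i") auto
    then show ?thesis
      unfolding axis_def by (intro borel_measurable_continuous_onI continuous_on_vec_lambda)
  qed
  have "u = (\<lambda>y. \<Sum>i\<in>UNIV. axis i (u y $ i))"
    by (rule ext) (simp add: vec_eq_iff axis_def)
  also have "\<dots> \<in> borel_measurable M"
    by (intro borel_measurable_sum measurable_compose[OF assms ax])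
  finally show ?thesis .
qed

lemma borel_measurable_vec_nth:
  fixes u :: "'x \<Rightarrow> 'b :: real_normed_vector ^ 'm"
  assumes "u \<in> borel_measurable M" shows "(\<lambda>y. u y $ i) \<in> borel_measurable M"
  by (intro measurable_compose[OF assms] borel_measurable_continuous_onI linear_continuous_on bounded_linear_vec_nth)

lemma norm_vec_square:
  fixes x :: "complex ^ 'm" shows "(norm x)\<^sup>2 = (\<Sum>i\<in>UNIV. (norm (x $ i))\<^sup>2)"
  by (simp add: norm_vec_def L2_set_def sum_nonneg)

lemma L2_vec_iff:
  fixes u :: "real ^ 'd \<Rightarrow> complex ^ 'm"
  shows "u \<in> L2 \<longleftrightarrow> (\<forall>i. (\<lambda>y. u y $ i) \<in> L2)"
proof
  assume u: "u \<in> L2"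
  show "\<forall>i. (\<lambda>y. u y $ i) \<in> L2"
    using L2_bound[OF borel_measurable_vec_nth[OF L2_measurable[OF u]] L2_integrable[OF u]]
    by (auto intro!: power_mono Finite_Cartesian_Product.norm_nth_le)
next
  assume u: "\<forall>i. (\<lambda>y. u y $ i) \<in> L2"
  show "u \<in> L2"
  proof (rule L2_bound)
    show "u \<in> borel_measurable cell" by (rule borel_measurable_vecI) (use u L2_measurable in blast)
    show "integrable cell (\<lambda>y. \<Sum>i\<in>UNIV. (norm (u y $ i))\<^sup>2)"
      by (intro Bochner_Integration.integrable_sum L2_integrable u[rule_format])
  qed (simp add: norm_vec_square)
qed

lemma norm_cls_vec:
  fixes u :: "real ^ 'd \<Rightarrow> complex ^ 'm"
  assumes "u \<in> L2" shows "(norm (cls u))\<^sup>2 = (\<Sum>i\<in>UNIV. (norm (cls (\<lambda>y. u y $ i)))\<^sup>2)"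
proof -
  have ui: "(\<lambda>y. u y $ i) \<in> L2" for i using assms by (simp add: L2_vec_iff)
  show ?thesis
    by (simp add: norm_cls assms ui norm_vec_square Bochner_Integration.integral_sum L2_integrable[OF ui])
qed

lemma LIMSEQ_iff_norm_square:
  fixes f :: "nat \<Rightarrow> 'b :: real_normed_vector"
  shows "f \<longlonglongrightarrow> l \<longleftrightarrow> (\<lambda>k. (norm (f k - l))\<^sup>2) \<longlonglongrightarrow> 0"
proof -
  have "f \<longlonglongrightarrow> l \<longleftrightarrow> (\<lambda>k. norm (f k - l)) \<longlonglongrightarrow> 0"
    unfolding LIM_zero_iff[of f l sequentially, symmetric] by (rule tendsto_norm_zero_iff[symmetric])
  also have "\<dots> \<longleftrightarrow> (\<lambda>k. (norm (f k - l))\<^sup>2) \<longlonglongrightarrow> 0"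
  proof
    assume "(\<lambda>k. norm (f k - l)) \<longlonglongrightarrow> 0"
    from tendsto_power[OF this, of 2] show "(\<lambda>k. (norm (f k - l))\<^sup>2) \<longlonglongrightarrow> 0" by simp
  next
    assume "(\<lambda>k. (norm (f k - l))\<^sup>2) \<longlonglongrightarrow> 0"
    from tendsto_real_sqrt[OF this] show "(\<lambda>k. norm (f k - l)) \<longlonglongrightarrow> 0" by simp
  qed
  finally show ?thesis .
qed

lemma cls_vec_tendsto_iff:
  fixes u :: "nat \<Rightarrow> real ^ 'd \<Rightarrow> complex ^ 'm"
  assumes u: "\<And>k. u k \<in> L2" and v: "v \<in> L2"
  shows "(\<lambda>k. cls (u k)) \<longlonglongrightarrow> cls v \<longleftrightarrow> (\<forall>i. (\<lambda>k. cls (\<lambda>y. u k y $ i)) \<longlonglongrightarrow> cls (\<lambda>y. v y $ i))"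
proof -
  have ui: "(\<lambda>y. u k y $ i) \<in> L2" and vi: "(\<lambda>y. v y $ i) \<in> L2" for k i
    using u v by (auto simp: L2_vec_iff)
  have eq: "(norm (cls (u k) - cls v))\<^sup>2 = (\<Sum>i\<in>UNIV. (norm (cls (\<lambda>y. u k y $ i) - cls (\<lambda>y. v y $ i)))\<^sup>2)" for k
    using norm_cls_vec[OF L2_diff[OF u v], of k] by (simp add: cls_diff u v ui vi)
  show ?thesis
  proof
    assume "(\<lambda>k. cls (u k)) \<longlonglongrightarrow> cls v"
    then have s: "(\<lambda>k. (norm (cls (u k) - cls v))\<^sup>2) \<longlonglongrightarrow> 0" by (rule LIMSEQ_iff_norm_square[THEN iffD1])
    show "\<forall>i. (\<lambda>k. cls (\<lambda>y. u k y $ i)) \<longlonglongrightarrow> cls (\<lambda>y. v y $ i)"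
    proof
      fix i
      have "(\<lambda>k. (norm (cls (\<lambda>y. u k y $ i) - cls (\<lambda>y. v y $ i)))\<^sup>2) \<longlonglongrightarrow> 0"
      proof (rule Lim_null_comparison[OF _ s], intro always_eventually allI)
        fix k
        show "norm ((norm (cls (\<lambda>y. u k y $ i) - cls (\<lambda>y. v y $ i)))\<^sup>2) \<le> (norm (cls (u k) - cls v))\<^sup>2"
          unfolding eq using member_le_sum[of i UNIV "\<lambda>i. (norm (cls (\<lambda>y. u k y $ i) - cls (\<lambda>y. v y $ i)))\<^sup>2"] by simp
      qed
      then show "(\<lambda>k. cls (\<lambda>y. u k y $ i)) \<longlonglongrightarrow> cls (\<lambda>y. v y $ i)"
        by (rule LIMSEQ_iff_norm_square[THEN iffD2])
    qed
  next
    assume h: "\<forall>i. (\<lambda>k. cls (\<lambda>y. u k y $ i)) \<longlonglongrightarrow> cls (\<lambda>y. v y $ i)"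
    have "(\<lambda>k. \<Sum>i\<in>UNIV. (norm (cls (\<lambda>y. u k y $ i) - cls (\<lambda>y. v y $ i)))\<^sup>2) \<longlonglongrightarrow> (\<Sum>i\<in>(UNIV :: 'm set). 0)"
      by (intro tendsto_sum, rule LIMSEQ_iff_norm_square[THEN iffD1]) (use h in blast)
    then have "(\<lambda>k. (norm (cls (u k) - cls v))\<^sup>2) \<longlonglongrightarrow> 0" by (simp add: eq)
    then show "(\<lambda>k. cls (u k)) \<longlonglongrightarrow> cls v" by (rule LIMSEQ_iff_norm_square[THEN iffD2])
  qed
qed

lemma cls_vec_eq_iff:
  fixes u v :: "real ^ 'd \<Rightarrow> complex ^ 'm"
  assumes "u \<in> L2" "v \<in> L2"
  shows "cls u = cls v \<longleftrightarrow> (\<forall>i. cls (\<lambda>y. u y $ i) = cls (\<lambda>y. v y $ i))"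
  using cls_vec_tendsto_iff[of "\<lambda>_. u" v] assms by (simp add: LIMSEQ_const_iff)

lemma L2_vec_cmult:
  fixes u :: "real ^ 'd \<Rightarrow> complex ^ 'm"
  assumes "u \<in> L2" shows "(\<lambda>y. c *s u y) \<in> L2"
  using assms by (auto simp: L2_vec_iff intro: L2_complex_mult)

text \<open>The imaginary part is the real inner product with the first argument multiplied by \<open>-\<i>\<close>; unlike in
\<open>l2_inner_cls\<close> the second argument stays as it is, so that limits can be taken in it.\<close>

lemma l2_inner_vec_cls:
  fixes u v :: "real ^ 'd \<Rightarrow> complex ^ 'm"
  assumes u: "u \<in> L2" and v: "v \<in> L2"
  shows "l2_inner_vec u v = of_real (cls u \<bullet> cls v) + \<i> * of_real (cls (\<lambda>y. (- \<i>) *s u y) \<bullet> cls v)"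
proof -
  have c: "(\<lambda>y. u y $ i) \<in> L2" "(\<lambda>y. v y $ i) \<in> L2" "(\<lambda>y. - (\<i> * u y $ i)) \<in> L2" for i
    using u v L2_vec_cmult[OF u, of "- \<i>"] by (auto simp: L2_vec_iff)
  have int: "integrable cell (\<lambda>y. u y $ i * cnj (v y $ i))" for i by (intro L2_product_integrable L2_cnj c)
  have sum: "cls w \<bullet> cls v = (\<Sum>i\<in>UNIV. LINT y|cell. w y $ i \<bullet> v y $ i)"
    if "\<And>i. (\<lambda>y. w y $ i) \<in> L2" for w :: "real ^ 'd \<Rightarrow> complex ^ 'm"
  proof -
    have "w \<in> L2" using that by (simp add: L2_vec_iff)
    then show ?thesis
      by (simp add: inner_cls v inner_vec_def Bochner_Integration.integral_sum L2_inner_integrable[OF that c(2)])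
  qed
  have "Re (l2_inner_vec u v) = cls u \<bullet> cls v"
    using sum[of u, OF c(1)]
    by (simp add: l2_inner_vec_def l2_inner_def integral_Re[OF int, symmetric] inner_complex_def)
  moreover have "Im (l2_inner_vec u v) = cls (\<lambda>y. (- \<i>) *s u y) \<bullet> cls v"
    using sum[of "\<lambda>y. (- \<i>) *s u y"] c(3)
    by (simp add: l2_inner_vec_def l2_inner_def integral_Im[OF int, symmetric] inner_complex_def algebra_simps)
  ultimately show ?thesis by (simp add: complex_eq_iff)
qed

lemma l2_inner_vec_cong:
  assumes "u \<in> L2" "u' \<in> L2" "v \<in> L2" "v' \<in> L2" "cls u = cls u'" "cls v = cls v'"
  shows "l2_inner_vec u v = l2_inner_vec u' v'"
proof -
  have "cls (\<lambda>y. (- \<i>) *s u y) = cls (\<lambda>y. (- \<i>) *s u' y)"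
    using assms(1,2,5) by (intro cls_eq_iff[THEN iffD2, OF L2_vec_cmult L2_vec_cmult])
      (auto simp: cls_eq_iff elim: eventually_mono)
  then show ?thesis using assms by (simp add: l2_inner_vec_cls)
qed

lemma l2_inner_vec_commute: "cnj (l2_inner_vec u v) = l2_inner_vec v u"
  by (simp add: l2_inner_vec_def l2_inner_commute)

section \<open>Gradient fields\<close>

definition classical_grad ::
    "(real ^ 'd \<Rightarrow> complex ^ 'n) \<Rightarrow> real ^ 'd \<Rightarrow> complex ^ ('n::finite \<times> 'd::finite)" where
  "classical_grad \<phi> y = (\<chi> p. pd (snd p) (\<lambda>z. \<phi> z $ fst p) y)"

definition smooth_perp :: "real ^ 'd \<Rightarrow> (real ^ 'd \<Rightarrow> complex ^ 'n) set" where
  "smooth_perp \<theta> = power_space {u. smooth u \<and> quasi_periodic \<theta> u \<and> l2_inner u (plane_wave \<theta>) = 0}"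

text \<open>The closure of this subspace is the space of gradients of functions in \<open>H1_theta_perp\<close>: one inclusion is
\<open>grad_in_closure\<close>, the other is \<open>closure_smooth_gradients_is_grad\<close>.\<close>

definition smooth_gradients :: "real ^ 'd \<Rightarrow> ('d, complex ^ ('n::finite \<times> 'd::finite)) l2 set" where
  "smooth_gradients \<theta> = (\<lambda>\<phi>. cls (classical_grad \<phi>)) ` (smooth_perp \<theta> :: (real ^ 'd \<Rightarrow> complex ^ 'n) set)"

lemma smooth_perp_iff:
  "\<phi> \<in> smooth_perp \<theta> \<longleftrightarrow> (\<forall>i. smooth (\<lambda>y. \<phi> y $ i) \<and> quasi_periodic \<theta> (\<lambda>y. \<phi> y $ i) \<and>
     l2_inner (\<lambda>y. \<phi> y $ i) (plane_wave \<theta>) = 0)"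
  by (simp add: smooth_perp_def power_space_def)

lemma classical_grad_nth: "classical_grad \<phi> y $ p = pd (snd p) (\<lambda>z. \<phi> z $ fst p) y"
  by (simp add: classical_grad_def)

lemma grad_nth: "grad u y $ p = weak_pd (snd p) (\<lambda>z. u z $ fst p) y"
  by (simp add: grad_def)

lemma classical_grad_L2:
  assumes "\<And>i. smooth (\<lambda>y. \<phi> y $ i)"
  shows "classical_grad \<phi> \<in> L2"
  by (auto simp: L2_vec_iff classical_grad_nth intro!: L2_smooth smooth_pd assms)

lemma grad_L2:
  assumes "u \<in> power_space (H1_theta \<theta>)"
  shows "grad u \<in> L2"
  using assms by (auto simp: L2_vec_iff grad_nth power_space_def H1_theta_def intro!: H1_weak_pd)

lemma power_space_mono: "V \<subseteq> V' \<Longrightarrow> u \<in> power_space V \<Longrightarrow> u \<in> power_space V'"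
  by (auto simp: power_space_def)

lemma perp_subset: "u \<in> power_space (H1_theta_perp \<theta>) \<Longrightarrow> u \<in> power_space (H1_theta \<theta>)"
  by (erule power_space_mono[rotated]) (auto simp: H1_theta_perp_def)

lemma smooth_perp_subset: "\<phi> \<in> smooth_perp \<theta> \<Longrightarrow> \<phi> \<in> power_space (H1_theta_perp \<theta>)"
  by (auto simp: smooth_perp_iff power_space_def H1_theta_perp_def intro: smooth_H1_theta)

lemma grad_smooth:
  assumes "\<And>i. smooth (\<lambda>y. \<phi> y $ i)" "\<phi> \<in> power_space (H1_theta \<theta>)"
  shows "cls (grad \<phi>) = cls (classical_grad \<phi>)"
  by (subst cls_vec_eq_iff)
    (auto simp: grad_nth classical_grad_nth intro!: grad_L2[OF assms(2)] classical_grad_L2 assms smooth_H1)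

lemma subspace_smooth_gradients: "subspace (smooth_gradients \<theta> :: ('d, complex ^ ('n::finite \<times> 'd::finite)) l2 set)"
  unfolding subspace_def
proof (intro conjI ballI allI)
  let ?S = "smooth_perp \<theta> :: (real ^ 'd \<Rightarrow> complex ^ 'n) set"
  have L: "l2_inner (\<lambda>y. 0) w = 0" for w :: "real ^ 'd \<Rightarrow> complex" by (simp add: l2_inner_def)
  have "(\<lambda>y. 0) \<in> ?S"
    by (auto simp: smooth_perp_iff smooth_const quasi_periodic_def L)
  moreover have "classical_grad (\<lambda>y. 0 :: complex ^ 'n) = (\<lambda>y :: real ^ 'd. 0)"
    by (rule ext) (simp add: vec_eq_iff classical_grad_nth pd_const)
  ultimately show "0 \<in> (smooth_gradients \<theta> :: ('d, complex ^ ('n \<times> 'd)) l2 set)"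
    unfolding smooth_gradients_def by (force simp: cls_zero[symmetric])
  fix x y :: "('d, complex ^ ('n \<times> 'd)) l2"
  assume x: "x \<in> smooth_gradients \<theta>"
  then obtain \<phi> where \<phi>: "\<phi> \<in> ?S" "x = cls (classical_grad \<phi>)" by (auto simp: smooth_gradients_def)
  have s\<phi>: "smooth (\<lambda>y. \<phi> y $ i)" for i using \<phi> by (simp add: smooth_perp_iff)
  show "c *\<^sub>R x \<in> smooth_gradients \<theta>" for c
  proof -
    have "(\<lambda>y. c *\<^sub>R \<phi> y) \<in> ?S"
      using \<phi>(1) by (auto simp: smooth_perp_iff scaleR_conv_of_real l2_inner_cmult intro!: smooth_mult smooth_const quasi_periodic_cmult)
    moreover have "classical_grad (\<lambda>y. c *\<^sub>R \<phi> y) = (\<lambda>y. c *\<^sub>R classical_grad \<phi> y)"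
      by (rule ext) (simp add: vec_eq_iff classical_grad_nth scaleR_conv_of_real[where 'a=complex] pd_cmult s\<phi>)
    ultimately show ?thesis
      unfolding smooth_gradients_def \<phi>(2) by (force simp: cls_scaleR[symmetric] classical_grad_L2 s\<phi>)
  qed
  assume "y \<in> smooth_gradients \<theta>"
  then obtain \<psi> where \<psi>: "\<psi> \<in> ?S" "y = cls (classical_grad \<psi>)" by (auto simp: smooth_gradients_def)
  have s\<psi>: "smooth (\<lambda>y. \<psi> y $ i)" for i using \<psi> by (simp add: smooth_perp_iff)
  have "l2_inner (\<lambda>y. \<phi> y $ i + \<psi> y $ i) (plane_wave \<theta>) = 0" for i
  proof -
    have "l2_inner (\<lambda>y. \<phi> y $ i + \<psi> y $ i) (plane_wave \<theta>) = l2_inner (\<lambda>y. \<phi> y $ i) (plane_wave \<theta>) + l2_inner (\<lambda>y. \<psi> y $ i) (plane_wave \<theta>)"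
      unfolding l2_inner_def distrib_right
      by (rule Bochner_Integration.integral_add) (intro L2_product_integrable L2_cnj[OF L2_smooth[OF smooth_plane_wave]] L2_smooth s\<phi> s\<psi>)+
    then show ?thesis using \<phi>(1) \<psi>(1) by (simp add: smooth_perp_iff)
  qed
  then have "(\<lambda>y. \<phi> y + \<psi> y) \<in> ?S"
    using \<phi>(1) \<psi>(1) by (auto simp: smooth_perp_iff intro!: smooth_add quasi_periodic_add)
  moreover have "classical_grad (\<lambda>y. \<phi> y + \<psi> y) = (\<lambda>y. classical_grad \<phi> y + classical_grad \<psi> y)"
    by (rule ext) (simp add: vec_eq_iff classical_grad_nth pd_add smooth_differentiable s\<phi> s\<psi>)
  ultimately show "x + y \<in> smooth_gradients \<theta>"
    unfolding smooth_gradients_def \<phi>(2) \<psi>(2) by (force simp: cls_add[symmetric] classical_grad_L2 s\<phi> s\<psi>)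
qed

lemma smooth_perp_imult: "\<phi> \<in> smooth_perp \<theta> \<Longrightarrow> (\<lambda>y. \<i> *s \<phi> y) \<in> smooth_perp \<theta>"
  by (auto simp: smooth_perp_iff l2_inner_cmult intro!: smooth_mult smooth_const quasi_periodic_cmult)

lemma classical_grad_imult:
  assumes "\<phi> \<in> smooth_perp \<theta>"
  shows "classical_grad (\<lambda>y. \<i> *s \<phi> y) = (\<lambda>y. \<i> *s classical_grad \<phi> y)"
  using assms by (intro ext) (simp add: vec_eq_iff classical_grad_nth pd_cmult smooth_perp_iff)

lemma grad_in_closure:
  assumes \<phi>: "\<phi> \<in> power_space (H1_theta_perp \<theta>)"
  shows "cls (grad \<phi>) \<in> closure (smooth_gradients \<theta>)"
proof -
  have "\<exists>\<psi>. (\<forall>k. smooth (\<psi> k) \<and> quasi_periodic \<theta> (\<psi> k) \<and> l2_inner (\<psi> k) (plane_wave \<theta>) = 0) \<and>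
      (\<forall>j. (\<lambda>k. cls (pd j (\<psi> k))) \<longlonglongrightarrow> cls (weak_pd j (\<lambda>y. \<phi> y $ i)))" for i
  proof -
    have "(\<lambda>y. \<phi> y $ i) \<in> H1_theta_perp \<theta>" using \<phi> by (simp add: power_space_def)
    then show ?thesis by (rule H1_theta_perp_approx) blast
  qed
  then obtain \<psi> where \<psi>: "\<And>i k. smooth (\<psi> i k)" "\<And>i k. quasi_periodic \<theta> (\<psi> i k)"
    "\<And>i k. l2_inner (\<psi> i k) (plane_wave \<theta>) = 0"
    "\<And>i j. (\<lambda>k. cls (pd j (\<psi> i k))) \<longlonglongrightarrow> cls (weak_pd j (\<lambda>y. \<phi> y $ i))"
    by metis
  define \<Psi> where "\<Psi> k = (\<lambda>y. \<chi> i. \<psi> i k y)" for k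
  have \<Psi>: "\<Psi> k \<in> smooth_perp \<theta>" for k by (simp add: smooth_perp_iff \<Psi>_def \<psi>)
  have "(\<lambda>k. cls (classical_grad (\<Psi> k))) \<longlonglongrightarrow> cls (grad \<phi>)"
  proof (subst cls_vec_tendsto_iff)
    show "classical_grad (\<Psi> k) \<in> L2" for k
      by (rule classical_grad_L2) (simp add: \<Psi>_def \<psi>)
    show "grad \<phi> \<in> L2" by (rule grad_L2[OF perp_subset[OF \<phi>]])
    show "\<forall>p. (\<lambda>k. cls (\<lambda>y. classical_grad (\<Psi> k) y $ p)) \<longlonglongrightarrow> cls (\<lambda>y. grad \<phi> y $ p)"
      using \<psi>(4) by (simp add: classical_grad_nth grad_nth \<Psi>_def)
  qed
  then show ?thesis unfolding closure_sequential smooth_gradients_def using \<Psi> by (auto intro!: exI[of _ "\<lambda>k. cls (classical_grad (\<Psi> k))"])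
qed

text \<open>If the gradients of smooth functions converge, the Poincare inequality makes the functions themselves a
Cauchy sequence; its limit is the function sought. The inequality is available only when \<open>\<theta>\<close> has a
component \<open>\<theta>\<^sub>j\<close> with \<open>exp (\<i> \<theta>\<^sub>j) \<noteq> 1\<close>.\<close>

lemma closure_smooth_gradients_is_grad:
  fixes \<theta> :: "real ^ 'd" and P :: "('d, complex ^ ('n::finite \<times> 'd::finite)) l2"
  assumes P: "P \<in> closure (smooth_gradients \<theta>)" and \<theta>: "exp (\<i> * of_real (\<theta> $ j)) \<noteq> 1"
  shows "\<exists>N \<in> power_space (H1_theta_perp \<theta>). cls (grad N) = P"
proof -
  obtain w where w: "\<And>k. w k \<in> smooth_gradients \<theta>" "w \<longlonglongrightarrow> P"
    using P by (auto simp: closure_sequential)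
  have "\<exists>\<phi>. \<phi> \<in> smooth_perp \<theta> \<and> w k = cls (classical_grad \<phi>)" for k
    using w(1)[of k] by (auto simp: smooth_gradients_def)
  then obtain \<phi> where \<phi>: "\<And>k. \<phi> k \<in> smooth_perp \<theta>" "\<And>k. w k = cls (classical_grad (\<phi> k))" by metis
  define f where "f i k = (\<lambda>y. \<phi> k y $ i)" for i k
  have f: "smooth (f i k)" "quasi_periodic \<theta> (f i k)" "l2_inner (f i k) (plane_wave \<theta>) = 0" for i k
    using \<phi>(1)[of k] by (auto simp: smooth_perp_iff f_def)
  obtain p where p: "p \<in> L2" "P = cls p" using cls_surj by blast
  have lim: "(\<lambda>k. cls (pd l (f i k))) \<longlonglongrightarrow> cls (\<lambda>y. p y $ (i, l))" for i l
  proof -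
    have "w = (\<lambda>k. cls (classical_grad (\<phi> k)))" using \<phi>(2) by auto
    then have "(\<lambda>k. cls (classical_grad (\<phi> k))) \<longlonglongrightarrow> cls p" using w(2) p(2) by simp
    moreover have "classical_grad (\<phi> k) \<in> L2" for k
      using \<phi>(1)[of k] by (intro classical_grad_L2) (auto simp: smooth_perp_iff)
    ultimately have "\<forall>q. (\<lambda>k. cls (\<lambda>y. classical_grad (\<phi> k) y $ q)) \<longlonglongrightarrow> cls (\<lambda>y. p y $ q)"
      using p(1) by (simp add: cls_vec_tendsto_iff)
    from this[rule_format, of "(i, l)"] show ?thesis
      by (simp add: classical_grad_nth f_def)
  qed
  define c where "c = norm (exp (\<i> * of_real (\<theta> $ j)) - 1)"
  have c: "0 < c" using \<theta> by (simp add: c_def)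
  have "\<exists>u\<in>L2. (\<lambda>k. cls (f i k)) \<longlonglongrightarrow> cls u" for i
  proof -
    have poincare: "c * norm (cls (f i m) - cls (f i k)) \<le> norm (cls (pd j (f i m)) - cls (pd j (f i k)))" for m k
    proof -
      have "c * norm (cls (\<lambda>y. f i m y - f i k y)) \<le> norm (cls (pd j (\<lambda>y. f i m y - f i k y)))"
        unfolding c_def by (intro quasi_periodic_poincare smooth_diff quasi_periodic_diff f)
      moreover have "pd j (\<lambda>y. f i m y - f i k y) = (\<lambda>y. pd j (f i m) y - pd j (f i k) y)"
        by (rule ext) (simp add: pd_diff smooth_differentiable f)
      ultimately show ?thesis
        by (simp add: cls_diff L2_smooth smooth_pd f)
    qed
    have "Cauchy (\<lambda>k. cls (f i k))"
    proof (rule CauchyI)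
      fix e :: real assume "0 < e"
      then have "0 < c * e" using c by simp
      moreover have "Cauchy (\<lambda>k. cls (pd j (f i k)))" using lim by (rule LIMSEQ_imp_Cauchy)
      ultimately obtain M where M: "\<And>m k. m \<ge> M \<Longrightarrow> k \<ge> M \<Longrightarrow> norm (cls (pd j (f i m)) - cls (pd j (f i k))) < c * e"
        using CauchyD by blast
      have "norm (cls (f i m) - cls (f i k)) < e" if "m \<ge> M" "k \<ge> M" for m k
      proof -
        have "c * norm (cls (f i m) - cls (f i k)) < c * e"
          using poincare[of m k] M[OF that] by (rule le_less_trans)
        then show ?thesis using c by simp
      qed
      then show "\<exists>M. \<forall>m\<ge>M. \<forall>n\<ge>M. norm (cls (f i m) - cls (f i n)) < e" by blast
    qed
    then obtain x where "(\<lambda>k. cls (f i k)) \<longlonglongrightarrow> x" using Cauchy_convergent convergent_def by blast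
    then show ?thesis using cls_surj[of x] by auto
  qed
  then obtain n where n: "\<And>i. n i \<in> L2" "\<And>i. (\<lambda>k. cls (f i k)) \<longlonglongrightarrow> cls (n i)" by metis
  have nH: "n i \<in> H1_theta \<theta>" "cls (weak_pd l (n i)) = cls (\<lambda>y. p y $ (i, l))" for i l
    using H1_theta_limit[of "n i" "f i" \<theta> "\<lambda>l. cls (\<lambda>y. p y $ (i, l))"] n f lim by blast+
  have np: "l2_inner (n i) (plane_wave \<theta>) = 0" for i
  proof -
    have "(\<lambda>k. l2_inner (f i k) (plane_wave \<theta>)) \<longlonglongrightarrow> l2_inner (n i) (plane_wave \<theta>)"
      by (intro l2_inner_tendsto n L2_smooth f smooth_plane_wave)
    then show ?thesis by (simp add: f LIMSEQ_const_iff)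
  qed
  define N where "N = (\<lambda>y. \<chi> i. n i y)"
  have N: "N \<in> power_space (H1_theta_perp \<theta>)"
    by (simp add: power_space_def N_def H1_theta_perp_def nH np)
  have "cls (grad N) = cls p"
    using nH(2) by (subst cls_vec_eq_iff) (auto simp: grad_nth N_def intro!: grad_L2 perp_subset N[unfolded N_def] p)
  then show ?thesis using N p by blast
qed

text \<open>The space of smooth gradients is invariant under multiplication by \<open>\<i>\<close>, so real orthogonality to it is
complex orthogonality, and this extends to the closure.\<close>

lemma l2_inner_vec_zero_closure:
  assumes u: "u \<in> L2"
    and zero: "\<And>q. q \<in> smooth_gradients \<theta> \<Longrightarrow> cls u \<bullet> q = 0"
    and \<phi>: "\<phi> \<in> power_space (H1_theta_perp \<theta>)"
  shows "l2_inner_vec u (grad \<phi>) = 0"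
proof -
  let ?iu = "\<lambda>y. (- \<i>) *s u y"
  have iu: "?iu \<in> L2" by (rule L2_vec_cmult[OF u])
  have zero': "cls ?iu \<bullet> q = 0" if q: "q \<in> smooth_gradients \<theta>" for q
  proof -
    obtain \<psi> where \<psi>: "\<psi> \<in> smooth_perp \<theta>" "q = cls (classical_grad \<psi>)" using q by (auto simp: smooth_gradients_def)
    have g: "classical_grad \<psi> \<in> L2" using \<psi>(1) by (intro classical_grad_L2) (simp add: smooth_perp_iff)
    have "cls ?iu \<bullet> q = (LINT y|cell. ?iu y \<bullet> classical_grad \<psi> y)" by (simp only: \<psi>(2) inner_cls iu g)
    also have "\<dots> = (LINT y|cell. u y \<bullet> (\<i> *s classical_grad \<psi> y))"
      by (simp add: inner_vec_def inner_complex_def algebra_simps)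
    also have "\<dots> = cls u \<bullet> cls (\<lambda>y. \<i> *s classical_grad \<psi> y)" by (simp add: inner_cls u L2_vec_cmult g)
    also have "\<dots> = 0"
      using smooth_perp_imult[OF \<psi>(1)] classical_grad_imult[OF \<psi>(1)]
      by (intro zero) (force simp: smooth_gradients_def)
    finally show ?thesis .
  qed
  have cl: "x \<bullet> q = 0" if "\<And>q. q \<in> smooth_gradients \<theta> \<Longrightarrow> x \<bullet> q = 0" "q \<in> closure (smooth_gradients \<theta>)" for x q
  proof -
    have "closed {q. x \<bullet> q = 0}" by (intro closed_Collect_eq continuous_intros)
    then have "closure (smooth_gradients \<theta>) \<subseteq> {q. x \<bullet> q = 0}" using that(1) by (intro closure_minimal) auto
    then show ?thesis using that(2) by auto
  qed
  have q: "cls (grad \<phi>) \<in> closure (smooth_gradients \<theta>)" by (rule grad_in_closure[OF \<phi>])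
  have "grad \<phi> \<in> L2" by (rule grad_L2[OF perp_subset[OF \<phi>]])
  then show ?thesis
    using cl[OF zero q] cl[OF zero' q] by (simp only: l2_inner_vec_cls[OF u]) simp
qed

section \<open>Matrices with positive real part\<close>

lemma norm_matrix_vector_le:
  fixes A :: "complex ^ 'm ^ 'k" and x :: "complex ^ 'm"
  shows "norm (A *v x) \<le> of_nat (CARD('k) * CARD('m)) * norm A * norm x"
proof -
  have "norm ((A *v x) $ i) \<le> of_nat CARD('m) * (norm A * norm x)" for i
  proof -
    have "norm ((A *v x) $ i) \<le> (\<Sum>j\<in>UNIV. norm (A $ i $ j) * norm (x $ j))"
      unfolding matrix_vector_mult_def by (simp add: norm_mult[symmetric]) (rule norm_sum)
    also have "\<dots> \<le> (\<Sum>j\<in>(UNIV :: 'm set). norm A * norm x)"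
      by (intro sum_mono mult_mono order_trans[OF Finite_Cartesian_Product.norm_nth_le Finite_Cartesian_Product.norm_nth_le]
         Finite_Cartesian_Product.norm_nth_le) auto
    finally show ?thesis by simp
  qed
  then have "(\<Sum>i\<in>UNIV. norm ((A *v x) $ i)) \<le> (\<Sum>i\<in>(UNIV :: 'k set). of_nat CARD('m) * (norm A * norm x))"
    by (intro sum_mono)
  moreover have "norm (A *v x) \<le> (\<Sum>i\<in>UNIV. norm ((A *v x) $ i))"
    unfolding norm_vec_def by (rule L2_set_le_sum) auto
  ultimately show ?thesis by (simp add: mult_ac)
qed

lemma inner_eq_Re_cinner: "x \<bullet> y = Re (cinner x y)"
  by (simp add: cinner_def inner_vec_def inner_complex_def)

lemma hermitian_inner:
  assumes "A = cadjoint A" shows "(A *v x) \<bullet> y = x \<bullet> (A *v y)"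
proof -
  have A: "A $ i $ j = cnj (A $ j $ i)" for i j
    using arg_cong[OF assms, of "\<lambda>B. B $ i $ j"] by (simp add: cadjoint_def)
  have "(A *v x) \<bullet> y = Re (\<Sum>i\<in>UNIV. \<Sum>j\<in>UNIV. A $ i $ j * x $ j * cnj (y $ i))"
    by (simp only: inner_eq_Re_cinner cinner_def matrix_vector_mult_def vec_lambda_beta sum_distrib_right)
  also have "(\<Sum>i\<in>UNIV. \<Sum>j\<in>UNIV. A $ i $ j * x $ j * cnj (y $ i)) = (\<Sum>j\<in>UNIV. \<Sum>i\<in>UNIV. A $ i $ j * x $ j * cnj (y $ i))"
    by (rule sum.swap)
  also have "\<dots> = (\<Sum>j\<in>UNIV. x $ j * cnj ((A *v y) $ j))"
    unfolding matrix_vector_mult_def by (simp add: sum_distrib_left, intro sum.cong refl, subst A, simp)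
  also have "Re \<dots> = x \<bullet> (A *v y)"
    by (simp only: inner_eq_Re_cinner cinner_def)
  finally show ?thesis .
qed

lemma complex_matrix_vector_scaleR: "A *v (r *\<^sub>R x) = r *\<^sub>R (A *v (x :: complex ^ 'm))"
  by (simp add: vec_eq_iff matrix_vector_mult_def scaleR_sum_right)

lemma coercive_inner:
  assumes "A = cadjoint A" "pos_semidef (re_part A - \<nu> *\<^sub>R mat 1)"
  shows "\<nu> * (norm x)\<^sup>2 \<le> (A *v x) \<bullet> x"
proof -
  have "re_part A = A"
    unfolding re_part_def assms(1)[symmetric] by (simp add: vec_eq_iff scaleR_2[symmetric] flip: scaleR_2)
  moreover have "(\<nu> *\<^sub>R mat 1 :: complex ^ 'a ^ 'a) *v x = \<nu> *\<^sub>R x"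
    by (simp add: vec_eq_iff matrix_vector_mult_def mat_def scaleR_conv_of_real[where 'a=complex] if_distrib if_distribR cong: if_cong)
  ultimately have "(re_part A - \<nu> *\<^sub>R mat 1) *v x = A *v x - \<nu> *\<^sub>R x"
    by (simp add: matrix_vector_mult_diff_rdistrib)
  moreover have "0 \<le> ((re_part A - \<nu> *\<^sub>R mat 1) *v x) \<bullet> x"
    using assms(2) by (simp add: pos_semidef_def inner_eq_Re_cinner)
  ultimately have "0 \<le> (A *v x - \<nu> *\<^sub>R x) \<bullet> x" by simp
  then show ?thesis by (simp add: inner_diff_left power2_norm_eq_inner)
qed

section \<open>The form of an elliptic coefficient\<close>

locale elliptic_coefficient =
  fixes a :: "real ^ 'd \<Rightarrow> complex ^ 'm ^ 'm" and C \<nu> :: real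
  assumes measurable: "a \<in> borel_measurable cell"
    and bounded: "AE y in cell. norm (a y) \<le> C"
    and hermitian: "AE y in cell. a y = cadjoint (a y)"
    and pos: "0 < \<nu>"
    and coercive: "AE y in cell. pos_semidef (re_part (a y) - \<nu> *\<^sub>R mat 1)"
begin

lemma apply_L2:
  assumes u: "u \<in> L2"
  shows "(\<lambda>y. a y *v u y) \<in> L2"
    and "norm (cls (\<lambda>y. a y *v u y)) \<le> (of_nat (CARD('m) * CARD('m)) * \<bar>C\<bar>) * norm (cls u)"
proof -
  define K where "K = of_nat (CARD('m) * CARD('m)) * \<bar>C\<bar>"
  have "(\<lambda>y. (a y *v u y) $ i) \<in> borel_measurable cell" for i
    unfolding matrix_vector_mult_def
    by (simp, intro borel_measurable_sum borel_measurable_times borel_measurable_vec_nth measurable L2_measurable u)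
  then have meas: "(\<lambda>y. a y *v u y) \<in> borel_measurable cell" by (rule borel_measurable_vecI)
  have bd: "AE y in cell. (norm (a y *v u y))\<^sup>2 \<le> K\<^sup>2 * (norm (u y))\<^sup>2"
    using bounded
  proof eventually_elim
    case (elim y)
    have "norm (a y *v u y) \<le> of_nat (CARD('m) * CARD('m)) * norm (a y) * norm (u y)" by (rule norm_matrix_vector_le)
    also have "\<dots> \<le> K * norm (u y)" unfolding K_def using elim by (intro mult_right_mono mult_left_mono) auto
    finally have "(norm (a y *v u y))\<^sup>2 \<le> (K * norm (u y))\<^sup>2" by (intro power_mono) auto
    then show ?case by (simp add: power_mult_distrib)
  qed
  show L: "(\<lambda>y. a y *v u y) \<in> L2"
    by (rule L2_bound[OF meas _ bd]) (simp add: L2_integrable u)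
  have "(norm (cls (\<lambda>y. a y *v u y)))\<^sup>2 \<le> (LINT y|cell. K\<^sup>2 * (norm (u y))\<^sup>2)"
    unfolding norm_cls[OF L] by (rule integral_mono_AE) (auto simp: L2_integrable L u bd)
  also have "\<dots> = (K * norm (cls u))\<^sup>2" by (simp add: norm_cls u power_mult_distrib)
  finally show "norm (cls (\<lambda>y. a y *v u y)) \<le> (of_nat (CARD('m) * CARD('m)) * \<bar>C\<bar>) * norm (cls u)"
    unfolding K_def[symmetric] by (rule power2_le_imp_le) (simp add: K_def)
qed

text \<open>The form is defined on classes through an arbitrary representative; \<open>form_cls\<close> shows that the choice
does not matter.\<close>

definition form :: "('d, complex ^ 'm) l2 \<Rightarrow> ('d, complex ^ 'm) l2 \<Rightarrow> real" where
  "form x q = cls (\<lambda>y. a y *v (SOME u. u \<in> L2 \<and> x = cls u) y) \<bullet> q"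

lemma form_cls:
  assumes u: "u \<in> L2"
  shows "form (cls u) q = cls (\<lambda>y. a y *v u y) \<bullet> q"
proof -
  define u' where "u' = (SOME u'. u' \<in> L2 \<and> cls u = cls u')"
  have u': "u' \<in> L2 \<and> cls u = cls u'"
    unfolding u'_def by (rule someI[of _ u]) (use u in auto)
  then have "AE y in cell. u y = u' y" using u cls_eq_iff by blast
  then have "cls (\<lambda>y. a y *v u' y) = cls (\<lambda>y. a y *v u y)"
    using u u' by (subst cls_eq_iff) (auto intro: apply_L2 elim: eventually_mono)
  then show ?thesis by (simp add: form_def u'_def)
qed

lemma form_sym: "form x q = form q x"
proof -
  obtain u v where uv: "u \<in> L2" "v \<in> L2" "x = cls u" "q = cls v" using cls_surj by metis
  have "(LINT y|cell. (a y *v u y) \<bullet> v y) = (LINT y|cell. (a y *v v y) \<bullet> u y)"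
  proof (rule integral_cong_AE)
    show "AE y in cell. (a y *v u y) \<bullet> v y = (a y *v v y) \<bullet> u y"
      using hermitian by eventually_elim (metis hermitian_inner inner_commute)
  qed (use uv apply_L2 in \<open>auto intro!: borel_measurable_integrable L2_inner_integrable\<close>)
  then show ?thesis by (simp add: uv form_cls inner_cls apply_L2)
qed

lemma form_coercive: "\<nu> * (norm x)\<^sup>2 \<le> form x x"
proof -
  obtain u where u: "u \<in> L2" "x = cls u" using cls_surj by metis
  have "(LINT y|cell. \<nu> * (norm (u y))\<^sup>2) \<le> (LINT y|cell. (a y *v u y) \<bullet> u y)"
  proof (rule integral_mono_AE)
    show "AE y in cell. \<nu> * (norm (u y))\<^sup>2 \<le> (a y *v u y) \<bullet> u y"
      using hermitian coercive by eventually_elim (rule coercive_inner)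
  qed (auto simp: L2_integrable L2_inner_integrable u apply_L2)
  then show ?thesis by (simp add: u form_cls inner_cls apply_L2 norm_cls)
qed

lemma bounded_bilinear_form: "bounded_bilinear form"
proof
  fix x x' q q' :: "('d, complex ^ 'm) l2" and r :: real
  obtain u u' where u: "u \<in> L2" "x = cls u" "u' \<in> L2" "x' = cls u'" using cls_surj by metis
  show "form (x + x') q = form x q + form x' q"
    by (simp add: u cls_add[symmetric] form_cls L2_add matrix_vector_right_distrib)
      (simp add: cls_add apply_L2 u inner_add_left)
  show "form x (q + q') = form x q + form x q'" by (simp add: form_def inner_add_right)
  show "form (r *\<^sub>R x) q = r *\<^sub>R form x q"
    by (simp add: u cls_scaleR[symmetric] form_cls L2_scaleR complex_matrix_vector_scaleR)
      (simp add: cls_scaleR apply_L2 u)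
  show "form x (r *\<^sub>R q) = r *\<^sub>R form x q" by (simp add: form_def)
next
  show "\<exists>K. \<forall>x q. norm (form x q) \<le> norm x * norm q * K"
  proof (intro exI allI)
    fix x q :: "('d, complex ^ 'm) l2"
    obtain u where u: "u \<in> L2" "x = cls u" using cls_surj by metis
    have "norm (form x q) \<le> norm (cls (\<lambda>y. a y *v u y)) * norm q"
      using u by (simp add: form_cls Cauchy_Schwarz_ineq2)
    also have "\<dots> \<le> ((of_nat (CARD('m) * CARD('m)) * \<bar>C\<bar>) * norm (cls u)) * norm q"
      by (intro mult_right_mono apply_L2 u) auto
    finally show "norm (form x q) \<le> norm x * norm q * (of_nat (CARD('m) * CARD('m)) * \<bar>C\<bar>)"
      by (simp add: u mult_ac)
  qed
qed

end

section \<open>The fibre-homogenised tensor\<close>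

lemma plane_wave_L2: "(\<lambda>y. plane_wave \<theta> y *s X) \<in> L2"
  by (auto simp: L2_vec_iff intro!: L2_smooth smooth_mult smooth_plane_wave smooth_const)

lemma matrix_vector_mult_smult: "A *v (c *s x) = c *s (A *v (x :: complex ^ 'm))"
  by (simp add: vec_eq_iff matrix_vector_mult_def sum_distrib_left mult_ac)

lemma inner_plane_wave_smult:
  "(plane_wave (- \<theta>) y *s v) \<bullet> X = v \<bullet> (plane_wave \<theta> y *s X)"
proof -
  have "Re (plane_wave (- \<theta>) y * z * cnj w) = Re (z * cnj (plane_wave \<theta> y * w))" for z w
    by (simp add: cnj_plane_wave mult_ac)
  then show ?thesis by (simp add: inner_eq_Re_cinner cinner_def)
qed

locale homogenisation = elliptic_coefficient a C \<nu>
  for a :: "real ^ 'd \<Rightarrow> complex ^ ('n::finite \<times> 'd::finite) ^ ('n::finite \<times> 'd::finite)" and C \<nu>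
begin

abbreviation datum :: "real ^ 'd \<Rightarrow> complex ^ ('n \<times> 'd) \<Rightarrow> ('d, complex ^ ('n \<times> 'd)) l2" where
  "datum \<theta> X \<equiv> cls (\<lambda>y. plane_wave \<theta> y *s X)"

definition mean :: "complex ^ ('n \<times> 'd) \<Rightarrow> complex ^ ('n \<times> 'd)" where
  "mean X = (LINT y|cell. a y *v X)"

lemma flux_L2:
  fixes N :: "real ^ 'd \<Rightarrow> complex ^ 'n"
  assumes "N \<in> power_space (H1_theta_perp \<theta>)"
  shows "(\<lambda>y. grad N y + plane_wave \<theta> y *s X) \<in> L2"
  by (intro L2_add grad_L2[OF perp_subset[OF assms]] plane_wave_L2)

text \<open>The corrector equation as an identity between classes; applied with the corrector as test function it is
the energy identity.\<close>

lemma corrector_form_zero: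
  fixes N \<phi> :: "real ^ 'd \<Rightarrow> complex ^ 'n"
  assumes N: "is_corrector a \<theta> X N" and \<phi>: "\<phi> \<in> power_space (H1_theta_perp \<theta>)"
  shows "form (cls (grad N) + datum \<theta> X) (cls (grad \<phi>)) = 0"
proof -
  have NV: "N \<in> power_space (H1_theta_perp \<theta>)" using N by (simp add: is_corrector_def)
  let ?F = "\<lambda>y. grad N y + plane_wave \<theta> y *s X"
  have F: "?F \<in> L2" by (rule flux_L2[OF NV])
  have g: "grad \<phi> \<in> L2" by (rule grad_L2[OF perp_subset[OF \<phi>]])
  have "form (cls ?F) (cls (grad \<phi>)) = Re (l2_inner_vec (\<lambda>y. a y *v ?F y) (grad \<phi>))"
    by (simp add: form_cls F l2_inner_vec_cls apply_L2 g)
  also have "\<dots> = 0" using N \<phi> by (simp add: is_corrector_def)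
  also have "cls ?F = cls (grad N) + datum \<theta> X"
    by (intro cls_add grad_L2[OF perp_subset[OF NV]] plane_wave_L2)
  finally show ?thesis .
qed

lemma form_zero_imp_grad_zero:
  fixes N :: "real ^ 'd \<Rightarrow> complex ^ 'n"
  assumes N: "is_corrector a \<theta> X N" and "form (datum \<theta> X) (cls (grad N)) = 0"
  shows "cls (grad N) = 0"
proof -
  interpret form: bounded_bilinear form by (rule bounded_bilinear_form)
  have "N \<in> power_space (H1_theta_perp \<theta>)" using N by (simp add: is_corrector_def)
  from corrector_form_zero[OF N this] have "form (cls (grad N)) (cls (grad N)) = 0"
    using assms(2) by (simp add: form.add_left)
  then have "\<nu> * (norm (cls (grad N)))\<^sup>2 \<le> 0" using form_coercive[of "cls (grad N)"] by simp
  then show ?thesis using pos by (simp add: mult_le_0_iff)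
qed

lemma a_hom_integrand_L2:
  assumes u: "u \<in> L2"
  shows "(\<lambda>y. plane_wave (- \<theta>) y *s (a y *v u y)) \<in> L2"
proof (rule L2_bound[OF _ L2_integrable[OF apply_L2(1)[OF u]]])
    have "(\<lambda>y. plane_wave (- \<theta>) y) \<in> borel_measurable cell"
      by (intro continuous_measurable_cell smooth_continuous_on smooth_plane_wave)
    then show "(\<lambda>y. plane_wave (- \<theta>) y *s (a y *v u y)) \<in> borel_measurable cell"
      by (intro borel_measurable_vecI) (auto intro!: borel_measurable_times borel_measurable_vec_nth[OF L2_measurable[OF apply_L2(1)[OF u]]])
  qed (simp add: norm_vec_square norm_mult)

text \<open>Moving the phase from the integrand to \<open>X\<close> turns the diagonal of the homogenised tensor into a value of
the form.\<close>

lemma a_hom_inner: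
  fixes N :: "real ^ 'd \<Rightarrow> complex ^ 'n"
  assumes N: "N \<in> power_space (H1_theta_perp \<theta>)"
  shows "(LINT y|cell. plane_wave (- \<theta>) y *s (a y *v (grad N y + plane_wave \<theta> y *s X))) \<bullet> X =
    form (cls (grad N) + datum \<theta> X) (datum \<theta> X)"
proof -
  let ?F = "\<lambda>y. grad N y + plane_wave \<theta> y *s X"
  have F: "?F \<in> L2" by (rule flux_L2[OF N])
  have aF: "(\<lambda>y. a y *v ?F y) \<in> L2" by (rule apply_L2[OF F])
  have "(\<lambda>y. plane_wave (- \<theta>) y *s (a y *v ?F y)) \<in> L2" by (rule a_hom_integrand_L2[OF F])
  then have int: "integrable cell (\<lambda>y. plane_wave (- \<theta>) y *s (a y *v ?F y))" by (rule L2_integrable_self)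
  have "(LINT y|cell. plane_wave (- \<theta>) y *s (a y *v ?F y)) \<bullet> X = (LINT y|cell. (plane_wave (- \<theta>) y *s (a y *v ?F y)) \<bullet> X)"
    by (rule integral_inner_left[symmetric]) (rule int)
  also have "\<dots> = (LINT y|cell. (a y *v ?F y) \<bullet> (plane_wave \<theta> y *s X))"
    by (simp only: inner_plane_wave_smult)
  also have "\<dots> = form (cls ?F) (datum \<theta> X)"
    by (simp add: form_cls F inner_cls aF plane_wave_L2)
  also have "cls ?F = cls (grad N) + datum \<theta> X"
    by (intro cls_add grad_L2[OF perp_subset[OF N]] plane_wave_L2)
  finally show ?thesis .
qed

lemma form_datum: "form (datum \<theta> X) (datum \<theta> X) = mean X \<bullet> X"
proof -
  have X: "(\<lambda>y :: real ^ 'd. X) \<in> L2" by (intro L2_continuous continuous_intros)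
  have "form (datum \<theta> X) (datum \<theta> X) = (LINT y|cell. (a y *v (plane_wave \<theta> y *s X)) \<bullet> (plane_wave \<theta> y *s X))"
    by (simp add: form_cls plane_wave_L2 inner_cls apply_L2)
  also have "\<dots> = (LINT y|cell. (a y *v X) \<bullet> X)"
  proof -
    have "(plane_wave \<theta> y *s v) \<bullet> (plane_wave \<theta> y *s X) = v \<bullet> X" for y v
      using inner_plane_wave_smult[of \<theta> y "plane_wave \<theta> y *s v" X] by (simp add: plane_wave_cancel)
    then show ?thesis by (simp add: matrix_vector_mult_smult)
  qed
  also have "\<dots> = mean X \<bullet> X"
    unfolding mean_def by (rule integral_inner_left) (intro impI L2_integrable_self apply_L2 X)
  finally show ?thesis .
qed

text \<open>Under the orthogonality the zero function is a corrector, so the chosen corrector also solves the corrector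
equation. The orthogonality then makes its energy vanish, and the integrand reduces to \<open>a X\<close>.\<close>

lemma a_hom_eq_mean:
  assumes orth: "\<And>\<phi> :: real ^ 'd \<Rightarrow> complex ^ 'n. \<phi> \<in> power_space (H1_theta_perp \<theta>) \<Longrightarrow>
      l2_inner_vec (\<lambda>y. a y *v (plane_wave \<theta> y *s X)) (grad \<phi>) = 0"
  shows "a_hom a \<theta> X = mean X"
proof -
  let ?z = "\<lambda>y :: real ^ 'd. 0 :: complex ^ 'n"
  have z: "?z \<in> smooth_perp \<theta>"
    by (simp add: smooth_perp_iff smooth_const quasi_periodic_def l2_inner_def)
  then have z': "?z \<in> power_space (H1_theta_perp \<theta>)" by (rule smooth_perp_subset)
  have "cls (grad ?z) = cls (classical_grad ?z)"
    by (rule grad_smooth[OF _ perp_subset[OF z']]) (simp add: smooth_const)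
  also have "classical_grad ?z = (\<lambda>y. 0)" by (intro ext) (simp add: vec_eq_iff classical_grad_nth pd_const)
  finally have g0: "AE y in cell. grad ?z y = 0"
    using cls_eq_iff[OF grad_L2[OF perp_subset[OF z']] L2_zero] by simp
  have "is_corrector a \<theta> X ?z"
    unfolding is_corrector_def
  proof (intro conjI z' ballI)
    fix \<phi> :: "real ^ 'd \<Rightarrow> complex ^ 'n" assume \<phi>: "\<phi> \<in> power_space (H1_theta_perp \<theta>)"
    have "l2_inner_vec (\<lambda>y. a y *v (grad ?z y + plane_wave \<theta> y *s X)) (grad \<phi>) =
      l2_inner_vec (\<lambda>y. a y *v (plane_wave \<theta> y *s X)) (grad \<phi>)"
    proof (rule l2_inner_vec_cong)
      show "cls (\<lambda>y. a y *v (grad ?z y + plane_wave \<theta> y *s X)) = cls (\<lambda>y. a y *v (plane_wave \<theta> y *s X))"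
        using g0 by (intro cls_eq_iff[THEN iffD2] apply_L2 flux_L2[OF z'] plane_wave_L2) (auto elim: eventually_mono)
    qed (auto intro!: apply_L2 flux_L2[OF z'] plane_wave_L2 grad_L2[OF perp_subset[OF \<phi>]])
    then show "l2_inner_vec (\<lambda>y. a y *v (grad ?z y + plane_wave \<theta> y *s X)) (grad \<phi>) = 0"
      using orth[OF \<phi>] by simp
  qed
  then have N: "is_corrector a \<theta> X (corrector a \<theta> X)"
    unfolding corrector_def by (rule someI[of "is_corrector a \<theta> X"])
  let ?N = "corrector a \<theta> X"
  have NV: "?N \<in> power_space (H1_theta_perp \<theta>)" using N by (simp add: is_corrector_def)
  have gN: "grad ?N \<in> L2" by (rule grad_L2[OF perp_subset[OF NV]])
  have "form (datum \<theta> X) (cls (grad ?N)) = Re (l2_inner_vec (\<lambda>y. a y *v (plane_wave \<theta> y *s X)) (grad ?N))"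
    by (simp add: form_cls plane_wave_L2 l2_inner_vec_cls apply_L2 gN)
  then have "cls (grad ?N) = 0" by (intro form_zero_imp_grad_zero[OF N]) (simp add: orth[OF NV])
  then have "AE y in cell. grad ?N y = 0"
    using cls_eq_iff[OF gN L2_zero] by (simp add: cls_zero)
  then have "AE y in cell. plane_wave (- \<theta>) y *s (a y *v (grad ?N y + plane_wave \<theta> y *s X)) = a y *v X"
  proof eventually_elim
    case (elim y)
    then show ?case by (simp add: matrix_vector_mult_smult plane_wave_cancel)
  qed
  then show ?thesis
    unfolding a_hom_def mean_def
    by (intro integral_cong_AE L2_measurable a_hom_integrand_L2 apply_L2 flux_L2[OF NV] L2_continuous[OF continuous_on_const])
qed

text \<open>Minimising the form over smooth gradients produces an element of their closure, which is a gradient.\<close>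

lemma corrector_exists:
  assumes "exp (\<i> * of_real (\<theta> $ j)) \<noteq> 1"
  shows "is_corrector a \<theta> X (corrector a \<theta> X)"
proof -
  obtain p where p: "p \<in> closure (smooth_gradients \<theta> :: ('d, complex ^ ('n \<times> 'd)) l2 set)"
    "\<And>q. q \<in> smooth_gradients \<theta> \<Longrightarrow> form (datum \<theta> X + p) q = 0"
    using riesz_on_subspace[OF bounded_bilinear_form form_sym pos form_coercive subspace_smooth_gradients] by metis
  obtain N :: "real ^ 'd \<Rightarrow> complex ^ 'n" where N: "N \<in> power_space (H1_theta_perp \<theta>)" "cls (grad N) = p"
    using closure_smooth_gradients_is_grad[OF p(1) assms] by auto
  have F: "(\<lambda>y. grad N y + plane_wave \<theta> y *s X) \<in> L2" by (rule flux_L2[OF N(1)])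
  have "cls (\<lambda>y. grad N y + plane_wave \<theta> y *s X) = datum \<theta> X + p"
    using cls_add[OF grad_L2[OF perp_subset[OF N(1)]] plane_wave_L2] N(2) by (simp add: add.commute)
  then have "cls (\<lambda>y. a y *v (grad N y + plane_wave \<theta> y *s X)) \<bullet> q = 0" if "q \<in> smooth_gradients \<theta>" for q
    using p(2)[OF that] form_cls[OF F] by simp
  then have "is_corrector a \<theta> X N"
    unfolding is_corrector_def
    by (intro conjI N ballI l2_inner_vec_zero_closure[OF apply_L2(1)[OF F]])
  then show ?thesis unfolding corrector_def by (rule someI[of "is_corrector a \<theta> X"])
qed

text \<open>By symmetry of the form the identity \<open>a_hom \<theta> X = mean X\<close>, tested with \<open>X\<close>, says that the form vanishes
at the pair of the datum and the gradient of the corrector. So this gradient is zero, and the corrector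
equation is the orthogonality claimed.\<close>

lemma orthogonal_if_a_hom_eq_mean:
  fixes \<phi> :: "real ^ 'd \<Rightarrow> complex ^ 'n"
  assumes \<theta>: "exp (\<i> * of_real (\<theta> $ j)) \<noteq> 1" and hom: "a_hom a \<theta> X = mean X"
    and \<phi>: "\<phi> \<in> power_space (H1_theta_perp \<theta>)"
  shows "l2_inner_vec (\<lambda>y. a y *v (plane_wave \<theta> y *s X)) (grad \<phi>) = 0"
proof -
  interpret form: bounded_bilinear form by (rule bounded_bilinear_form)
  let ?N = "corrector a \<theta> X"
  have N: "is_corrector a \<theta> X ?N" by (rule corrector_exists[OF \<theta>])
  then have NV: "?N \<in> power_space (H1_theta_perp \<theta>)" by (simp add: is_corrector_def)
  have "mean X \<bullet> X = form (cls (grad ?N)) (datum \<theta> X) + form (datum \<theta> X) (datum \<theta> X)"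
    using a_hom_inner[OF NV, of X] hom by (simp add: a_hom_def form.add_left)
  then have "form (datum \<theta> X) (cls (grad ?N)) = 0" by (simp add: form_datum form_sym)
  then have "cls (grad ?N) = 0" by (rule form_zero_imp_grad_zero[OF N])
  then have "AE y in cell. grad ?N y = 0"
    using cls_eq_iff[OF grad_L2[OF perp_subset[OF NV]] L2_zero] by (simp add: cls_zero)
  then have "cls (\<lambda>y. a y *v (grad ?N y + plane_wave \<theta> y *s X)) = cls (\<lambda>y. a y *v (plane_wave \<theta> y *s X))"
    by (intro cls_eq_iff[THEN iffD2] apply_L2 flux_L2[OF NV] plane_wave_L2) (auto elim: eventually_mono)
  then have "l2_inner_vec (\<lambda>y. a y *v (grad ?N y + plane_wave \<theta> y *s X)) (grad \<phi>) =
      l2_inner_vec (\<lambda>y. a y *v (plane_wave \<theta> y *s X)) (grad \<phi>)"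
    by (intro l2_inner_vec_cong) (auto intro!: apply_L2 flux_L2[OF NV] plane_wave_L2 grad_L2[OF perp_subset[OF \<phi>]])
  then show ?thesis using N \<phi> by (simp add: is_corrector_def)
qed

end

section \<open>Constant coefficients and the constancy of columns\<close>

lemma exp_i_neq_1: "exp \<i> \<noteq> (1 :: complex)"
proof
  assume "exp \<i> = (1 :: complex)"
  moreover have "Im (exp \<i>) = sin 1" by (simp add: Im_exp)
  ultimately have "sin 1 = (0 :: real)" by simp
  then show False using sin_gt_zero[of 1] pi_gt3 by simp
qed

context homogenisation
begin

lemma constant_orthogonal:
  fixes \<phi> :: "real ^ 'd \<Rightarrow> complex ^ 'n"
  assumes A: "AE y in cell. a y = A" and \<phi>: "\<phi> \<in> power_space (H1_theta_perp \<theta>)"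
  shows "l2_inner_vec (\<lambda>y. a y *v (plane_wave \<theta> y *s X)) (grad \<phi>) = 0"
proof -
  have "l2_inner_vec (\<lambda>y. a y *v (plane_wave \<theta> y *s X)) (grad \<phi>) = l2_inner_vec (\<lambda>y. plane_wave \<theta> y *s (A *v X)) (grad \<phi>)"
  proof (rule l2_inner_vec_cong)
    show "cls (\<lambda>y. a y *v (plane_wave \<theta> y *s X)) = cls (\<lambda>y. plane_wave \<theta> y *s (A *v X))"
      using A by (intro cls_eq_iff[THEN iffD2] apply_L2 plane_wave_L2)
        (auto simp: matrix_vector_mult_smult elim: eventually_mono)
  qed (auto intro!: apply_L2 plane_wave_L2 grad_L2[OF perp_subset[OF \<phi>]])
  also have "\<dots> = 0"
    unfolding l2_inner_vec_def
  proof (rule sum.neutral, intro ballI)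
    fix p :: "'n \<times> 'd"
    have u: "(\<lambda>y. \<phi> y $ fst p) \<in> H1_theta \<theta>" "l2_inner (\<lambda>y. \<phi> y $ fst p) (plane_wave \<theta>) = 0"
      using \<phi> by (auto simp: power_space_def H1_theta_perp_def)
    have "l2_inner (plane_wave \<theta>) (weak_pd (snd p) (\<lambda>y. \<phi> y $ fst p)) = 0"
      by (subst l2_inner_commute[symmetric]) (simp add: l2_inner_weak_pd_plane_wave[OF u(1)] u(2))
    then show "l2_inner (\<lambda>y. (plane_wave \<theta> y *s (A *v X)) $ p) (\<lambda>y. grad \<phi> y $ p) = 0"
      using l2_inner_cmult[of "(A *v X) $ p" "plane_wave \<theta>"] by (simp add: grad_nth mult.commute)
  qed
  finally show ?thesis .
qed

text \<open>The test function is the plane wave of frequency \<open>axis j 1\<close> times \<open>\<psi>\<close>, placed in row \<open>i\<close>. It is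
perpendicular to the plane wave because \<open>\<psi>\<close> has mean zero. The phases cancel in the integrals, and of
\<open>\<nabla>\<psi> + \<i> \<theta> \<psi>\<close> the gradient is annihilated by the divergence condition while \<open>\<theta>\<close> selects the
column \<open>j\<close>.\<close>

lemma column_orthogonal_mean_zero:
  assumes ker: "(\<lambda>y. a y *v X) \<in> ker_div_per" and hom: "a_hom a (axis j 1) X = mean X"
    and \<psi>: "smooth \<psi>" "quasi_periodic 0 \<psi>" "(LINT y|cell. \<psi> y) = 0"
  shows "l2_inner (\<lambda>y. (a y *v X) $ (i, j)) \<psi> = 0"
proof -
  define \<theta> :: "real ^ 'd" where "\<theta> = axis j 1"
  define \<Psi> :: "real ^ 'd \<Rightarrow> complex ^ 'n" where "\<Psi> y = (\<chi> i'. if i' = i then \<psi> y else 0)" for y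
  define \<phi> where "\<phi> y = plane_wave \<theta> y *s \<Psi> y" for y
  let ?aX = "\<lambda>y. a y *v X"
  have aX: "?aX \<in> L2" by (intro apply_L2 L2_continuous continuous_intros)
  have aXp: "(\<lambda>y. ?aX y $ p) \<in> L2" for p using aX unfolding L2_vec_iff by blast
  have s\<Psi>: "smooth (\<lambda>y. \<Psi> y $ i')" "quasi_periodic 0 (\<lambda>y. \<Psi> y $ i')" for i'
    using \<psi> by (cases "i' = i"; simp add: \<Psi>_def smooth_const quasi_periodic_def)+
  have s\<phi>: "smooth (\<lambda>y. \<phi> y $ i')" for i'
    by (simp add: \<phi>_def smooth_mult smooth_plane_wave s\<Psi>)
  have "l2_inner (\<lambda>y. \<phi> y $ i') (plane_wave \<theta>) = 0" for i'
  proof -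
    have "\<phi> y $ i' * cnj (plane_wave \<theta> y) = \<Psi> y $ i'" for y
      using plane_wave_mult_cnj[of \<theta> y] by (simp add: \<phi>_def mult.commute mult.left_commute[of _ "plane_wave \<theta> y"])
    then have "l2_inner (\<lambda>y. \<phi> y $ i') (plane_wave \<theta>) = (LINT y|cell. \<Psi> y $ i')"
      by (simp only: l2_inner_def)
    then show ?thesis using \<psi>(3) by (cases "i' = i") (simp_all add: \<Psi>_def)
  qed
  then have \<phi>: "\<phi> \<in> smooth_perp \<theta>"
    using quasi_periodic_mult[OF quasi_periodic_plane_wave s\<Psi>(2), of \<theta>]
    by (simp add: smooth_perp_iff s\<phi>) (simp add: \<phi>_def)
  then have \<phi>V: "\<phi> \<in> power_space (H1_theta_perp \<theta>)" by (rule smooth_perp_subset)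
  have \<Psi>V: "\<Psi> \<in> power_space (H1_theta 0)"
    by (simp add: power_space_def smooth_H1_theta s\<Psi>)
  have cg\<Psi>: "classical_grad \<Psi> \<in> L2" by (intro classical_grad_L2 s\<Psi>)
  have cg: "classical_grad \<phi> y $ p = plane_wave \<theta> y * (classical_grad \<Psi> y $ p + \<i> * of_real (\<theta> $ snd p) * \<Psi> y $ fst p)" for y p
    unfolding classical_grad_nth \<phi>_def
    by (simp add: pd_mult smooth_differentiable smooth_plane_wave s\<Psi> pd_plane_wave algebra_simps)
  have neq: "exp (\<i> * of_real (\<theta> $ j)) \<noteq> 1" by (simp add: \<theta>_def axis_def exp_i_neq_1)
  \<comment> \<open>The test function is smooth, so its weak gradient is the classical one.\<close>
  have "0 = l2_inner_vec (\<lambda>y. a y *v (plane_wave \<theta> y *s X)) (grad \<phi>)"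
    using orthogonal_if_a_hom_eq_mean[OF neq _ \<phi>V] hom by (simp add: \<theta>_def)
  also have "\<dots> = l2_inner_vec (\<lambda>y. a y *v (plane_wave \<theta> y *s X)) (classical_grad \<phi>)"
    by (intro l2_inner_vec_cong apply_L2 plane_wave_L2 grad_L2[OF perp_subset[OF \<phi>V]] classical_grad_L2 s\<phi> refl
      grad_smooth[OF s\<phi> perp_subset[OF \<phi>V]])
  also have "\<dots> = (\<Sum>p\<in>UNIV. l2_inner (\<lambda>y. ?aX y $ p) (\<lambda>y. classical_grad \<Psi> y $ p + \<i> * of_real (\<theta> $ snd p) * \<Psi> y $ fst p))"
    unfolding l2_inner_vec_def
  proof (rule sum.cong[OF refl])
    fix p :: "'n \<times> 'd"
    have "plane_wave \<theta> y * z * cnj (plane_wave \<theta> y * w) = z * cnj w" for y z w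
      using plane_wave_mult_cnj[of \<theta> y] by (simp add: mult_ac mult.left_commute[of "plane_wave \<theta> y"])
    then show "l2_inner (\<lambda>y. (a y *v (plane_wave \<theta> y *s X)) $ p) (\<lambda>y. classical_grad \<phi> y $ p) =
      l2_inner (\<lambda>y. ?aX y $ p) (\<lambda>y. classical_grad \<Psi> y $ p + \<i> * of_real (\<theta> $ snd p) * \<Psi> y $ fst p)"
      unfolding l2_inner_def matrix_vector_mult_smult vector_smult_component cg by (simp only:)
  qed
  also have "\<dots> = (\<Sum>p\<in>UNIV. l2_inner (\<lambda>y. ?aX y $ p) (\<lambda>y. classical_grad \<Psi> y $ p) +
      l2_inner (\<lambda>y. ?aX y $ p) (\<lambda>y. \<i> * of_real (\<theta> $ snd p) * \<Psi> y $ fst p))"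
    by (intro sum.cong refl l2_inner_add_right aXp L2_complex_mult L2_smooth[OF s\<Psi>(1)] L2_vec_iff[THEN iffD1, OF cg\<Psi>, rule_format])
  also have "\<dots> = l2_inner_vec ?aX (classical_grad \<Psi>) +
      (\<Sum>p\<in>UNIV. l2_inner (\<lambda>y. ?aX y $ p) (\<lambda>y. \<i> * of_real (\<theta> $ snd p) * \<Psi> y $ fst p))"
    by (simp add: sum.distrib l2_inner_vec_def)
  also have "l2_inner_vec ?aX (classical_grad \<Psi>) = l2_inner_vec ?aX (grad \<Psi>)"
    by (intro l2_inner_vec_cong aX cg\<Psi> grad_L2[OF \<Psi>V] refl grad_smooth[OF s\<Psi>(1) \<Psi>V, symmetric])
  also have "\<dots> = 0"
  proof -
    have "l2_inner_vec (grad \<Psi>) ?aX = 0"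
      using ker \<Psi>V by (simp add: ker_div_per_def div_per_def grad_per_adjoint_def l2_inner_vec_def l2_inner_def)
    then show ?thesis using l2_inner_vec_commute[of "grad \<Psi>" ?aX] by simp
  qed
  also have "(\<Sum>p\<in>UNIV. l2_inner (\<lambda>y. ?aX y $ p) (\<lambda>y. \<i> * of_real (\<theta> $ snd p) * \<Psi> y $ fst p)) =
      (\<Sum>p\<in>UNIV. if p = (i, j) then - \<i> * l2_inner (\<lambda>y. ?aX y $ (i, j)) \<psi> else 0)"
  proof (rule sum.cong[OF refl])
    fix p :: "'n \<times> 'd"
    show "l2_inner (\<lambda>y. ?aX y $ p) (\<lambda>y. \<i> * of_real (\<theta> $ snd p) * \<Psi> y $ fst p) =
      (if p = (i, j) then - \<i> * l2_inner (\<lambda>y. ?aX y $ (i, j)) \<psi> else 0)"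
    proof (cases "p = (i, j)")
      case True
      have "?aX y $ p * cnj (\<i> * of_real (\<theta> $ snd p) * \<Psi> y $ fst p) = - \<i> * (?aX y $ (i, j) * cnj (\<psi> y))" for y
        using True by (simp add: \<theta>_def axis_def \<Psi>_def)
      then show ?thesis using True by (simp only: l2_inner_def integral_mult_right_zero if_True simp_thms)
    next
      case False
      have "\<i> * of_real (\<theta> $ snd p) * \<Psi> y $ fst p = 0" for y
        using False by (cases p) (auto simp: \<theta>_def axis_def \<Psi>_def)
      then show ?thesis using False by (simp only: l2_inner_def) simp
    qed
  qed
  finally show ?thesis by simp
qed

text \<open>An arbitrary periodic function becomes admissible after its mean is subtracted, so the entry minus its own
mean is orthogonal to all of them.\<close>

lemma column_constant:
  assumes ker: "(\<lambda>y. a y *v X) \<in> ker_div_per" and hom: "a_hom a (axis j 1) X = mean X"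
  shows "\<exists>c. AE y in cell. (a y *v X) $ (i, j) = c"
proof -
  define v where "v y = (a y *v X) $ (i, j)" for y
  define c where "c = (LINT y|cell. v y)"
  have "(\<lambda>y. a y *v X) \<in> L2" by (intro apply_L2 L2_continuous continuous_intros)
  then have v: "v \<in> L2" unfolding v_def by (simp add: L2_vec_iff)
  have "AE y in cell. v y - c = 0"
  proof (rule fundamental_lemma_periodic)
    show "integrable cell (\<lambda>y. v y - c)"
      by (intro L2_integrable_self L2_diff v L2_continuous continuous_intros)
    fix \<psi> :: "real ^ 'd \<Rightarrow> real"
    assume \<psi>: "smooth (\<lambda>y. complex_of_real (\<psi> y))" "quasi_periodic 0 (\<lambda>y. complex_of_real (\<psi> y))"
    define m where "m = (LINT y|cell. \<psi> y)"
    have i\<psi>: "integrable cell (\<lambda>y. complex_of_real (\<psi> y))" by (intro integrable_cell_continuous smooth_continuous_on \<psi>)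
    have m: "(LINT y|cell. complex_of_real (\<psi> y)) = of_real m" by (simp add: m_def)
    have iv: "integrable cell v" "integrable cell (\<lambda>y. v y * complex_of_real (\<psi> y))"
      by (intro L2_integrable_self v, intro L2_product_integrable v L2_smooth \<psi>)
    have "l2_inner v (\<lambda>y. complex_of_real (\<psi> y) - of_real m) = 0"
      unfolding v_def
    proof (rule column_orthogonal_mean_zero[OF ker hom])
      show "smooth (\<lambda>y. complex_of_real (\<psi> y) - of_real m)" by (intro smooth_diff \<psi> smooth_const)
      show "quasi_periodic 0 (\<lambda>y. complex_of_real (\<psi> y) - of_real m)"
        using \<psi>(2) by (simp add: quasi_periodic_def)
      show "(LINT y|cell. complex_of_real (\<psi> y) - of_real m) = 0"
        using i\<psi> by (subst Bochner_Integration.integral_diff) (auto simp: m integrable_cell_continuous simp del: integral_complex_of_real lebesgue_integral_const)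
    qed
    also have "l2_inner v (\<lambda>y. complex_of_real (\<psi> y) - of_real m) = (LINT y|cell. v y * complex_of_real (\<psi> y) - of_real m * v y)"
      by (simp add: l2_inner_def algebra_simps)
    also have "\<dots> = (LINT y|cell. v y * complex_of_real (\<psi> y)) - of_real m * c"
      using iv by (simp add: c_def)
    finally have "(LINT y|cell. v y * complex_of_real (\<psi> y)) = of_real m * c" by simp
    moreover have "(LINT y|cell. (v y - c) * complex_of_real (\<psi> y)) = (LINT y|cell. v y * complex_of_real (\<psi> y)) - c * of_real m"
      unfolding left_diff_distrib using iv i\<psi> by (simp add: m[symmetric] del: integral_complex_of_real)
    ultimately show "(LINT y|cell. (v y - c) * complex_of_real (\<psi> y)) = 0" by simp
  qed
  then show ?thesis unfolding v_def by (intro exI[of _ c]) simp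
qed

end

lemma AE_lebesgue_iff_negligible: "(AE x in lebesgue. P x) \<longleftrightarrow> negligible {x. \<not> P x}"
proof
  assume "AE x in lebesgue. P x"
  then obtain N where "N \<in> null_sets lebesgue" "{x. \<not> P x} \<subseteq> N"
    by (auto simp: eventually_ae_filter)
  then show "negligible {x. \<not> P x}" by (simp add: negligible_iff_null_sets[symmetric] negligible_subset)
next
  assume "negligible {x. \<not> P x}"
  then show "AE x in lebesgue. P x" by (intro AE_I'[of "{x. \<not> P x}"]) (auto simp: negligible_iff_null_sets)
qed

text \<open>The lattice translates of the closed cell cover the space, and there are countably many of them. The faces
of the cell form a null set.\<close>

lemma periodic_constant_on_cell:
  fixes a :: "real ^ 'd \<Rightarrow> 'b"
  assumes per: "\<And>k. AE x in lebesgue. a (x + lattice_vec k) = a x" and A: "AE y in cell. a y = A"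
  shows "AE x in lebesgue. a x = A"
proof -
  have "AE x in lebesgue. x \<in> unit_cell \<longrightarrow> a x = A"
    using A by (subst (asm) AE_restrict_space_iff) auto
  then have "negligible {x. x \<in> unit_cell \<and> a x \<noteq> A}" by (simp add: AE_lebesgue_iff_negligible)
  then have "negligible ({x. x \<in> unit_cell \<and> a x \<noteq> A} \<union> (cbox 0 (\<chi> i. 1) - box 0 (\<chi> i. 1)))"
    using negligible_frontier_interval[of 0 "\<chi> i. 1 :: real ^ 'd"] by (auto simp: negligible_Un)
  then have neg: "negligible {x. x \<in> cbox 0 (\<chi> i. 1) \<and> a x \<noteq> A}"
    by (rule negligible_subset) (auto simp: unit_cell_box)
  have cell_k: "AE x in lebesgue. x + lattice_vec k \<in> cbox 0 (\<chi> i. 1) \<longrightarrow> a (x + lattice_vec k) = A" for k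
    unfolding AE_lebesgue_iff_negligible
  proof (rule negligible_subset[OF negligible_translation[OF neg, of "- lattice_vec k"]])
    show "{x. \<not> (x + lattice_vec k \<in> cbox 0 (\<chi> i. 1) \<longrightarrow> a (x + lattice_vec k) = A)} \<subseteq>
        (+) (- lattice_vec k) ` {x. x \<in> cbox 0 (\<chi> i. 1) \<and> a x \<noteq> A}"
      by (force simp: image_iff)
  qed
  have "AE x in lebesgue. \<forall>k :: int ^ 'd. a (x + lattice_vec k) = a x \<and> (x + lattice_vec k \<in> cbox 0 (\<chi> i. 1) \<longrightarrow> a (x + lattice_vec k) = A)"
    unfolding AE_all_countable using per cell_k by auto
  then show ?thesis
  proof eventually_elim
    case (elim x)
    define k :: "int ^ 'd" where "k = (\<chi> i. - \<lfloor>x $ i\<rfloor>)"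
    have "x + lattice_vec k \<in> cbox 0 (\<chi> i. 1)"
      by (auto simp: mem_box_cart k_def lattice_vec_def) (smt (verit) real_of_int_floor_add_one_ge of_int_floor_le)+
    then show ?case using elim[rule_format, of k] by metis
  qed
qed

theorem proposition4p5:
  fixes a :: "real ^ 'd \<Rightarrow> complex ^ ('n::finite \<times> 'd::finite) ^ ('n::finite \<times> 'd::finite)"
  assumes "a \<in> M_per"
    and "AE x in lebesgue. a x = cadjoint (a x)"
    and "\<And>X. (\<lambda>y. a y *v X) \<in> ker_div_per"
  shows "(\<forall>\<theta>\<in>theta_cell - {0}. a_hom a \<theta> = a_hom a 0) \<longleftrightarrow>
         (\<exists>A. AE x in lebesgue. a x = A)"
proof -
  obtain C \<nu> where a: "a \<in> borel_measurable lebesgue" "AE x in lebesgue. norm (a x) \<le> C"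
    "\<And>k. AE x in lebesgue. a (x + lattice_vec k) = a x" "0 < \<nu>"
    "AE x in lebesgue. pos_semidef (re_part (a x) - \<nu> *\<^sub>R mat 1)"
    using assms(1) unfolding M_per_def by blast
  have on_cell: "AE x in cell. P x" if "AE x in lebesgue. P x" for P :: "real ^ 'd \<Rightarrow> bool"
    using that by (subst AE_restrict_space_iff) auto
  interpret homogenisation a C \<nu>
    by unfold_locales (use a assms(2) in \<open>auto intro: measurable_restrict_space1 on_cell\<close>)
  have hom0: "a_hom a 0 X = mean X" for X
  proof (rule a_hom_eq_mean)
    fix \<phi> :: "real ^ 'd \<Rightarrow> complex ^ 'n" assume "\<phi> \<in> power_space (H1_theta_perp 0)"
    then have "\<phi> \<in> power_space (H1_theta 0)" by (rule perp_subset)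
    then have "l2_inner_vec (grad \<phi>) (\<lambda>y. a y *v X) = 0"
      using assms(3)[of X] by (simp add: ker_div_per_def div_per_def grad_per_adjoint_def l2_inner_vec_def l2_inner_def)
    then have "l2_inner_vec (\<lambda>y. a y *v X) (grad \<phi>) = 0"
      using l2_inner_vec_commute[of "grad \<phi>" "\<lambda>y. a y *v X"] by simp
    then show "l2_inner_vec (\<lambda>y. a y *v (plane_wave 0 y *s X)) (grad \<phi>) = 0"
      by (simp add: plane_wave_def)
  qed
  show ?thesis
  proof
    assume "\<exists>A. AE x in lebesgue. a x = A"
    then obtain A where "AE x in cell. a x = A" using on_cell by blast
    then have "a_hom a \<theta> X = mean X" for \<theta> X
      by (intro a_hom_eq_mean constant_orthogonal)
    then show "\<forall>\<theta>\<in>theta_cell - {0}. a_hom a \<theta> = a_hom a 0" by (auto simp: hom0)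
  next
    assume hom: "\<forall>\<theta>\<in>theta_cell - {0}. a_hom a \<theta> = a_hom a 0"
    \<comment> \<open>One frequency for each column suffices.\<close>
    have "axis j 1 \<in> theta_cell - {0 :: real ^ 'd}" for j
      using pi_gt3 by (auto simp: theta_cell_def axis_def vec_eq_iff)
    then have "a_hom a (axis j 1) X = mean X" for j X using hom hom0 by metis
    then have "\<exists>c. AE y in cell. (a y *v X) $ (i, j) = c" for X i j
      by (intro column_constant assms(3))
    then have "\<exists>c. AE y in cell. (a y *v X) $ r = c" for X r by (cases r) auto
    then obtain c where c: "\<And>X r. AE y in cell. (a y *v X) $ r = c X r" by metis
    define A :: "complex ^ ('n \<times> 'd) ^ ('n \<times> 'd)" where "A = (\<chi> r s. c (axis s 1) r)"
    have "AE y in cell. \<forall>s\<in>UNIV. \<forall>r\<in>UNIV. (a y *v axis s 1) $ r = A $ r $ s"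
      using c by (intro AE_finite_allI) (simp_all add: A_def)
    then have "AE y in cell. a y = A"
    proof eventually_elim
      case (elim y)
      have "(a y *v axis s 1) $ r = a y $ r $ s" for r s
        by (simp add: matrix_vector_mult_def axis_def if_distrib cong: if_cong)
      then have "a y $ r $ s = A $ r $ s" for r s using elim by (metis UNIV_I)
      then show ?case unfolding vec_eq_iff by blast
    qed
    then show "\<exists>A. AE x in lebesgue. a x = A" using periodic_constant_on_cell[OF a(3)] by blast
  qed
qed

end
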